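(* Let $G$ be a finite graph with a Schrödinger operator $\mathcal H$ and let $\theta\in\mathbb R$. If $G$ is $\theta$-phobic, then for every normal cover $G_\Gamma$ of $G$ we have $\theta\notin\operatorname{Spec}G_\Gamma$. In fact $\theta$ lies in a gap of the spectrum of $G_\Gamma$, in the sense that there exist $\theta_1,\theta_2\in\operatorname{Spec}G_\Gamma$ with $\theta_1<\theta<\theta_2$. In particular, the spectrum of any normal cover of $G$ is disconnected.
   Context: Graphs are multigraphs: parallel edges and loops are allowed. $\vec E(G)$ is the set of edges with both orientations (a loop also has two distinct orientations); $\bar e$ is the reverse of $e$, and $o(e),t(e)$ are its origin and terminus. A Schrödinger operator on a finite graph $G=(V,E)$ is $\mathcal H=\sum_{e\in\vec E}w_eA_e+\mathcal V$ on $\ell^2(V)$, where $A_e$ is the matrix with $1$ in entry $(o(e),t(e))$ and $0$ elsewhere (so a loop contributes twice to its diagonal entry), $w_{\bar e}=\overline{w_e}\neq0$, and $\mathcal V=\mathrm{diag}(\mathcal V_v)_{v\in V}$ is real. Subgraphs carry the restricted operator. Normal covers are viewed as derived voltage graphs: given a group $\Gamma$ and $g_e\in\Gamma$ for $e\in\vec E(G)$ with $g_{\bar e}=g_e^{-1}$, the graph $G_\Gamma$ has vertex set $V(G)\times\Gamma$ and, for each $e\in\vec E(G)$ and $x\in\Gamma$, an oriented edge from $(o(e),x)$ to $(t(e),xg_e)$ (whose reverse is the oriented edge over $\bar e$ starting at $(t(e),xg_e)$). Every connected normal cover of a connected graph with deck group $\Gamma$ is of this form. The lifted operator on $\ell^2(V(G)\times\Gamma)$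 is $(\mathcal H_\Gamma f)(v,x)=\sum_{e\in\vec E(G):\,o(e)=v}w_ef(t(e),xg_e)+\mathcal V_vf(v,x)$, and $\operatorname{Spec}G_\Gamma$ is the spectrum of $\mathcal H_\Gamma$. A matching $M$ of $G$ is a set of pairwise vertex-disjoint non-loop edges (the empty matching is allowed), $V(M)$ its set of covered vertices, $\vec E(M)$ its edges with both orientations; $\mathcal M_G$ is the set of matchings. The generalised matching polynomial is $m_G(x)=\sum_{M\in\mathcal M_G}(-1)^{|E(M)|}\prod_{e\in\vec E(M)}w_e\prod_{u\in V\setminus V(M)}(x-\mathcal V_u)$; it equals $1$ for the empty graph. $\mathcal C(G)$ is the set of $2$-regular subgraphs of $G$, including the empty one (a loop is a cycle of length one, two parallel edges form a cycle of length two). $G\setminus\gamma$ is obtained by deleting all vertices of $\gamma$ and all edges incident to them. $G$ is $\theta$-phobic (with respect to $\mathcal H$) if $G$ is not a forest, $m_G(\theta)\neq0$, and $m_{G\setminus\gamma}(\theta)=0$ for every non-empty $\gamma\in\mathcal C(G)$. *)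

theory Defs
  imports
    "HOL-Analysis.Analysis"
    "HOL-Computational_Algebra.Polynomial"
    "HOL-Algebra.Group"
    "Graph_Theory.Bidirected_Digraph"
    "Graph_Theory.Digraph_Component"
begin

text \<open>
  Multigraphs are bidirected digraphs in the sense of \<^locale>\<open>bidirected_digraph\<close>: the arcs of
  \<open>G\<close> are the edges with both orientations, \<open>tail G a\<close> and \<open>head G a\<close> are the origin and terminus
  of \<open>a\<close>, and \<open>arev\<close> is the reversal. It has no fixed point on the arcs, so that a loop consists of
  two distinct arcs. The potential of a Schroedinger operator is an arbitrary real function
  \<open>V\<close> on vertices and therefore does not occur in the following locale.
\<close>

locale schroedinger_weights = bidirected_digraph G arev
  for G :: "('v, 'e) pre_digraph" and arev :: "'e \<Rightarrow> 'e" +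
  fixes w :: "'e \<Rightarrow> complex"
  assumes weight_arev: "a \<in> arcs G \<Longrightarrow> w (arev a) = cnj (w a)"
    and weight_nonzero: "a \<in> arcs G \<Longrightarrow> w a \<noteq> 0"

text \<open>
  \<^term>\<open>out_arcs G v\<close> contains both orientations of a loop at \<open>v\<close>. The value outside
  \<^term>\<open>verts G\<close> is \<open>0\<close> because functions on a set are represented as total functions that vanish
  outside it.
\<close>

definition schroedinger_op ::
  "('v, 'e) pre_digraph \<Rightarrow> ('e \<Rightarrow> complex) \<Rightarrow> ('v \<Rightarrow> real) \<Rightarrow> ('v \<Rightarrow> complex) \<Rightarrow> 'v \<Rightarrow> complex" where
  "schroedinger_op G w V f = (\<lambda>v. if v \<in> verts G
     then (\<Sum>a\<in>out_arcs G v. w a * f (head G a)) + complex_of_real (V v) * f v else 0)"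


section \<open>Square-summable functions and the spectrum\<close>

definition ell2 :: "'a set \<Rightarrow> ('a \<Rightarrow> complex) set" where
  "ell2 S = {f. (\<forall>p. p \<notin> S \<longrightarrow> f p = 0) \<and> (\<lambda>p. (cmod (f p))\<^sup>2) summable_on S}"

definition ell2_norm :: "'a set \<Rightarrow> ('a \<Rightarrow> complex) \<Rightarrow> real" where
  "ell2_norm S f = sqrt (\<Sum>\<^sub>\<infinity>p\<in>S. (cmod (f p))\<^sup>2)"

definition ell2_bounded_operator :: "'a set \<Rightarrow> (('a \<Rightarrow> complex) \<Rightarrow> 'a \<Rightarrow> complex) \<Rightarrow> bool" where
  "ell2_bounded_operator S T \<longleftrightarrow>
     (\<forall>f\<in>ell2 S. T f \<in> ell2 S) \<and>
     (\<forall>f\<in>ell2 S. \<forall>h\<in>ell2 S. T (\<lambda>p. f p + h p) = (\<lambda>p. T f p + T h p)) \<and>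
     (\<forall>c. \<forall>f\<in>ell2 S. T (\<lambda>p. c * f p) = (\<lambda>p. c * T f p)) \<and>
     (\<exists>C. \<forall>f\<in>ell2 S. ell2_norm S (T f) \<le> C * ell2_norm S f)"

text \<open>The numbers \<open>z\<close> for which \<open>T - z\<close> has no bounded two-sided inverse \<open>R\<close>.\<close>

definition ell2_spectrum :: "'a set \<Rightarrow> (('a \<Rightarrow> complex) \<Rightarrow> 'a \<Rightarrow> complex) \<Rightarrow> complex set" where
  "ell2_spectrum S T = {z. \<not> (\<exists>R. ell2_bounded_operator S R \<and>
     (\<forall>f\<in>ell2 S. R (\<lambda>p. T f p - z * f p) = f \<and>
                 (\<lambda>p. T (R f) p - z * R f p) = f))}"


section \<open>Normal covers as derived voltage graphs\<close>

definition voltage_assignment ::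
  "('v, 'e) pre_digraph \<Rightarrow> ('e \<Rightarrow> 'e) \<Rightarrow> ('g, 'm) monoid_scheme \<Rightarrow> ('e \<Rightarrow> 'g) \<Rightarrow> bool" where
  "voltage_assignment G arev \<Gamma> g \<longleftrightarrow>
     (\<forall>a\<in>arcs G. g a \<in> carrier \<Gamma> \<and> g (arev a) = inv\<^bsub>\<Gamma>\<^esub> (g a))"

definition derived_graph ::
  "('v, 'e) pre_digraph \<Rightarrow> ('g, 'm) monoid_scheme \<Rightarrow> ('e \<Rightarrow> 'g) \<Rightarrow> ('v \<times> 'g, 'e \<times> 'g) pre_digraph" where
  "derived_graph G \<Gamma> g =
     \<lparr> verts = verts G \<times> carrier \<Gamma>,
       arcs = arcs G \<times> carrier \<Gamma>,
       tail = (\<lambda>(a, x). (tail G a, x)),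
       head = (\<lambda>(a, x). (head G a, x \<otimes>\<^bsub>\<Gamma>\<^esub> g a)) \<rparr>"

text \<open>The locale \<^locale>\<open>bidirected_digraph\<close> asks the reversal to be the identity off the arcs.\<close>

definition derived_arev ::
  "('v, 'e) pre_digraph \<Rightarrow> ('e \<Rightarrow> 'e) \<Rightarrow> ('g, 'm) monoid_scheme \<Rightarrow> ('e \<Rightarrow> 'g) \<Rightarrow> 'e \<times> 'g \<Rightarrow> 'e \<times> 'g" where
  "derived_arev G arev \<Gamma> g = (\<lambda>(a, x).
     if a \<in> arcs G \<and> x \<in> carrier \<Gamma> then (arev a, x \<otimes>\<^bsub>\<Gamma>\<^esub> g a) else (a, x))"

definition lifted_op ::
  "('v, 'e) pre_digraph \<Rightarrow> ('e \<Rightarrow> complex) \<Rightarrow> ('v \<Rightarrow> real) \<Rightarrow> ('g, 'm) monoid_scheme \<Rightarrow> ('e \<Rightarrow> 'g) \<Rightarrow>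
    ('v \<times> 'g \<Rightarrow> complex) \<Rightarrow> 'v \<times> 'g \<Rightarrow> complex" where
  "lifted_op G w V \<Gamma> g = schroedinger_op (derived_graph G \<Gamma> g) (w \<circ> fst) (V \<circ> fst)"

definition cover_spectrum ::
  "('v, 'e) pre_digraph \<Rightarrow> ('e \<Rightarrow> complex) \<Rightarrow> ('v \<Rightarrow> real) \<Rightarrow> ('g, 'm) monoid_scheme \<Rightarrow> ('e \<Rightarrow> 'g) \<Rightarrow>
    complex set" where
  "cover_spectrum G w V \<Gamma> g = ell2_spectrum (verts (derived_graph G \<Gamma> g)) (lifted_op G w V \<Gamma> g)"

lemma lifted_op_apply:
  assumes "v \<in> verts G" "x \<in> carrier \<Gamma>"
  shows "lifted_op G w V \<Gamma> g f (v, x) =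
    (\<Sum>a\<in>out_arcs G v. w a * f (head G a, x \<otimes>\<^bsub>\<Gamma>\<^esub> g a)) + complex_of_real (V v) * f (v, x)"
proof -
  have "out_arcs (derived_graph G \<Gamma> g) (v, x) = (\<lambda>a. (a, x)) ` out_arcs G v"
    using assms by (auto simp: derived_graph_def out_arcs_def)
  moreover have "inj_on (\<lambda>a. (a, x)) (out_arcs G v)"
    by (auto simp: inj_on_def)
  ultimately show ?thesis
    using assms by (simp add: lifted_op_def schroedinger_op_def sum.reindex derived_graph_def)
qed

lemma schroedinger_weights_derived_graph:
  assumes "schroedinger_weights G arev w" "group \<Gamma>" "voltage_assignment G arev \<Gamma> g"
  shows "schroedinger_weights (derived_graph G \<Gamma> g) (derived_arev G arev \<Gamma> g) (w \<circ> fst)"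
proof -
  interpret schroedinger_weights G arev w by fact
  interpret \<Gamma>: group \<Gamma> by fact
  have g: "g a \<in> carrier \<Gamma>" "g (arev a) = inv\<^bsub>\<Gamma>\<^esub> (g a)" if "a \<in> arcs G" for a
    using assms(3) that by (auto simp: voltage_assignment_def)
  show ?thesis
    by unfold_locales
      (auto simp: derived_graph_def derived_arev_def g weight_arev weight_nonzero arev_neq
        arev_dom[symmetric] \<Gamma>.m_assoc split: prod.splits if_splits)
qed


section \<open>Matchings, cycles and phobic graphs\<close>

text \<open>
  An edge is the set \<^term>\<open>{a, arev a}\<close> of its two orientations, so \<^term>\<open>\<Union>M\<close> is the set of
  orientations of the edges in \<open>M\<close>. For a subgraph of \<open>G\<close> that is closed under reversal, the
  reversal, weights and potential of \<open>G\<close> are used; only their values on the subgraph matter.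
\<close>

definition edges :: "('v, 'e) pre_digraph \<Rightarrow> ('e \<Rightarrow> 'e) \<Rightarrow> 'e set set" where
  "edges G arev = (\<lambda>a. {a, arev a}) ` arcs G"

definition edge_ends :: "('v, 'e) pre_digraph \<Rightarrow> 'e set \<Rightarrow> 'v set" where
  "edge_ends G e = (\<Union>a\<in>e. {tail G a, head G a})"

definition matchings :: "('v, 'e) pre_digraph \<Rightarrow> ('e \<Rightarrow> 'e) \<Rightarrow> 'e set set set" where
  "matchings G arev = {M. M \<subseteq> edges G arev \<and>
     (\<forall>e\<in>M. \<forall>a\<in>e. tail G a \<noteq> head G a) \<and>
     (\<forall>e\<in>M. \<forall>e'\<in>M. e \<noteq> e' \<longrightarrow> edge_ends G e \<inter> edge_ends G e' = {})}"

definition matching_poly ::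
  "('v, 'e) pre_digraph \<Rightarrow> ('e \<Rightarrow> 'e) \<Rightarrow> ('e \<Rightarrow> complex) \<Rightarrow> ('v \<Rightarrow> real) \<Rightarrow> complex poly" where
  "matching_poly G arev w V =
     (\<Sum>M\<in>matchings G arev. smult ((-1) ^ card M * (\<Prod>a\<in>\<Union>M. w a))
        (\<Prod>u\<in>verts G - (\<Union>e\<in>M. edge_ends G e). [:- complex_of_real (V u), 1:]))"

text \<open>
  Counting the arcs of \<open>H\<close> that leave \<open>v\<close> gives the degree in the undirected sense, with loops
  counted twice.
\<close>

definition two_regular_subgraphs ::
  "('v, 'e) pre_digraph \<Rightarrow> ('e \<Rightarrow> 'e) \<Rightarrow> ('v, 'e) pre_digraph set" where
  "two_regular_subgraphs G arev =
     {H. subgraph H G \<and> arev ` arcs H \<subseteq> arcs H \<and> (\<forall>v\<in>verts H. out_degree H v = 2)}"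

text \<open>
  The constant \<^const>\<open>forest\<close> of the imported library is not suitable here: it excludes all directed
  cycles, including \<open>[a, arev a]\<close>. In a graph cycle no edge is traversed in both directions; loops
  and pairs of parallel edges do form cycles.
\<close>

definition graph_cycle :: "('v, 'e) pre_digraph \<Rightarrow> ('e \<Rightarrow> 'e) \<Rightarrow> 'e list \<Rightarrow> bool" where
  "graph_cycle G arev p \<longleftrightarrow> pre_digraph.cycle G p \<and> (\<forall>a\<in>set p. arev a \<notin> set p)"

definition is_forest :: "('v, 'e) pre_digraph \<Rightarrow> ('e \<Rightarrow> 'e) \<Rightarrow> bool" where
  "is_forest G arev \<longleftrightarrow> (\<nexists>p. graph_cycle G arev p)"

definition phobic ::
  "real \<Rightarrow> ('v, 'e) pre_digraph \<Rightarrow> ('e \<Rightarrow> 'e) \<Rightarrow> ('e \<Rightarrow> complex) \<Rightarrow> ('v \<Rightarrow> real) \<Rightarrow> bool" where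
  "phobic \<theta> G arev w V \<longleftrightarrow>
     \<not> is_forest G arev \<and>
     poly (matching_poly G arev w V) (complex_of_real \<theta>) \<noteq> 0 \<and>
     (\<forall>\<gamma>\<in>two_regular_subgraphs G arev. verts \<gamma> \<noteq> {} \<longrightarrow>
        poly (matching_poly (G \<restriction> (verts G - verts \<gamma>)) arev w V) (complex_of_real \<theta>) = 0)"

end

theory Submission
  imports Defs
begin

text \<open>Put \<open>d = \<theta> - V\<close> and write \<mu>(T) for
  \<open>matching_value d T\<close>, the matching polynomial at \<theta> of the subgraph induced on
  T. Twist the finite matrix of \<theta> minus the Schroedinger operator by nonzero complex voltages
  on the arcs. Its determinant is a sum over oriented 2-regular subgraphs C; each contributes its
  monomial in the voltages, times a nonzero constant, times \<mu> of the graph without C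
  (\<open>schroedinger_det_cycles\<close>). Hence for a phobic graph the determinant is the same
  nonzero number \<mu>(verts G) for all voltages. For a commutative deck group this would nearly
  finish the proof; for a general group there is no determinant, and the operator on the cover is
  inverted by elimination along the graph instead.

  The combinatorial heart is \<open>exists_leaf\<close>: if U is nonempty, \<mu>(U) is nonzero and
  all nonempty cycles in U contribute zero, then some vertex of U has at most one arc inside U. A
  leaf u with \<open>d u\<close> nonzero is removed by a Schur complement. The translations along
  its edge and back cancel, so only the real number \<open>d\<close> at its neighbour changes. If
  \<open>d u = 0\<close>, then u is removed together with its neighbour. In both cases \<mu> changes
  by a nonzero factor, so the hypotheses survive (\<open>elimination_induct\<close>). Reversing the
  elimination shows that \<theta> minus the lifted operator is bounded below and onto
  (\<open>regular_if_cycles_vanish\<close>). A cycle never meets a vertex with at most one arc, so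
  if the graph contains a cycle, then a leaf with \<open>d u = 0\<close> must occur at some stage;
  its block has a zero on the diagonal and makes the quadratic form indefinite
  (\<open>indefinite_if_cycle\<close>).

  The leaf is found as follows. By a Heilmann-Lieb inequality, if cycles vanish in T and in T - {a},
  they vanish in T - {a, b} for every neighbour b of a (\<open>cycles_vanish_remove_edge\<close>).
  Starting at a vertex c such that cycles still vanish in U - {c}, one grows paths whose deletion
  keeps \<mu> nonzero. A longest such path ends in a leaf, since another arc at its end would extend
  it or close a forbidden cycle (\<open>exists_leaf_of_start\<close>).

  The vertex c comes from the constant determinant (\<open>exists_vanishing_start\<close>). Let D_a,
  D_b and r be the determinants on U - {a}, U - {b} and U - {a, b} for an edge e from a to b.
  Jacobi's identity becomes D_a D_b = r (\<mu>(U) + |w_e|^2 r). Comparing degrees in the voltage of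
  a single arc f shows that if f occurs in D_a, it occurs in D_b, provided that D_b is not
  identically zero. If no c existed, the arcs of some nonempty cycle C would occur in D_b for all b
  in a union K of components of U; so C avoids K, and multiplicativity of \<mu> makes \<mu>(U - C)
  nonzero, a contradiction.

  Finally, a bounded symmetric operator has approximate eigenvalues at both ends of its numerical
  range, and invertibility at \<theta> spreads along the whole line Re z = \<theta>, which therefore
  separates the spectrum (\<open>spectral_gap\<close>).\<close>

section \<open>Determinants indexed by finite sets\<close>

text \<open>Indexing by a set makes principal minors the same matrix on a smaller set, so that
  deleting vertices of a graph requires no renumbering.\<close>

definition set_det :: "'a set \<Rightarrow> ('a \<Rightarrow> 'a \<Rightarrow> complex) \<Rightarrow> complex" where
  "set_det S A = (\<Sum>p | p permutes S. of_int (sign p) * (\<Prod>i\<in>S. A i (p i)))"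

definition unit_row :: "'a \<Rightarrow> 'a \<Rightarrow> complex" where
  "unit_row a = (\<lambda>j. if j = a then 1 else 0)"

lemma set_det_cong:
  assumes "\<And>i j. i \<in> S \<Longrightarrow> j \<in> S \<Longrightarrow> A i j = B i j"
  shows "set_det S A = set_det S B"
  unfolding set_det_def
  by (intro sum.cong refl arg_cong2[where f = "(*)"] prod.cong)
    (auto intro!: assms simp: permutes_in_image)

lemma set_det_upd:
  assumes "finite S" "a \<in> S"
  shows "set_det S (A(a := r)) =
    (\<Sum>p | p permutes S. of_int (sign p) * (r (p a) * (\<Prod>i\<in>S - {a}. A i (p i))))"
proof -
  have "(\<Prod>i\<in>S. (A(a := r)) i (p i)) = r (p a) * (\<Prod>i\<in>S - {a}. A i (p i))" for p
    using assms by (subst prod.remove[of S a]) (auto intro!: prod.cong)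
  then show ?thesis by (simp add: set_det_def)
qed

lemma set_det_row_sum:
  assumes "finite S" "a \<in> S" "finite I"
  shows "set_det S (A(a := (\<lambda>j. \<Sum>i\<in>I. c i * R i j))) = (\<Sum>i\<in>I. c i * set_det S (A(a := R i)))"
  using assms
  by (simp add: set_det_upd sum_distrib_left sum_distrib_right sum.swap[of _ I] mult_ac)

lemma set_det_row_add:
  assumes "finite S" "a \<in> S"
  shows "set_det S (A(a := (\<lambda>j. R j + c * Q j))) = set_det S (A(a := R)) + c * set_det S (A(a := Q))"
  using assms
  by (simp add: set_det_upd sum_distrib_left sum.distrib algebra_simps)

lemma set_det_equal_rows:
  assumes "finite S" "a \<in> S" "b \<in> S" "a \<noteq> b" "\<And>j. A a j = A b j"
  shows "set_det S A = 0"
proof -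
  let ?t = "Transposition.transpose a b"
  let ?f = "\<lambda>p. of_int (sign p) * (\<Prod>i\<in>S. A i (p i))"
  have t: "?t permutes S" using assms by (simp add: permutes_swap_id)
  have "set_det S A = (\<Sum>p | p permutes S. ?f (p \<circ> ?t))"
    unfolding set_det_def
    by (rule sum.reindex_bij_witness[where i = "\<lambda>p. p \<circ> ?t" and j = "\<lambda>p. p \<circ> ?t"])
      (auto intro: permutes_compose t simp: o_assoc[symmetric])
  also have "\<dots> = (\<Sum>p | p permutes S. - ?f p)"
  proof (rule sum.cong[OF refl])
    fix p assume "p \<in> {p. p permutes S}"
    then have p: "permutation p" using assms(1) by (auto simp: permutation_permutes)
    have "(\<Prod>i\<in>S. A i ((p \<circ> ?t) i)) = (\<Prod>i\<in>S. A (?t i) (p i))"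
      by (rule prod.reindex_bij_witness[where i = ?t and j = ?t])
        (use permutes_in_image[OF t] in auto)
    also have "\<dots> = (\<Prod>i\<in>S. A i (p i))"
      by (intro prod.cong refl) (auto simp: Transposition.transpose_def assms(5))
    finally show "?f (p \<circ> ?t) = - ?f p"
      using assms(4) p by (simp add: sign_compose permutation_swap_id sign_swap_id)
  qed
  also have "\<dots> = - set_det S A" by (simp add: set_det_def sum_negf)
  finally show ?thesis by simp
qed

lemma set_det_equal_columns:
  assumes "finite S" "a \<in> S" "b \<in> S" "a \<noteq> b" "\<And>i. i \<in> S \<Longrightarrow> A i a = A i b"
  shows "set_det S A = 0"
proof -
  let ?t = "Transposition.transpose a b"
  let ?f = "\<lambda>p. of_int (sign p) * (\<Prod>i\<in>S. A i (p i))"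
  have t: "?t permutes S" using assms by (simp add: permutes_swap_id)
  have "set_det S A = (\<Sum>p | p permutes S. ?f (?t \<circ> p))"
    unfolding set_det_def
    by (rule sum.reindex_bij_witness[where i = "\<lambda>p. ?t \<circ> p" and j = "\<lambda>p. ?t \<circ> p"])
      (auto intro: permutes_compose t simp: o_assoc)
  also have "\<dots> = (\<Sum>p | p permutes S. - ?f p)"
  proof (rule sum.cong[OF refl])
    fix p assume "p \<in> {p. p permutes S}"
    then have p: "permutation p" using assms(1) by (auto simp: permutation_permutes)
    have "(\<Prod>i\<in>S. A i ((?t \<circ> p) i)) = (\<Prod>i\<in>S. A i (p i))"
      by (intro prod.cong refl) (auto simp: Transposition.transpose_def assms(5))
    then show "?f (?t \<circ> p) = - ?f p"
      using assms(4) p by (simp add: sign_compose permutation_swap_id sign_swap_id)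
  qed
  also have "\<dots> = - set_det S A" by (simp add: set_det_def sum_negf)
  finally show ?thesis by simp
qed

lemma set_det_expand_column:
  assumes "finite S" "j \<in> S"
  shows "set_det S A = (\<Sum>i\<in>S. A i j * set_det S (A(i := unit_row j)))"
proof -
  have "(\<Sum>i\<in>S. A i j * set_det S (A(i := unit_row j))) =
      (\<Sum>i\<in>S. \<Sum>p | p permutes S. if p i = j then of_int (sign p) * (\<Prod>i\<in>S. A i (p i)) else 0)"
  proof (intro sum.cong refl)
    fix i assume i: "i \<in> S"
    have eq: "A i j * (unit_row j (p i) * (\<Prod>i\<in>S - {i}. A i (p i))) =
      (if p i = j then \<Prod>i\<in>S. A i (p i) else 0)" for p
      using assms i by (auto simp: unit_row_def prod.remove[of S i])
    have "A i j * set_det S (A(i := unit_row j)) = (\<Sum>p | p permutes S.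
        of_int (sign p) * (A i j * (unit_row j (p i) * (\<Prod>i\<in>S - {i}. A i (p i)))))"
      using assms i by (simp add: set_det_upd sum_distrib_left mult.left_commute)
    then show "A i j * set_det S (A(i := unit_row j)) = (\<Sum>p | p permutes S.
        if p i = j then of_int (sign p) * (\<Prod>i\<in>S. A i (p i)) else 0)"
      by (simp add: eq if_distrib cong: if_cong)
  qed
  also have "\<dots> = (\<Sum>p | p permutes S. \<Sum>i\<in>S.
      if p i = j then of_int (sign p) * (\<Prod>i\<in>S. A i (p i)) else 0)"
    by (rule sum.swap)
  also have "\<dots> = set_det S A"
    unfolding set_det_def
  proof (intro sum.cong refl)
    fix p assume "p \<in> {p. p permutes S}"
    then have p: "p permutes S" by simp
    have "p i = j \<longleftrightarrow> i = inv_into UNIV p j" for i using p by (metis permutes_inverses)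
    then show "(\<Sum>i\<in>S. if p i = j then of_int (sign p) * (\<Prod>i\<in>S. A i (p i)) else 0) =
      of_int (sign p) * (\<Prod>i\<in>S. A i (p i))"
      using assms permutes_in_image[OF permutes_inv[OF p]] by simp
  qed
  finally show ?thesis by simp
qed

lemma set_det_adjugate:
  assumes "finite S" "a \<in> S" "j \<in> S"
  shows "(\<Sum>i\<in>S. set_det S (A(i := unit_row a)) * A i j) = set_det S A * unit_row a j"
proof (cases "j = a")
  case True
  then show ?thesis using set_det_expand_column[OF assms(1,2), of A] by (simp add: unit_row_def mult.commute)
next
  case False
  \<comment> \<open>Column \<open>a\<close> is overwritten by column \<open>j\<close>. The cofactors
    along column \<open>a\<close> stay the same, because a permutation sending \<open>i\<close> to
    \<open>a\<close> reads column \<open>a\<close> in no other row, while the determinant vanishes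
    because two columns agree.\<close>
  define B where "B = (\<lambda>i k. if k = a then A i j else A i k)"
  have "set_det S (B(i := unit_row a)) = set_det S (A(i := unit_row a))" if i: "i \<in> S" for i
    unfolding set_det_upd[OF assms(1) i]
  proof (rule sum.cong[OF refl])
    fix p assume p: "p \<in> {p. p permutes S}"
    have "unit_row a (p i) * (\<Prod>i\<in>S - {i}. B i (p i)) = unit_row a (p i) * (\<Prod>i\<in>S - {i}. A i (p i))"
    proof (cases "p i = a")
      case True
      then have "p k \<noteq> a" if "k \<noteq> i" for k using p that by (auto dest: permutes_inj injD)
      then show ?thesis by (auto simp: B_def intro!: prod.cong)
    qed (simp add: unit_row_def)
    then show "of_int (sign p) * (unit_row a (p i) * (\<Prod>i\<in>S - {i}. B i (p i))) =
        of_int (sign p) * (unit_row a (p i) * (\<Prod>i\<in>S - {i}. A i (p i)))"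
      by (rule arg_cong)
  qed
  then have "set_det S B = (\<Sum>i\<in>S. A i j * set_det S (A(i := unit_row a)))"
    using set_det_expand_column[OF assms(1,2), of B] by (simp add: B_def)
  moreover have "set_det S B = 0"
    using assms False by (intro set_det_equal_columns[of S a j]) (auto simp: B_def)
  ultimately show ?thesis using False by (simp add: unit_row_def mult.commute)
qed

lemma set_det_remove:
  assumes "finite S" "a \<in> S"
  shows "set_det S (A(a := unit_row a)) = set_det (S - {a}) A"
proof -
  have "set_det S (A(a := unit_row a)) = (\<Sum>p | p permutes S \<and> p a = a.
      of_int (sign p) * (unit_row a (p a) * (\<Prod>i\<in>S - {a}. A i (p i))))"
    unfolding set_det_upd[OF assms]
    by (rule sum.mono_neutral_right) (auto simp: unit_row_def finite_permutations assms)
  also have "{p. p permutes S \<and> p a = a} = {p. p permutes (S - {a})}"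
    using assms permutes_superset[of _ S "S - {a}"] by (auto intro: permutes_subset permutes_not_in)
  also have "(\<Sum>p | p permutes (S - {a}). of_int (sign p) * (unit_row a (p a) * (\<Prod>i\<in>S - {a}. A i (p i)))) =
      set_det (S - {a}) A"
    unfolding set_det_def by (intro sum.cong refl) (simp add: unit_row_def permutes_not_in)
  finally show ?thesis .
qed

text \<open>Jacobi's identity for complementary minors of size two.\<close>

lemma set_det_Jacobi:
  assumes S: "finite S" "a \<in> S" "b \<in> S" "a \<noteq> b" and nz: "set_det S A \<noteq> 0"
  shows "set_det S A * set_det (S - {a, b}) A =
    set_det (S - {a}) A * set_det (S - {b}) A -
    set_det S (A(b := unit_row a)) * set_det S (A(a := unit_row b))"
proof -
  let ?D = "set_det S A"
  \<comment> \<open>By Cramer's rule \<open>x c\<close> is row \<open>c\<close> of the inverse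
    matrix, so it writes the unit row \<open>c\<close> as a combination of the rows of
    \<open>A\<close>.\<close>
  define x where "x = (\<lambda>c i. set_det S (A(i := unit_row c)) / ?D)"
  have unit: "unit_row c j = (\<Sum>i\<in>S. x c i * A i j)" if "c \<in> S" "j \<in> S" for c j
    using set_det_adjugate[OF S(1) that(1,2), of A] nz
    by (simp add: x_def sum_divide_distrib[symmetric])
  let ?B = "\<lambda>i k. A(a := A i, b := A k)"
  \<comment> \<open>In the multilinear expansion of rows \<open>a\<close> and \<open>b\<close> over
    the rows of \<open>A\<close>, every choice repeats a row except the original pair and its
    interchange.\<close>
  have zero: "set_det S (?B i k) = 0" if ik: "i \<in> S" "k \<in> S" "(i, k) \<noteq> (a, b)" "(i, k) \<noteq> (b, a)" for i k
  proof -
    consider "i = k" | "i \<noteq> a" "i \<noteq> b" | "k \<noteq> a" "k \<noteq> b" using ik by blast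
    then show ?thesis
    proof cases
      case 1 then show ?thesis using S by (intro set_det_equal_rows[of S a b]) auto
    next
      case 2 then show ?thesis using S ik by (intro set_det_equal_rows[of S a i]) auto
    next
      case 3 then show ?thesis using S ik by (intro set_det_equal_rows[of S b k]) auto
    qed
  qed
  have swap: "set_det S (?B b a) = - ?D"
  proof -
    have "0 = set_det S (A(a := (\<lambda>j. A a j + 1 * A b j), b := (\<lambda>j. A a j + 1 * A b j)))"
      using S by (intro set_det_equal_rows[of S a b, symmetric]) auto
    also have "\<dots> = set_det S (?B a a) + set_det S (?B b a) + (set_det S (?B a b) + set_det S (?B b b))"
      using S set_det_row_add[of S b "A(a := (\<lambda>j. A a j + 1 * A b j))" "A a" 1 "A b"]
        set_det_row_add[of S a "A(b := A a)" "A a" 1 "A b"]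
        set_det_row_add[of S a "A(b := A b)" "A a" 1 "A b"]
      by (simp add: fun_upd_twist del: fun_upd_triv)
    finally show ?thesis using zero[of a a] zero[of b b] S by (simp add: add_eq_0_iff)
  qed
  have "set_det (S - {a, b}) A = set_det (S - {a} - {b}) A"
    by (simp add: Diff_insert2[symmetric] insert_commute)
  also have "\<dots> = set_det (S - {a}) (A(b := unit_row b))"
    using S by (intro set_det_remove[symmetric]) auto
  also have "\<dots> = set_det S (A(b := unit_row b, a := unit_row a))"
    using S by (intro set_det_remove[symmetric]) auto
  also have "\<dots> = set_det S (A(a := (\<lambda>j. \<Sum>i\<in>S. x a i * A i j), b := (\<lambda>j. \<Sum>i\<in>S. x b i * A i j)))"
    by (rule set_det_cong) (use S in \<open>simp add: unit\<close>)
  also have "\<dots> = (\<Sum>k\<in>S. x b k * (\<Sum>i\<in>S. x a i * set_det S (?B i k)))"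
  proof -
    have "set_det S (A(a := (\<lambda>j. \<Sum>i\<in>S. x a i * A i j), b := A k)) = (\<Sum>i\<in>S. x a i * set_det S (?B i k))" for k
      using set_det_row_sum[of S a S "A(b := A k)" "x a" A] fun_upd_twist[OF S(4), of A]
      by (simp only: S)
    then show ?thesis
      using set_det_row_sum[of S b S "A(a := (\<lambda>j. \<Sum>i\<in>S. x a i * A i j))" "x b" A]
      by (simp only: S)
  qed
  also have "\<dots> = (\<Sum>k\<in>S. (if k = b then x a a * x b b * ?D else 0) + (if k = a then - x a b * x b a * ?D else 0))"
  proof (rule sum.cong[OF refl])
    fix k assume k: "k \<in> S"
    have "x a i * set_det S (?B i k) = (if i = a then if k = b then x a a * ?D else 0 else 0) +
        (if i = b then if k = a then - x a b * ?D else 0 else 0)" if i: "i \<in> S" for i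
    proof -
      consider "(i, k) = (a, b)" | "(i, k) = (b, a)" | "(i, k) \<noteq> (a, b)" "(i, k) \<noteq> (b, a)" by blast
      then show ?thesis
        by cases (use S zero[OF i k] swap in auto)
    qed
    then have "(\<Sum>i\<in>S. x a i * set_det S (?B i k)) =
        (if k = b then x a a * ?D else 0) + (if k = a then - x a b * ?D else 0)"
      by (simp only: sum.distrib sum.delta S if_True cong: sum.cong)
    then show "x b k * (\<Sum>i\<in>S. x a i * set_det S (?B i k)) =
        (if k = b then x a a * x b b * ?D else 0) + (if k = a then - x a b * x b a * ?D else 0)"
      using S(4) by auto
  qed
  also have "\<dots> = (x a a * x b b - x a b * x b a) * ?D"
    using S by (simp add: sum.distrib algebra_simps)
  finally have eq: "set_det (S - {a, b}) A = (x a a * x b b - x a b * x b a) * ?D" .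
  have off: "x c i * ?D = set_det S (A(i := unit_row c))" for c i
    using nz by (simp add: x_def)
  have "?D * set_det (S - {a, b}) A = (x a a * ?D) * (x b b * ?D) - (x a b * ?D) * (x b a * ?D)"
    unfolding eq by (simp add: algebra_simps)
  then show ?thesis unfolding off set_det_remove[OF S(1,2)] set_det_remove[OF S(1,3)] .
qed

section \<open>Matchings as reversal-closed arc sets, their recursion and a Heilmann-Lieb
  inequality\<close>

section \<open>Matching sums\<close>

locale fin_schroedinger = schroedinger_weights G arev w + fin_digraph G
  for G :: "('v, 'e) pre_digraph" and arev w
begin

text \<open>A matching is encoded by both orientations of its edges. For a set closed under
  reversal, injectivity of the tail makes the edges disjoint and also excludes loops, whose two arcs
  share their tail; the covered vertices are then just the tails.\<close>

definition arc_matchings :: "'v set \<Rightarrow> 'e set set" where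
  "arc_matchings T = {M. M \<subseteq> arcs G \<and> arev ` M \<subseteq> M \<and> inj_on (tail G) M \<and> tail G ` M \<subseteq> T}"

text \<open>Ring and arc coefficients are left open: the determinant leads to complex coefficients
  \<open>w e * z e\<close>, the inequality needs the real coefficients \<open>cmod (w e)\<close>.
  The two agree because only the products \<open>c e * c (arev e)\<close> enter.\<close>

definition matching_sum :: "('e \<Rightarrow> 'a::comm_ring_1) \<Rightarrow> ('v \<Rightarrow> 'a) \<Rightarrow> 'v set \<Rightarrow> 'a" where
  "matching_sum c d T = (\<Sum>M\<in>arc_matchings T.
     (-1) ^ (card M div 2) * (\<Prod>e\<in>M. c e) * (\<Prod>u\<in>T - tail G ` M. d u))"

definition arcs_into :: "'v \<Rightarrow> 'v set \<Rightarrow> 'e set" where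
  "arcs_into a T = {e \<in> arcs G. tail G e = a \<and> head G e \<in> T}"

lemma finite_arcs_into [simp]: "finite (arcs_into a T)"
  by (simp add: arcs_into_def)

lemma arc_matchingsD:
  assumes "M \<in> arc_matchings T"
  shows "M \<subseteq> arcs G" "e \<in> M \<Longrightarrow> arev e \<in> M" "inj_on (tail G) M" "e \<in> M \<Longrightarrow> tail G e \<in> T"
    "finite M" "e \<in> M \<Longrightarrow> head G e \<in> T" "e \<in> M \<Longrightarrow> head G e \<noteq> tail G e"
proof -
  show *: "M \<subseteq> arcs G" "e \<in> M \<Longrightarrow> arev e \<in> M" "inj_on (tail G) M" "e \<in> M \<Longrightarrow> tail G e \<in> T" for e
    using assms by (auto simp: arc_matchings_def)
  show "finite M" using *(1) finite_arcs by (rule finite_subset)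
  assume e: "e \<in> M"
  then have "e \<in> arcs G" "arev e \<in> M" using *(1,2) by auto
  then show "head G e \<in> T" using *(4)[of "arev e"] by simp
  show "head G e \<noteq> tail G e"
    using inj_onD[OF *(3), of e "arev e"] e \<open>arev e \<in> M\<close> \<open>e \<in> arcs G\<close> arev_neq[of e] by auto
qed

lemma finite_arc_matchings [simp]: "finite (arc_matchings T)"
  by (rule finite_subset[of _ "Pow (arcs G)"]) (auto simp: arc_matchings_def)

lemma arc_matchings_insert:
  assumes "M \<in> arc_matchings (T - {a, b})" "e \<in> arcs G" "tail G e = a" "head G e = b"
    "a \<in> T" "b \<in> T" "a \<noteq> b"
  shows "insert e (insert (arev e) M) \<in> arc_matchings T" "e \<notin> M" "arev e \<notin> M"
    "card (insert e (insert (arev e) M)) = card M + 2"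
proof -
  note M = arc_matchingsD[OF assms(1)]
  show nin: "e \<notin> M" "arev e \<notin> M" using M(4)[of e] M(4)[of "arev e"] assms(2-4) by auto
  show "insert e (insert (arev e) M) \<in> arc_matchings T"
  proof -
    have t: "tail G f \<noteq> a \<and> tail G f \<noteq> b \<and> tail G f \<in> T" if "f \<in> M" for f
      using M(4)[OF that] by simp
    have ar: "tail G (arev e) = b" "arev e \<in> arcs G" using assms(2-4) by simp_all
    have "inj_on (tail G) (insert e (insert (arev e) M))"
      using M(3) t ar assms(3,4,7) by force
    moreover have "arev ` insert e (insert (arev e) M) \<subseteq> insert e (insert (arev e) M)"
      using M(2) by (simp add: image_subset_iff)
    ultimately show ?thesis
      using M(1) t ar assms(2,3,5,6) by (simp add: arc_matchings_def image_subset_iff)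
  qed
  show "card (insert e (insert (arev e) M)) = card M + 2"
    using nin M(5) arev_neq[OF assms(2)] by simp
qed

lemma arc_matchings_remove:
  assumes M: "M \<in> arc_matchings T" and e: "e \<in> M" "tail G e = a"
  shows "M - {e, arev e} \<in> arc_matchings (T - {a, head G e})" "e \<in> arcs_into a (T - {a})"
proof -
  note D = arc_matchingsD[OF M]
  have ae: "arev e \<in> M" "e \<in> arcs G" using D e by auto
  have "tail G f \<notin> {a, head G e}" if "f \<in> M - {e, arev e}" for f
    using inj_onD[OF D(3), of f e] inj_onD[OF D(3), of f "arev e"] that e ae by auto
  moreover have "arev f \<noteq> e \<and> arev f \<noteq> arev e" if "f \<in> M - {e, arev e}" for f
    using that by (metis DiffE arev_arev insertI1 insertI2)
  ultimately show "M - {e, arev e} \<in> arc_matchings (T - {a, head G e})"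
    using D unfolding arc_matchings_def by (auto intro: inj_on_subset)
  show "e \<in> arcs_into a (T - {a})" using D e ae by (auto simp: arcs_into_def)
qed

text \<open>Matchings are sorted by what happens at \<open>a\<close>: either \<open>a\<close> is
  uncovered, or exactly one arc \<open>e\<close> of the matching starts at \<open>a\<close>, and
  removing its edge leaves a matching of \<open>T - {a, head G e}\<close> with one sign change.
  Parallel arcs are counted separately.\<close>

lemma matching_sum_recursion:
  assumes T: "finite T" "a \<in> T"
  shows "matching_sum c d T = d a * matching_sum c d (T - {a}) -
    (\<Sum>e\<in>arcs_into a (T - {a}). c e * c (arev e) * matching_sum c d (T - {a, head G e}))"
proof -
  define t where "t = (\<lambda>T M. (-1) ^ (card M div 2) * (\<Prod>e\<in>M. c e) * (\<Prod>u\<in>T - tail G ` M. d u))"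
  have split: "arc_matchings T = arc_matchings (T - {a}) \<union> {M \<in> arc_matchings T. a \<in> tail G ` M}"
    by (auto simp: arc_matchings_def)
  have disjoint: "arc_matchings (T - {a}) \<inter> {M \<in> arc_matchings T. a \<in> tail G ` M} = {}"
    by (auto simp: arc_matchings_def)
  have the_arc: "(THE e. e \<in> M \<and> tail G e = a) = e"
    if "M \<in> arc_matchings T" "e \<in> M" "tail G e = a" for M e
  proof (rule the_equality)
    show "f = e" if "f \<in> M \<and> tail G f = a" for f
      using inj_onD[OF arc_matchingsD(3)[OF \<open>M \<in> arc_matchings T\<close>], of f e] that
        \<open>e \<in> M\<close> \<open>tail G e = a\<close> by simp
  qed (use that in simp)
  have "matching_sum c d T = (\<Sum>M\<in>arc_matchings T. t T M)"
    by (simp add: matching_sum_def t_def)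
  also have "\<dots> = (\<Sum>M\<in>arc_matchings (T - {a}). t T M) +
      (\<Sum>M | M \<in> arc_matchings T \<and> a \<in> tail G ` M. t T M)"
    by (subst split, rule sum.union_disjoint) (simp_all add: disjoint)
  also have "(\<Sum>M\<in>arc_matchings (T - {a}). t T M) = d a * matching_sum c d (T - {a})"
    unfolding matching_sum_def sum_distrib_left
  proof (rule sum.cong[OF refl])
    fix M assume "M \<in> arc_matchings (T - {a})"
    then have "a \<notin> tail G ` M" by (auto simp: arc_matchings_def)
    then have "(\<Prod>u\<in>T - tail G ` M. d u) = d a * (\<Prod>u\<in>T - tail G ` M - {a}. d u)"
      using T by (intro prod.remove) auto
    also have "T - tail G ` M - {a} = T - {a} - tail G ` M" by auto
    finally have "(\<Prod>u\<in>T - tail G ` M. d u) = d a * (\<Prod>u\<in>T - {a} - tail G ` M. d u)" .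
    then show "t T M = d a * ((-1) ^ (card M div 2) * (\<Prod>e\<in>M. c e) * (\<Prod>u\<in>T - {a} - tail G ` M. d u))"
      unfolding t_def by (simp only: mult_ac)
  qed
  also have "(\<Sum>M | M \<in> arc_matchings T \<and> a \<in> tail G ` M. t T M) =
      (\<Sum>(e, M)\<in>(SIGMA e:arcs_into a (T - {a}). arc_matchings (T - {a, head G e})).
        - (c e * c (arev e) * t (T - {a, head G e}) M))"
  proof (rule sum.reindex_bij_witness[where i = "\<lambda>(e, M). insert e (insert (arev e) M)"
        and j = "\<lambda>M. let e = (THE e. e \<in> M \<and> tail G e = a) in (e, M - {e, arev e})"], goal_cases)
    case (1 M)
    then obtain e where e: "e \<in> M" "tail G e = a" and M: "M \<in> arc_matchings T" by auto
    note the_arc[OF M e]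
    then show ?case using e arc_matchingsD(2)[OF M e(1)] by (auto simp: Let_def)
  next
    case (2 M)
    then obtain e where e: "e \<in> M" "tail G e = a" and M: "M \<in> arc_matchings T" by auto
    note the_arc[OF M e]
    then show ?case using arc_matchings_remove[OF M e] by (simp add: Let_def)
  next
    case (3 x)
    then obtain e M where x: "x = (e, M)" "e \<in> arcs_into a (T - {a})"
      "M \<in> arc_matchings (T - {a, head G e})" by auto
    then have e: "e \<in> arcs G" "tail G e = a" "head G e \<in> T" "head G e \<noteq> a" by (auto simp: arcs_into_def)
    note ins = arc_matchings_insert[OF x(3) e(1,2) refl T(2) e(3) e(4)[symmetric]]
    note the_arc[OF ins(1) insertI1 e(2)]
    then show ?case using ins(2,3) by (simp add: x(1) Let_def insert_Diff_if)
  next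
    case (4 x)
    then obtain e M where x: "x = (e, M)" "e \<in> arcs_into a (T - {a})"
      "M \<in> arc_matchings (T - {a, head G e})" by auto
    then have e: "e \<in> arcs G" "tail G e = a" "head G e \<in> T" "head G e \<noteq> a" by (auto simp: arcs_into_def)
    note ins = arc_matchings_insert[OF x(3) e(1,2) refl T(2) e(3) e(4)[symmetric]]
    then show ?case using ins(1) by (simp add: x(1) e(2))
  next
    case (5 M)
    then obtain e where e: "e \<in> M" "tail G e = a" and M: "M \<in> arc_matchings T" by auto
    note the = the_arc[OF M e]
    note D = arc_matchingsD[OF M]
    have ae: "arev e \<in> M" "e \<in> arcs G" using D e by auto
    define N where "N = M - {e, arev e}"
    have ne: "e \<noteq> arev e" using arev_neq[OF ae(2)] by simp
    have MN: "M = insert e (insert (arev e) N)" using e ae by (auto simp: N_def)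
    have N: "finite N" "e \<notin> N" "arev e \<notin> N" using D(5) by (auto simp: N_def)
    have card: "card M = card N + 2" using N ne by (simp add: MN)
    have prod: "(\<Prod>e\<in>M. c e) = c e * (c (arev e) * (\<Prod>e\<in>N. c e))" using N ne by (simp add: MN)
    have "tail G ` M = insert a (insert (head G e) (tail G ` N))"
      using e(2) ae(2) by (simp add: MN)
    then have rest: "T - tail G ` M = T - {a, head G e} - tail G ` N" by auto
    have "t T M = - (c e * c (arev e) * t (T - {a, head G e}) N)"
      unfolding t_def card prod rest by simp
    then show ?case by (simp add: the Let_def N_def[symmetric])
  qed
  also have "\<dots> = (\<Sum>e\<in>arcs_into a (T - {a}). - (c e * c (arev e) * matching_sum c d (T - {a, head G e})))"
    by (simp add: sum.Sigma[symmetric] matching_sum_def t_def sum_distrib_left sum_negf)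
  finally show ?thesis by (simp add: sum_negf)
qed

lemma matching_sum_empty [simp]: "matching_sum c d {} = 1"
proof -
  have "arc_matchings {} = {{}}" by (auto simp: arc_matchings_def)
  then show ?thesis by (simp add: matching_sum_def)
qed

text \<open>For \<open>d = \<lambda>v. \<theta> - V v\<close> this is the matching polynomial of the
  induced subgraph, evaluated at \<theta>. The function \<open>d\<close> stays arbitrary because
  eliminating a leaf changes it.\<close>

definition matching_value :: "('v \<Rightarrow> real) \<Rightarrow> 'v set \<Rightarrow> real" where
  "matching_value d T = matching_sum (cmod \<circ> w) d T"

definition edge_weight :: "'v \<Rightarrow> 'v \<Rightarrow> real" where
  "edge_weight a b = (\<Sum>e\<in>arcs_into a {b}. (cmod (w e))\<^sup>2)"

lemma edge_weight_nonneg: "edge_weight a b \<ge> 0"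
  by (simp add: edge_weight_def sum_nonneg)

lemma edge_weight_pos: "e \<in> arcs G \<Longrightarrow> edge_weight (tail G e) (head G e) > 0"
  unfolding edge_weight_def by (rule sum_pos2[of _ e]) (auto simp: arcs_into_def weight_nonzero)

lemma edge_weight_eq_0:
  "edge_weight a b = 0 \<longleftrightarrow> arcs_into a {b} = {}"
  by (auto simp: edge_weight_def sum_nonneg_eq_0_iff arcs_into_def weight_nonzero)

lemma edge_weight_sym: "edge_weight a b = edge_weight b a"
  unfolding edge_weight_def
  by (rule sum.reindex_bij_witness[where i = arev and j = arev])
    (auto simp: arcs_into_def weight_arev)

lemma sum_arcs_into:
  assumes "finite T"
  shows "(\<Sum>e\<in>arcs_into a T. (cmod (w e))\<^sup>2 * h (head G e)) = (\<Sum>c\<in>T. edge_weight a c * h c)"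
proof -
  have "(\<Sum>e\<in>arcs_into a T. (cmod (w e))\<^sup>2 * h (head G e)) =
      (\<Sum>c\<in>T. \<Sum>e\<in>{e \<in> arcs_into a T. head G e = c}. (cmod (w e))\<^sup>2 * h (head G e))"
    using assms by (intro sum.group[symmetric]) (auto simp: arcs_into_def)
  also have "\<dots> = (\<Sum>c\<in>T. edge_weight a c * h c)"
    unfolding edge_weight_def sum_distrib_right
    by (intro sum.cong refl) (auto simp: arcs_into_def)
  finally show ?thesis .
qed

lemma matching_value_recursion:
  assumes "finite T" "a \<in> T"
  shows "matching_value d T = d a * matching_value d (T - {a}) -
    (\<Sum>c\<in>T - {a}. edge_weight a c * matching_value d (T - {a, c}))"
proof -
  have "(\<Sum>e\<in>arcs_into a (T - {a}). cmod (w e) * cmod (w (arev e)) * matching_value d (T - {a, head G e})) =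
    (\<Sum>e\<in>arcs_into a (T - {a}). (cmod (w e))\<^sup>2 * matching_value d (T - {a, head G e}))"
    by (intro sum.cong refl) (auto simp: arcs_into_def weight_arev power2_eq_square)
  also have "\<dots> = (\<Sum>c\<in>T - {a}. edge_weight a c * matching_value d (T - {a, c}))"
    using assms by (intro sum_arcs_into) auto
  finally show ?thesis
    using matching_sum_recursion[OF assms, of "cmod \<circ> w" d] by (simp add: matching_value_def)
qed

lemma matching_value_empty [simp]: "matching_value d {} = 1"
  by (simp add: matching_value_def)

text \<open>The recursion sees the two arcs of an edge only through their product, so phases and
  voltages cancel.\<close>

lemma matching_sum_complex:
  assumes "finite T" "\<And>e. e \<in> arcs G \<Longrightarrow> c e * c (arev e) = complex_of_real ((cmod (w e))\<^sup>2)"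
  shows "matching_sum c (\<lambda>u. complex_of_real (d u)) T = complex_of_real (matching_value d T)"
  using assms(1)
proof (induction "card T" arbitrary: T rule: less_induct)
  case less
  show ?case
  proof (cases "T = {}")
    case False
    then obtain a where a: "a \<in> T" by blast
    have IH: "matching_sum c (\<lambda>u. complex_of_real (d u)) T' = complex_of_real (matching_value d T')"
      if "T' \<subset> T" for T'
      using that less by (meson finite_subset psubset_card_mono psubset_imp_subset)
    have "(\<Sum>e\<in>arcs_into a (T - {a}). c e * c (arev e) *
          matching_sum c (\<lambda>u. complex_of_real (d u)) (T - {a, head G e})) =
        (\<Sum>e\<in>arcs_into a (T - {a}). complex_of_real (cmod (w e) * cmod (w (arev e)) * matching_value d (T - {a, head G e})))"
    proof (intro sum.cong refl)
      fix e assume "e \<in> arcs_into a (T - {a})"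
      then have "e \<in> arcs G" by (simp add: arcs_into_def)
      moreover have "T - {a, head G e} \<subset> T" using a by auto
      ultimately show "c e * c (arev e) * matching_sum c (\<lambda>u. complex_of_real (d u)) (T - {a, head G e}) =
          complex_of_real (cmod (w e) * cmod (w (arev e)) * matching_value d (T - {a, head G e}))"
        using assms(2)[of e] by (simp add: IH weight_arev power2_eq_square)
    qed
    moreover have "T - {a} \<subset> T" using a by auto
    ultimately show ?thesis
      using matching_sum_recursion[OF less.prems a, of c "\<lambda>u. complex_of_real (d u)"]
        matching_sum_recursion[OF less.prems a, of "cmod \<circ> w" d]
      by (simp add: IH matching_value_def)
  qed simp
qed

lemma matching_value_cong:
  assumes "\<And>u. u \<in> T \<Longrightarrow> d u = d' u"
  shows "matching_value d T = matching_value d' T"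
  unfolding matching_value_def matching_sum_def
  by (intro sum.cong refl arg_cong2[where f = "(*)"] prod.cong) (auto intro: assms)

lemma matching_value_union:
  assumes "finite S" "finite T" "S \<inter> T = {}" "\<And>a b. a \<in> S \<Longrightarrow> b \<in> T \<Longrightarrow> edge_weight a b = 0"
  shows "matching_value d (S \<union> T) = matching_value d S * matching_value d T"
  using assms
proof (induction "card S" arbitrary: S rule: less_induct)
  case less
  show ?case
  proof (cases "S = {}")
    case False
    then obtain a where a: "a \<in> S" by blast
    have IH: "matching_value d (S' \<union> T) = matching_value d S' * matching_value d T" if "S' \<subset> S" for S'
      using that less.prems
      by (intro less.hyps) (auto intro: psubset_card_mono finite_subset)
    have eq: "S \<union> T - {a} = S - {a} \<union> T" "c \<in> S \<Longrightarrow> S \<union> T - {a, c} = S - {a, c} \<union> T" for c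
      using less.prems a by auto
    have "(\<Sum>c\<in>S \<union> T - {a}. edge_weight a c * matching_value d (S \<union> T - {a, c})) =
        (\<Sum>c\<in>S - {a}. edge_weight a c * matching_value d (S \<union> T - {a, c}))"
      using less.prems a by (intro sum.mono_neutral_right) auto
    also have "\<dots> = (\<Sum>c\<in>S - {a}. edge_weight a c * matching_value d (S - {a, c})) * matching_value d T"
      unfolding sum_distrib_right
    proof (intro sum.cong refl)
      fix c assume "c \<in> S - {a}"
      then have "matching_value d (S - {a, c} \<union> T) = matching_value d (S - {a, c}) * matching_value d T"
        using a by (intro IH) auto
      then show "edge_weight a c * matching_value d (S \<union> T - {a, c}) =
          edge_weight a c * matching_value d (S - {a, c}) * matching_value d T"
        using \<open>c \<in> S - {a}\<close> by (simp add: eq)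
    qed
    finally have "matching_value d (S \<union> T) = d a * matching_value d (S \<union> T - {a}) -
        (\<Sum>c\<in>S - {a}. edge_weight a c * matching_value d (S - {a, c})) * matching_value d T"
      using matching_value_recursion[of "S \<union> T" a d] less.prems a by simp
    moreover have "matching_value d (S \<union> T - {a}) = matching_value d (S - {a}) * matching_value d T"
      using IH[of "S - {a}"] a by (auto simp: eq)
    ultimately show ?thesis
      unfolding matching_value_recursion[OF less.prems(1) a, of d] by (simp add: left_diff_distrib)
  qed simp
qed

text \<open>A weak form of the Heilmann-Lieb identity, in which the sum over all paths from \<open>a\<close> to \<open>b\<close>
  is bounded from below by the contribution of the edges between them.\<close>

lemma Heilmann_Lieb:
  assumes "finite T" "a \<in> T" "b \<in> T" "a \<noteq> b"
  shows "matching_value d (T - {a}) * matching_value d (T - {b}) -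
    matching_value d T * matching_value d (T - {a, b}) \<ge> edge_weight a b * (matching_value d (T - {a, b}))\<^sup>2"
  using assms
proof (induction "card T" arbitrary: T a rule: less_induct)
  case less
  let ?\<mu> = "matching_value d"
  \<comment> \<open>The induction hypothesis is used for \<open>T - {a}\<close> and the pair
    \<open>c\<close>, \<open>b\<close>, keeping only nonnegativity. Expanding the values at
    \<open>T\<close> and at \<open>T - {b}\<close> along \<open>a\<close> turns the sum of these
    terms into the claim; the edge term comes from the summand \<open>c = b\<close> in the expansion
    at \<open>T\<close>.\<close>
  have "edge_weight a c * (?\<mu> (T - {a} - {c}) * ?\<mu> (T - {a} - {b}) - ?\<mu> (T - {a}) * ?\<mu> (T - {a} - {c, b})) \<ge> 0"
    if "c \<in> T - {a, b}" for c
  proof -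
    have "edge_weight c b * (?\<mu> (T - {a} - {c, b}))\<^sup>2 \<ge> 0" by (simp add: edge_weight_nonneg)
    also have "edge_weight c b * (?\<mu> (T - {a} - {c, b}))\<^sup>2 \<le>
        ?\<mu> (T - {a} - {c}) * ?\<mu> (T - {a} - {b}) - ?\<mu> (T - {a}) * ?\<mu> (T - {a} - {c, b})"
      using less.prems that by (intro less.hyps card_Diff1_less) auto
    finally show ?thesis by (simp add: edge_weight_nonneg)
  qed
  then have "0 \<le> (\<Sum>c\<in>T - {a, b}. edge_weight a c *
      (?\<mu> (T - {a} - {c}) * ?\<mu> (T - {a} - {b}) - ?\<mu> (T - {a}) * ?\<mu> (T - {a} - {c, b})))"
    by (rule sum_nonneg)
  also have "\<dots> = (\<Sum>c\<in>T - {a, b}. edge_weight a c * ?\<mu> (T - {a, c})) * ?\<mu> (T - {a, b}) -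
      ?\<mu> (T - {a}) * (\<Sum>c\<in>T - {a, b}. edge_weight a c * ?\<mu> (T - {b} - {a, c}))"
  proof -
    have "T - {a} - {c} = T - {a, c}" "T - {a} - {b} = T - {a, b}" "T - {a} - {c, b} = T - {b} - {a, c}" for c
      by auto
    then show ?thesis
      by (simp add: sum_distrib_left sum_distrib_right sum_subtractf[symmetric] right_diff_distrib mult_ac)
  qed
  also have "(\<Sum>c\<in>T - {a, b}. edge_weight a c * ?\<mu> (T - {a, c})) =
      d a * ?\<mu> (T - {a}) - ?\<mu> T - edge_weight a b * ?\<mu> (T - {a, b})"
  proof -
    have "(\<Sum>c\<in>T - {a}. edge_weight a c * ?\<mu> (T - {a, c})) = edge_weight a b * ?\<mu> (T - {a, b}) +
        (\<Sum>c\<in>T - {a} - {b}. edge_weight a c * ?\<mu> (T - {a, c}))"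
      using less.prems by (intro sum.remove) auto
    also have "T - {a} - {b} = T - {a, b}" by auto
    finally show ?thesis using matching_value_recursion[of T a d] less.prems by simp
  qed
  also have "(\<Sum>c\<in>T - {a, b}. edge_weight a c * ?\<mu> (T - {b} - {a, c})) = d a * ?\<mu> (T - {a, b}) - ?\<mu> (T - {b})"
  proof -
    have "T - {b} - {a} = T - {a, b}" by auto
    then show ?thesis using matching_value_recursion[of "T - {b}" a d] less.prems by simp
  qed
  finally show ?case by (simp add: algebra_simps power2_eq_square)
qed

end

section \<open>Vanishing of cycles and a longest-path argument for leaves\<close>

section \<open>Oriented cycles and leaves\<close>

context fin_schroedinger begin

text \<open>These are the 2-regular subgraphs with a direction chosen on each component. Excluding
  reversed pairs forbids going back and forth along one edge, while loops and pairs of parallel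
  edges remain.\<close>

definition oriented_cycles :: "'v set \<Rightarrow> 'e set set" where
  "oriented_cycles T = {C. C \<subseteq> arcs G \<and> inj_on (tail G) C \<and> inj_on (head G) C \<and>
     tail G ` C = head G ` C \<and> tail G ` C \<subseteq> T \<and> (\<forall>e\<in>C. arev e \<notin> C)}"

text \<open>The part of the phobic condition that elimination has to preserve; nonvanishing of
  \<open>matching_value d T\<close> is carried separately.\<close>

definition cycles_vanish :: "('v \<Rightarrow> real) \<Rightarrow> 'v set \<Rightarrow> bool" where
  "cycles_vanish d T \<longleftrightarrow> (\<forall>C\<in>oriented_cycles T. C \<noteq> {} \<longrightarrow> matching_value d (T - tail G ` C) = 0)"

lemma oriented_cycles_mono: "T \<subseteq> T' \<Longrightarrow> oriented_cycles T \<subseteq> oriented_cycles T'"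
  by (auto simp: oriented_cycles_def)

lemma oriented_cycles_Diff: "C \<in> oriented_cycles (T - S) \<Longrightarrow> tail G ` C \<inter> S = {}"
  by (auto simp: oriented_cycles_def)

lemma arc_of_edge_weight:
  assumes "edge_weight a b > 0"
  obtains e where "e \<in> arcs G" "tail G e = a" "head G e = b"
proof -
  have "arcs_into a {b} \<noteq> {}" using assms edge_weight_eq_0[of a b] by auto
  then show ?thesis using that by (auto simp: arcs_into_def)
qed

text \<open>For a cycle C avoiding \<open>a\<close> and \<open>b\<close>, the values at T - C and at
  T - C - {a} are zero. Each product on the larger side of \<open>Heilmann_Lieb\<close> contains one
  of them, so the square on the other side must vanish.\<close>

lemma cycles_vanish_remove_edge:
  assumes "finite T" "a \<in> T" "b \<in> T" "a \<noteq> b" "edge_weight a b > 0"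
    and "cycles_vanish d T" "cycles_vanish d (T - {a})"
  shows "cycles_vanish d (T - {a, b})"
  unfolding cycles_vanish_def
proof (intro ballI impI)
  fix C assume C: "C \<in> oriented_cycles (T - {a, b})" "C \<noteq> {}"
  have nin: "a \<notin> tail G ` C" "b \<notin> tail G ` C" using oriented_cycles_Diff[OF C(1)] by auto
  have "C \<in> oriented_cycles T" "C \<in> oriented_cycles (T - {a})"
    using C(1) oriented_cycles_mono[of "T - {a, b}" T] oriented_cycles_mono[of "T - {a, b}" "T - {a}"] by auto
  moreover have "T - {a} - tail G ` C = T - tail G ` C - {a}" by auto
  ultimately have "matching_value d (T - tail G ` C) = 0" "matching_value d (T - tail G ` C - {a}) = 0"
    using assms(6,7) C(2) unfolding cycles_vanish_def by metis+
  then have "edge_weight a b * (matching_value d (T - tail G ` C - {a, b}))\<^sup>2 \<le> 0"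
    using Heilmann_Lieb[of "T - tail G ` C" a b d] assms(1-4) nin by simp
  then have "matching_value d (T - tail G ` C - {a, b}) = 0"
    using assms(5) by (simp add: mult_le_0_iff not_le)
  moreover have "T - tail G ` C - {a, b} = T - {a, b} - tail G ` C" by auto
  ultimately show "matching_value d (T - {a, b} - tail G ` C) = 0" by simp
qed

text \<open>If deleting \<open>a\<close> makes the value zero, the recursion at \<open>a\<close>
  must have a nonzero summand, and this summand names the neighbour \<open>b\<close>.\<close>

lemma cycles_vanish_partner:
  assumes "finite T" "a \<in> T" "matching_value d T \<noteq> 0" "matching_value d (T - {a}) = 0"
    and "cycles_vanish d T" "cycles_vanish d (T - {a})"
  obtains e b where "e \<in> arcs G" "tail G e = a" "head G e = b" "b \<in> T" "b \<noteq> a"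
    "matching_value d (T - {a, b}) \<noteq> 0" "cycles_vanish d (T - {a, b})"
proof -
  have "(\<Sum>c\<in>T - {a}. edge_weight a c * matching_value d (T - {a, c})) \<noteq> 0"
    using matching_value_recursion[OF assms(1,2), of d] assms(3,4) by auto
  then obtain b where b: "b \<in> T - {a}" "edge_weight a b \<noteq> 0" "matching_value d (T - {a, b}) \<noteq> 0"
    by (metis (no_types, lifting) mult_eq_0_iff sum.neutral)
  then have pos: "edge_weight a b > 0" using edge_weight_nonneg[of a b] by simp
  from arc_of_edge_weight[OF pos] obtain e where "e \<in> arcs G" "tail G e = a" "head G e = b" .
  moreover have "cycles_vanish d (T - {a, b})"
    using cycles_vanish_remove_edge[OF assms(1,2) _ _ pos assms(5,6)] b by auto
  ultimately show ?thesis using that b by auto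
qed

text \<open>The vertices of a path are listed starting with its endpoint, \<open>es ! i\<close> leads from
  \<open>xs ! Suc i\<close> to \<open>xs ! i\<close>, and \<open>drop j xs\<close> is an initial segment of the path.\<close>

definition vanishing_path :: "('v \<Rightarrow> real) \<Rightarrow> 'v set \<Rightarrow> 'v list \<Rightarrow> 'e list \<Rightarrow> bool" where
  "vanishing_path d U xs es \<longleftrightarrow> length xs = Suc (length es) \<and> distinct xs \<and> set xs \<subseteq> U \<and>
     (\<forall>i<length es. es ! i \<in> arcs G \<and> tail G (es ! i) = xs ! Suc i \<and> head G (es ! i) = xs ! i) \<and>
     (\<forall>j\<le>length xs. cycles_vanish d (U - set (drop j xs))) \<and> matching_value d (U - set xs) \<noteq> 0"

lemma all_le_Suc_iff: "(\<forall>j\<le>Suc n. P j) \<longleftrightarrow> P 0 \<and> (\<forall>j\<le>n. P (Suc j))"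
  by (metis Suc_le_mono le0 not0_implies_Suc)

text \<open>Stepping to \<open>head G f\<close> keeps all cycles vanishing. If it also keeps the
  value nonzero, the path grows by one vertex; otherwise \<open>cycles_vanish_partner\<close>
  supplies a second step that restores a nonzero value.\<close>

lemma vanishing_path_extend:
  assumes U: "finite U" and p: "vanishing_path d U xs es"
    and f: "f \<in> arcs G" "tail G f = hd xs" "head G f \<in> U" "head G f \<notin> set xs"
  shows "\<exists>xs' es'. vanishing_path d U xs' es' \<and> length xs < length xs'"
proof -
  let ?c = "head G f" and ?T = "U - set xs"
  obtain y ys where xs: "xs = y # ys" using p by (cases xs) (auto simp: vanishing_path_def)
  have van: "\<And>j. j \<le> length xs \<Longrightarrow> cycles_vanish d (U - set (drop j xs))"
    and p': "length xs = Suc (length es)" "distinct xs" "set xs \<subseteq> U"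
      "\<And>i. i < length es \<Longrightarrow> es ! i \<in> arcs G \<and> tail G (es ! i) = xs ! Suc i \<and> head G (es ! i) = xs ! i"
      "matching_value d (U - set xs) \<noteq> 0"
    using p by (auto simp: vanishing_path_def)
  have "cycles_vanish d (U - set ys)" "cycles_vanish d ?T" using van[of 1] van[of 0] by (auto simp: xs)
  moreover have "U - set ys - {y} = ?T" by (auto simp: xs)
  ultimately have "cycles_vanish d (U - set ys - {y, ?c})"
    using U p' f edge_weight_pos[OF f(1)] by (intro cycles_vanish_remove_edge) (auto simp: xs)
  moreover have "U - set ys - {y, ?c} = ?T - {?c}" by (auto simp: xs)
  ultimately have c: "cycles_vanish d (?T - {?c})" by simp
  show ?thesis
  proof (cases "matching_value d (?T - {?c}) = 0")
    case False
    have "U - set (?c # xs) = ?T - {?c}" by auto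
    then have "vanishing_path d U (?c # xs) (f # es)"
      using c van p' f False by (auto simp: vanishing_path_def all_le_Suc_iff nth_Cons' xs gr0_conv_Suc)
    then show ?thesis by (intro exI[of _ "?c # xs"]) auto
  next
    case True
    obtain e b where b: "e \<in> arcs G" "tail G e = ?c" "head G e = b" "b \<in> ?T" "b \<noteq> ?c"
      "matching_value d (?T - {?c, b}) \<noteq> 0" "cycles_vanish d (?T - {?c, b})"
      using cycles_vanish_partner[of ?T ?c d] U f p'(5) True \<open>cycles_vanish d ?T\<close> c by auto
    have *: "U - insert ?c (set xs) = ?T - {?c}" "U - insert b (insert ?c (set xs)) = ?T - {?c, b}" by auto
    have arcs: "(e # f # es) ! i \<in> arcs G \<and> tail G ((e # f # es) ! i) = (b # ?c # xs) ! Suc i \<and>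
        head G ((e # f # es) ! i) = (b # ?c # xs) ! i" if "i < Suc (Suc (length es))" for i
      using that b p'(4) f by (cases i; cases "i - 1") (auto simp: xs)
    have "vanishing_path d U (b # ?c # xs) (e # f # es)"
      unfolding vanishing_path_def using arcs c van p' f b by (auto simp: all_le_Suc_iff *)
    then show ?thesis by (intro exI[of _ "b # ?c # xs"]) auto
  qed
qed

text \<open>An arc from the end of the path back to its vertex \<open>xs ! j\<close> closes a cycle
  with the last part of the path. Cycles vanish once the rest of the path,
  \<open>drop (Suc j) xs\<close>, is deleted, so deleting the whole path would give the value
  zero.\<close>

lemma vanishing_path_no_return:
  assumes p: "vanishing_path d U xs es"
    and f: "f \<in> arcs G" "tail G f = hd xs" "head G f \<in> set xs" "es \<noteq> [] \<Longrightarrow> f \<noteq> arev (hd es)"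
  shows False
proof -
  have p': "length xs = Suc (length es)" "distinct xs" "set xs \<subseteq> U"
      "\<And>i. i < length es \<Longrightarrow> es ! i \<in> arcs G \<and> tail G (es ! i) = xs ! Suc i \<and> head G (es ! i) = xs ! i"
      "matching_value d (U - set xs) \<noteq> 0"
    using p by (auto simp: vanishing_path_def)
  obtain j where j: "j < length xs" "head G f = xs ! j" using f(3) by (auto simp: in_set_conv_nth)
  have hd: "tail G f = xs ! 0" using f(2) p'(1) by (cases xs) auto
  \<comment> \<open>\<open>g i\<close> is the arc of the cycle that starts at \<open>xs ! i\<close>:
    the closing arc \<open>f\<close> for \<open>i = 0\<close>, and a path arc leading to
    \<open>xs ! (i - 1)\<close> otherwise.\<close>
  define g where "g = (\<lambda>i. if i = 0 then f else es ! (i - 1))"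
  define C where "C = g ` {..j}"
  have g: "g i \<in> arcs G" "tail G (g i) = xs ! i" "head G (g i) = xs ! (if i = 0 then j else i - 1)"
    if "i \<le> j" for i
    using that j p'(1) p'(4)[of "i - 1"] f(1) hd by (auto simp: g_def)
  have inj: "xs ! i = xs ! k \<longleftrightarrow> i = k" if "i \<le> j" "k \<le> j" for i k
    using p'(2) j(1) that by (simp add: nth_eq_iff_index_eq)
  have tails: "tail G ` C = set (take (Suc j) xs)"
  proof -
    have "tail G ` C = (!) xs ` {..j}" unfolding C_def image_image by (intro image_cong) (auto simp: g)
    also have "\<dots> = set (take (Suc j) xs)"
      using j(1) nth_image[of "Suc j" xs] by (simp add: lessThan_Suc_atMost atLeast0LessThan)
    finally show ?thesis .
  qed
  have heads: "head G ` C = tail G ` C"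
  proof -
    have "head G ` C = (!) xs ` ((\<lambda>i. if i = 0 then j else i - 1) ` {..j})"
      unfolding C_def image_image by (intro image_cong) (auto simp: g)
    also have "(\<lambda>i. if i = 0 then j else i - 1) ` {..j} = {..j}"
    proof (rule equalityI; rule subsetI)
      fix k assume "k \<in> {..j}"
      then show "k \<in> (\<lambda>i. if i = 0 then j else i - 1) ` {..j}"
        by (intro image_eqI[of _ _ "if k = j then 0 else Suc k"]) auto
    qed auto
    also have "(!) xs ` {..j} = tail G ` C" unfolding C_def image_image by (intro image_cong) (auto simp: g)
    finally show ?thesis .
  qed
  have disj: "set (take (Suc j) xs) \<inter> set (drop (Suc j) xs) = {}"
    using p'(2) by (rule set_take_disj_set_drop_if_distinct) simp
  have "inj_on (tail G) C"
    unfolding C_def by (rule inj_on_imageI) (auto simp: inj_on_def g inj)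
  moreover have "inj_on (head G) C"
    unfolding C_def by (rule inj_on_imageI) (auto simp: inj_on_def g inj split: if_splits)
  moreover have "arev e \<notin> C" if "e \<in> C" for e
  proof
    assume "arev e \<in> C"
    then obtain i k where ik: "i \<le> j" "k \<le> j" "e = g i" "arev (g i) = g k" using \<open>e \<in> C\<close> by (auto simp: C_def)
    have "tail G (g k) = head G (g i)" "head G (g k) = tail G (g i)"
      using g(1)[OF ik(1)] unfolding ik(4)[symmetric] by auto
    then have k: "k = (if i = 0 then j else i - 1)" and i: "i = (if k = 0 then j else k - 1)"
      using ik(1,2) by (simp_all only: g) (simp_all add: inj split: if_splits)
    have "i = 0 \<Longrightarrow> k = j" "i \<noteq> 0 \<Longrightarrow> k + 1 = i" "k = 0 \<Longrightarrow> i = j" "k \<noteq> 0 \<Longrightarrow> i + 1 = k"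
      by (subst k, simp)+ (subst i, simp)+
    \<comment> \<open>A cycle with at least three vertices cannot contain a reversed pair. For one
      vertex the reversal would fix \<open>f\<close>; for two vertices \<open>f\<close> would be the
      reverse of the last path arc, which is excluded.\<close>
    then have jik: "j = 0 \<or> j = 1 \<and> (i = 0 \<and> k = 1 \<or> i = 1 \<and> k = 0)" by linarith
    show False
    proof (cases "j = 0")
      case True
      then show False using ik arev_neq[OF f(1)] by (auto simp: g_def)
    next
      case False
      with jik have "j = 1" "i = 0 \<and> k = 1 \<or> i = 1 \<and> k = 0" by simp_all
      then have "f = arev (es ! 0)" using ik(4) by (auto simp: g_def) (metis arev_arev)
      moreover have "es \<noteq> []" using \<open>j = 1\<close> j(1) p'(1) by auto
      ultimately show False using f(4) by (simp add: hd_conv_nth)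
    qed
  qed
  moreover have "C \<subseteq> arcs G" using g by (auto simp: C_def)
  ultimately have "C \<in> oriented_cycles (U - set (drop (Suc j) xs))"
    using heads tails disj p'(3) set_take_subset[of "Suc j" xs] by (auto simp: oriented_cycles_def)
  moreover have "C \<noteq> {}" by (auto simp: C_def)
  moreover have "cycles_vanish d (U - set (drop (Suc j) xs))"
    using p j(1) by (simp add: vanishing_path_def)
  ultimately have "matching_value d (U - set (drop (Suc j) xs) - tail G ` C) = 0"
    by (simp add: cycles_vanish_def)
  moreover have "U - set (drop (Suc j) xs) - tail G ` C = U - set xs"
  proof -
    have "set xs = set (take (Suc j) xs) \<union> set (drop (Suc j) xs)"
      by (metis append_take_drop_id set_append)
    then show ?thesis unfolding tails by blast
  qed
  ultimately show False using p'(5) by simp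
qed

text \<open>A longest vanishing path ends in the required vertex: an arc leaving its end other than
  the reverse of the last path arc either extends the path or returns to it.\<close>

lemma exists_leaf_of_start:
  assumes U: "finite U" and van: "cycles_vanish d U" "matching_value d U \<noteq> 0"
    and c: "c \<in> U" "cycles_vanish d (U - {c})"
  shows "\<exists>u\<in>U. card (arcs_into u U) \<le> 1"
proof -
  have start: "\<exists>xs es. vanishing_path d U xs es"
  proof (cases "matching_value d (U - {c}) = 0")
    case False
    then have "vanishing_path d U [c] []"
      using c van by (auto simp: vanishing_path_def all_le_Suc_iff)
    then show ?thesis by blast
  next
    case True
    obtain e b where b: "e \<in> arcs G" "tail G e = c" "head G e = b" "b \<in> U" "b \<noteq> c"
      "matching_value d (U - {c, b}) \<noteq> 0" "cycles_vanish d (U - {c, b})"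
      using cycles_vanish_partner[OF U c(1) van(2) True van(1) c(2)] by blast
    then have "vanishing_path d U [b, c] [e]"
      using c van by (auto simp: vanishing_path_def all_le_Suc_iff insert_commute)
    then show ?thesis by blast
  qed
  have bound: "length xs \<le> card U" if "vanishing_path d U xs es" for xs es
    using that U card_mono[of U "set xs"] by (auto simp: vanishing_path_def distinct_card)
  obtain xs es where p: "vanishing_path d U xs es"
    and max: "\<And>xs' es'. vanishing_path d U xs' es' \<Longrightarrow> length xs' \<le> length xs"
  proof -
    obtain p where "vanishing_path d U (fst p) (snd p)" using start by auto
    then have "\<exists>p. vanishing_path d U (fst p) (snd p) \<and>
        (\<forall>q. vanishing_path d U (fst q) (snd q) \<longrightarrow> length (fst q) \<le> length (fst p))"
      using bound
      by (intro ex_has_greatest_nat[of "\<lambda>p. vanishing_path d U (fst p) (snd p)" p "\<lambda>p. length (fst p)" "Suc (card U)"])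
        (auto simp: less_Suc_eq_le)
    then show ?thesis using that by auto
  qed
  have xs: "xs \<noteq> []" "set xs \<subseteq> U" using p by (auto simp: vanishing_path_def)
  have "card (arcs_into (hd xs) U) \<le> 1"
  proof (rule ccontr)
    assume "\<not> card (arcs_into (hd xs) U) \<le> 1"
    \<comment> \<open>If the path has no arcs, \<open>hd es\<close> is an unspecified arc;
      \<open>vanishing_path_no_return\<close> then asks for nothing about the reverse of
      \<open>hd es\<close>.\<close>
    then have "\<not> arcs_into (hd xs) U \<subseteq> {arev (hd es)}"
      using card_mono[of "{arev (hd es)}" "arcs_into (hd xs) U"] by auto
    then obtain f where f: "f \<in> arcs G" "tail G f = hd xs" "head G f \<in> U" "f \<noteq> arev (hd es)"
      by (auto simp: arcs_into_def)
    show False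
    proof (cases "head G f \<in> set xs")
      case True
      then show False using vanishing_path_no_return[OF p f(1,2)] f(4) by simp
    next
      case False
      then show False using vanishing_path_extend[OF U p f(1-3)] max by (meson not_le)
    qed
  qed
  then show ?thesis using xs by (intro bexI[of _ "hd xs"]) auto
qed

end

section \<open>The twisted determinant as a sum over oriented cycles\<close>

context fin_schroedinger begin

text \<open>Permutations of \<open>T\<close> lifted to arcs: each vertex in the tail image has
  chosen one arc along which it is moved (a loop keeps it fixed), and the remaining vertices take
  the diagonal term.\<close>

definition arc_permutations :: "'v set \<Rightarrow> 'e set set" where
  "arc_permutations T = {X. X \<subseteq> arcs G \<and> inj_on (tail G) X \<and> inj_on (head G) X \<and>
     tail G ` X = head G ` X \<and> tail G ` X \<subseteq> T}"

definition arc_perm :: "'e set \<Rightarrow> 'v \<Rightarrow> 'v" where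
  "arc_perm X v = (if v \<in> tail G ` X then head G (the_inv_into X (tail G) v) else v)"

lemma arc_perm_tail: "inj_on (tail G) X \<Longrightarrow> e \<in> X \<Longrightarrow> arc_perm X (tail G e) = head G e"
  by (auto simp: arc_perm_def the_inv_into_f_f)

lemma arc_perm_other: "v \<notin> tail G ` X \<Longrightarrow> arc_perm X v = v"
  by (simp add: arc_perm_def)

lemma arc_perm_permutes:
  assumes "X \<in> arc_permutations T" "finite T"
  shows "arc_perm X permutes T"
proof -
  have X: "inj_on (tail G) X" "inj_on (head G) X" "tail G ` X = head G ` X" "tail G ` X \<subseteq> T"
    using assms(1) by (auto simp: arc_permutations_def)
  have into: "arc_perm X v \<in> T" if "v \<in> T" for v
  proof (cases "v \<in> tail G ` X")
    case True
    then obtain e where "e \<in> X" "v = tail G e" by auto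
    then have "arc_perm X v \<in> head G ` X" using X(1) by (simp add: arc_perm_tail)
    then show ?thesis using X(3,4) by auto
  qed (use that in \<open>simp add: arc_perm_other\<close>)
  have head: "arc_perm X v \<in> tail G ` X \<longleftrightarrow> v \<in> tail G ` X" for v
  proof (cases "v \<in> tail G ` X")
    case True
    then obtain e where "e \<in> X" "v = tail G e" by auto
    then have "arc_perm X v \<in> head G ` X" using X(1) by (simp add: arc_perm_tail)
    then show ?thesis using X(3) True by simp
  qed (simp add: arc_perm_other)
  have "inj_on (arc_perm X) T"
  proof (rule inj_onI)
    fix u v assume eq: "arc_perm X u = arc_perm X v"
    show "u = v"
    proof (cases "u \<in> tail G ` X")
      case True
      then have "v \<in> tail G ` X" using head[of u] head[of v] eq by simp
      with True obtain e f where "e \<in> X" "u = tail G e" "f \<in> X" "v = tail G f" by auto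
      then show ?thesis using eq X(1) inj_onD[OF X(2), of e f] by (simp add: arc_perm_tail)
    next
      case False
      then have "v \<notin> tail G ` X" using head[of u] head[of v] eq by simp
      then show ?thesis using eq False by (simp add: arc_perm_other)
    qed
  qed
  then have "bij_betw (arc_perm X) T T"
    using into endo_inj_surj[OF assms(2), of "arc_perm X"] by (auto simp: bij_betw_def)
  then show ?thesis
    by (rule bij_imp_permutes) (use X(4) in \<open>auto intro: arc_perm_other\<close>)
qed

text \<open>For \<open>d = \<lambda>v. \<theta> - V v\<close> this is \<theta> minus the
  Schroedinger matrix with every arc weight multiplied by a commuting voltage
  \<open>z\<close>.\<close>

definition schroedinger_matrix :: "('v \<Rightarrow> real) \<Rightarrow> ('e \<Rightarrow> complex) \<Rightarrow> 'v \<Rightarrow> 'v \<Rightarrow> complex" where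
  "schroedinger_matrix d z u v =
     (if v = u then complex_of_real (d u) else 0) - (\<Sum>e\<in>arcs_into u {v}. w e * z e)"

text \<open>Each matrix entry is a sum over options, \<open>Some e\<close> for an arc and
  \<open>None\<close> for the diagonal potential. Expanding the product over the rows, a permutation
  with a choice of options is the same as the set of chosen arcs.\<close>

lemma schroedinger_det_arc_permutations:
  assumes T: "finite T"
  shows "set_det T (schroedinger_matrix d z) =
    (\<Sum>X\<in>arc_permutations T. of_int (sign (arc_perm X)) * (\<Prod>e\<in>X. - (w e * z e)) *
       (\<Prod>u\<in>T - tail G ` X. complex_of_real (d u)))"
proof -
  define opts where "opts = (\<lambda>v u. Some ` arcs_into v {u} \<union> (if u = v then {None} else {}))"
  define wt where "wt = (\<lambda>v x. case x of None \<Rightarrow> complex_of_real (d v) | Some e \<Rightarrow> - (w e * z e))"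
  have fin: "finite (opts v u)" for v u by (simp add: opts_def)
  have mat: "schroedinger_matrix d z v u = (\<Sum>x\<in>opts v u. wt v x)" for v u
    unfolding opts_def schroedinger_matrix_def
    by (subst sum.union_disjoint) (auto simp: wt_def sum.reindex sum_negf)
  define i where "i = (\<lambda>X. (arc_perm X,
    \<lambda>v\<in>T. if v \<in> tail G ` X then Some (the_inv_into X (tail G) v) else None))"
  define j where "j = (\<lambda>(p :: 'v \<Rightarrow> 'v, c :: 'v \<Rightarrow> 'e option). {e. \<exists>v\<in>T. c v = Some e})"
  define F where "F = (\<lambda>(p :: 'v \<Rightarrow> 'v, c). of_int (sign p) * (\<Prod>v\<in>T. wt v (c v)))"
  define P where "P = (SIGMA p:{p. p permutes T}. PiE T (\<lambda>v. opts v (p v)))"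
  have "set_det T (schroedinger_matrix d z) =
      (\<Sum>p | p permutes T. \<Sum>c\<in>PiE T (\<lambda>v. opts v (p v)). F (p, c))"
    unfolding set_det_def mat F_def using T fin
    by (simp add: prod_sum_PiE sum_distrib_left)
  also have "\<dots> = sum F P"
    unfolding P_def using T fin by (subst sum.Sigma) (auto simp: finite_permutations finite_PiE)
  also have "\<dots> = (\<Sum>X\<in>arc_permutations T. of_int (sign (arc_perm X)) * (\<Prod>e\<in>X. - (w e * z e)) *
       (\<Prod>u\<in>T - tail G ` X. complex_of_real (d u)))"
  proof (rule sum.reindex_bij_witness[where i = i and j = j])
    fix x assume "x \<in> P"
    then obtain p c where x: "x = (p, c)" and p: "p permutes T" and c: "c \<in> PiE T (\<lambda>v. opts v (p v))"
      by (auto simp: P_def)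
    let ?X = "j x"
    have X: "e \<in> ?X \<longleftrightarrow> tail G e \<in> T \<and> c (tail G e) = Some e" for e
      using c by (auto simp: x j_def opts_def arcs_into_def PiE_def Pi_def split: if_splits)
    have arc: "e \<in> arcs G \<and> head G e = p (tail G e)" if "e \<in> ?X" for e
      using c that by (auto simp: X opts_def arcs_into_def PiE_def Pi_def split: if_splits)
    have tails: "tail G ` ?X = {v \<in> T. c v \<noteq> None}"
    proof (rule equalityI; rule subsetI)
      fix v assume "v \<in> {v \<in> T. c v \<noteq> None}"
      then obtain e where e: "v \<in> T" "c v = Some e" by auto
      then have "tail G e = v" using c by (auto simp: opts_def arcs_into_def PiE_def Pi_def split: if_splits)
      then show "v \<in> tail G ` ?X" using e X[of e] by auto
    qed (auto simp: X)
    have fixed: "p v = v" if "v \<notin> tail G ` ?X" for v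
    proof (cases "v \<in> T")
      case True
      then have "c v = None" "c v \<in> opts v (p v)" using that PiE_mem[OF c True] by (auto simp: tails)
      then show ?thesis by (auto simp: opts_def split: if_splits)
    qed (use p in \<open>auto intro: permutes_not_in\<close>)
    have injp: "inj p" using p by (rule permutes_inj)
    have heads: "head G ` ?X = tail G ` ?X"
    proof -
      have "head G ` ?X = p ` tail G ` ?X" using arc by (auto simp: image_image intro!: image_cong)
      also have "\<dots> = tail G ` ?X"
      proof -
        have "p v \<in> tail G ` ?X" if "v \<in> tail G ` ?X" for v
          using fixed[of "p v"] injD[OF injp, of "p v" v] that by auto
        moreover have "finite (tail G ` ?X)" using T unfolding tails by simp
        ultimately show ?thesis
          using injp by (intro endo_inj_surj) (auto intro: inj_on_subset)
      qed
      finally show ?thesis .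
    qed
    have inj: "inj_on (tail G) ?X" by (rule inj_onI) (auto simp: X)
    have injh: "inj_on (head G) ?X"
      using arc inj injD[OF injp] by (auto simp: inj_on_def)
    show XP: "?X \<in> arc_permutations T"
      unfolding arc_permutations_def using arc inj injh heads by (auto simp: X)
    have inv: "the_inv_into ?X (tail G) (tail G e) = e" if "e \<in> ?X" for e
      using inj that by (rule the_inv_into_f_f)
    have perm: "arc_perm ?X = p"
    proof
      fix v
      show "arc_perm ?X v = p v"
        using inj arc fixed by (cases "v \<in> tail G ` ?X") (auto simp: arc_perm_tail arc_perm_other)
    qed
    show "i ?X = x"
    proof -
      have "(\<lambda>v\<in>T. if v \<in> tail G ` ?X then Some (the_inv_into ?X (tail G) v) else None) = c"
      proof
        fix v
        show "(\<lambda>v\<in>T. if v \<in> tail G ` ?X then Some (the_inv_into ?X (tail G) v) else None) v = c v"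
        proof (cases "v \<in> tail G ` ?X")
          case True
          then obtain e where "e \<in> ?X" "v = tail G e" by auto
          then show ?thesis using True inv[of e] X[of e] by simp
        next
          case False
          then show ?thesis using c tails by (auto simp: restrict_def PiE_def extensional_def)
        qed
      qed
      then show ?thesis unfolding i_def perm by (simp only: x[symmetric])
    qed
    have "(\<Prod>v\<in>T. wt v (c v)) = (\<Prod>v\<in>tail G ` ?X. wt v (c v)) * (\<Prod>v\<in>T - tail G ` ?X. wt v (c v))"
      using T by (intro prod.subset_diff[THEN trans[OF _ mult.commute]]) (auto simp: tails)
    also have "(\<Prod>v\<in>tail G ` ?X. wt v (c v)) = (\<Prod>e\<in>?X. - (w e * z e))"
      using inj by (subst prod.reindex) (auto simp: X wt_def intro!: prod.cong)
    also have "(\<Prod>v\<in>T - tail G ` ?X. wt v (c v)) = (\<Prod>u\<in>T - tail G ` ?X. complex_of_real (d u))"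
      by (intro prod.cong refl) (auto simp: tails wt_def)
    finally show "of_int (sign (arc_perm ?X)) * (\<Prod>e\<in>?X. - (w e * z e)) *
        (\<Prod>u\<in>T - tail G ` ?X. complex_of_real (d u)) = F x"
      by (simp add: F_def x perm[unfolded x])
  next
    fix X assume X: "X \<in> arc_permutations T"
    have D: "X \<subseteq> arcs G" "inj_on (tail G) X" "tail G ` X \<subseteq> T"
      using X by (auto simp: arc_permutations_def)
    have inv: "the_inv_into X (tail G) (tail G e) = e" if "e \<in> X" for e
      using D(2) that by (rule the_inv_into_f_f)
    show "j (i X) = X"
    proof (rule Set.set_eqI)
      fix e
      have "e \<in> j (i X) \<longleftrightarrow> (\<exists>v\<in>T. v \<in> tail G ` X \<and> the_inv_into X (tail G) v = e)"
        by (auto simp: j_def i_def)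
      also have "\<dots> \<longleftrightarrow> e \<in> X" using D(3) inv by (auto intro: bexI[of _ "tail G e"])
      finally show "e \<in> j (i X) \<longleftrightarrow> e \<in> X" .
    qed
    have "(if v \<in> tail G ` X then Some (the_inv_into X (tail G) v) else None) \<in> opts v (arc_perm X v)" for v
    proof (cases "v \<in> tail G ` X")
      case True
      then obtain e where "e \<in> X" "v = tail G e" by auto
      then show ?thesis using D(1,2) by (auto simp: inv arc_perm_tail opts_def arcs_into_def)
    qed (auto simp: arc_perm_other opts_def)
    then show "i X \<in> P"
      unfolding P_def i_def using arc_perm_permutes[OF X T] by (intro SigmaI) (simp_all only: mem_Collect_eq restrict_PiE_iff, blast)
  qed
  finally show ?thesis .
qed

lemma arc_permutations_union:
  assumes C: "C \<in> arc_permutations T" and M: "M \<in> arc_matchings (T - tail G ` C)"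
  shows "C \<union> M \<in> arc_permutations T" "C \<inter> M = {}"
proof -
  note D = arc_matchingsD[OF M]
  have C': "C \<subseteq> arcs G" "inj_on (tail G) C" "inj_on (head G) C" "tail G ` C = head G ` C" "tail G ` C \<subseteq> T"
    using C by (auto simp: arc_permutations_def)
  have t: "tail G e \<in> T" "tail G e \<notin> tail G ` C" "head G e \<notin> tail G ` C" "tail G e \<in> head G ` M"
    "head G e \<in> tail G ` M" if "e \<in> M" for e
  proof -
    show "tail G e \<in> T" "tail G e \<notin> tail G ` C" "head G e \<notin> tail G ` C" using D(4,6)[OF that] by auto
    have "e \<in> arcs G" "arev e \<in> M" using D(1,2) that by auto
    then show "tail G e \<in> head G ` M" "head G e \<in> tail G ` M"
      by (simp_all add: rev_image_eqI[of "arev e"])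
  qed
  show "C \<inter> M = {}" using t by auto
  have "inj_on (head G) M"
  proof (rule inj_onI)
    fix e f assume ef: "e \<in> M" "f \<in> M" "head G e = head G f"
    then have "e \<in> arcs G" "f \<in> arcs G" "arev e \<in> M" "arev f \<in> M" using D(1,2) by auto
    then have "arev e = arev f" using ef(3) inj_onD[OF D(3), of "arev e" "arev f"] by simp
    then show "e = f" by (metis arev_arev)
  qed
  moreover have "tail G ` (C - M) \<inter> tail G ` (M - C) = {}" "head G ` (C - M) \<inter> head G ` (M - C) = {}"
  proof -
    have "tail G ` M \<subseteq> - tail G ` C" "head G ` M \<subseteq> - head G ` C"
      using t(2,3) unfolding C'(4)[symmetric] by (simp_all add: image_subset_iff)
    then show "tail G ` (C - M) \<inter> tail G ` (M - C) = {}" "head G ` (C - M) \<inter> head G ` (M - C) = {}"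
      by blast+
  qed
  ultimately have "inj_on (head G) (C \<union> M)" "inj_on (tail G) (C \<union> M)"
    using C'(2,3) D(3) by (simp_all add: inj_on_Un)
  moreover have "tail G ` M = head G ` M" using t(4,5) by blast
  moreover have "tail G ` M \<subseteq> T" using t(1) by blast
  ultimately show "C \<union> M \<in> arc_permutations T"
    using C'(1,4,5) D(1) by (simp add: arc_permutations_def image_Un)
qed

text \<open>Each edge of the matching multiplies the permutation by the transposition of its two
  ends.\<close>

lemma sign_arc_perm_union:
  assumes "finite T" "C \<in> arc_permutations T" "M \<in> arc_matchings (T - tail G ` C)"
  shows "even (card M) \<and> sign (arc_perm (C \<union> M)) = sign (arc_perm C) * (-1) ^ (card M div 2)"
  using assms(3)
proof (induction "card M" arbitrary: M rule: less_induct)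
  case less
  note D = arc_matchingsD[OF less.prems]
  show ?case
  proof (cases "M = {}")
    case False
    then obtain e where e: "e \<in> M" by blast
    let ?a = "tail G e" and ?b = "head G e"
    have ae: "e \<in> arcs G" "arev e \<in> M" "arev e \<noteq> e" "?b \<noteq> ?a" using D e arev_neq by auto
    define N where "N = M - {e, arev e}"
    have MN: "M = insert e (insert (arev e) N)" using e ae by (auto simp: N_def)
    have N: "N \<in> arc_matchings (T - tail G ` C - {?a, ?b})"
      using arc_matchings_remove[OF less.prems e refl] by (simp add: N_def)
    then have N': "N \<in> arc_matchings (T - tail G ` C)" by (auto simp: arc_matchings_def)
    have nin: "finite N" "e \<notin> N" "arev e \<notin> N" using D(5) by (auto simp: N_def)
    have card: "card M = card N + 2" using nin ae(3) by (simp add: MN)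
    have X: "C \<union> N \<in> arc_permutations T" by (rule arc_permutations_union[OF assms(2) N'])
    then have XD: "inj_on (tail G) (C \<union> N)" "head G ` (C \<union> N) = tail G ` (C \<union> N)"
      by (auto simp: arc_permutations_def)
    have "C \<union> M \<in> arc_permutations T" by (rule arc_permutations_union[OF assms(2) less.prems])
    then have inj: "inj_on (tail G) (C \<union> M)" by (auto simp: arc_permutations_def)
    have out: "?a \<notin> tail G ` (C \<union> N)" "?b \<notin> tail G ` (C \<union> N)"
    proof -
      have "tail G f \<noteq> ?a \<and> tail G f \<noteq> ?b" if "f \<in> N" for f
        using arc_matchingsD(4)[OF N that] by simp
      then have "?a \<notin> tail G ` N" "?b \<notin> tail G ` N" by (metis imageE)+
      then show "?a \<notin> tail G ` (C \<union> N)" "?b \<notin> tail G ` (C \<union> N)"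
        using D(4)[OF e] D(6)[OF e] by (simp_all add: image_Un)
    qed
    have "arc_perm (C \<union> M) = Transposition.transpose ?a ?b \<circ> arc_perm (C \<union> N)"
    proof
      fix v
      consider "v = ?a" | "v = ?b" | f where "f \<in> C \<union> N" "v = tail G f" | "v \<notin> tail G ` (C \<union> M)"
        using ae(1) by (auto simp: MN)
      then show "arc_perm (C \<union> M) v = (Transposition.transpose ?a ?b \<circ> arc_perm (C \<union> N)) v"
      proof cases
        case 1
        then show ?thesis using arc_perm_tail[OF inj, of e] e out by (simp add: arc_perm_other)
      next
        case 2
        then show ?thesis using arc_perm_tail[OF inj, of "arev e"] ae out by (simp add: arc_perm_other)
      next
        case 3
        then have "head G f \<in> tail G ` (C \<union> N)" unfolding XD(2)[symmetric] by blast
        then have "head G f \<noteq> ?a" "head G f \<noteq> ?b" using out by metis+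
        then show ?thesis
          using 3 arc_perm_tail[OF inj, of f] arc_perm_tail[OF XD(1), of f] by (simp add: MN)
      next
        case 4
        then have "v \<noteq> ?a" "v \<noteq> ?b" using ae(1) by (auto simp: MN)
        then show ?thesis using 4 by (simp add: arc_perm_other MN image_Un)
      qed
    qed
    moreover have "permutation (arc_perm (C \<union> N))"
      using arc_perm_permutes[OF X assms(1)] assms(1) by (auto simp: permutation_permutes)
    ultimately have "sign (arc_perm (C \<union> M)) = - sign (arc_perm (C \<union> N))"
      using ae(4) by (simp add: sign_compose permutation_swap_id sign_swap_id)
    moreover have "even (card N) \<and> sign (arc_perm (C \<union> N)) = sign (arc_perm C) * (-1) ^ (card N div 2)"
      using N' by (intro less.hyps) (simp_all add: card)
    ultimately show ?thesis by (simp add: card)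
  qed simp
qed

definition cycle_coefficient :: "'e set \<Rightarrow> complex" where
  "cycle_coefficient C = of_int (sign (arc_perm C)) * (-1) ^ card C * (\<Prod>e\<in>C. w e)"

lemma cycle_coefficient_nonzero: "C \<subseteq> arcs G \<Longrightarrow> cycle_coefficient C \<noteq> 0"
  using finite_subset[OF _ finite_arcs, of C] weight_nonzero
  by (auto simp: cycle_coefficient_def sign_def)

text \<open>An arc permutation splits uniquely into the arcs whose reverse it also contains, which
  form a matching, and the others, which form oriented cycles. On the matching part the voltages
  cancel, so summing over it yields the matching value of the vertices off the cycles.\<close>

lemma schroedinger_det_cycles:
  assumes T: "finite T" and z: "\<And>e. e \<in> arcs G \<Longrightarrow> z e * z (arev e) = 1"
  shows "set_det T (schroedinger_matrix d z) =
    (\<Sum>C\<in>oriented_cycles T. cycle_coefficient C * (\<Prod>e\<in>C. z e) *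
       complex_of_real (matching_value d (T - tail G ` C)))"
proof -
  define F where "F = (\<lambda>X. of_int (sign (arc_perm X)) * (\<Prod>e\<in>X. - (w e * z e)) *
       (\<Prod>u\<in>T - tail G ` X. complex_of_real (d u)))"
  define m where "m = (\<lambda>T' M. (-1) ^ (card M div 2) * (\<Prod>e\<in>M. w e * z e) * (\<Prod>u\<in>T' - tail G ` M. complex_of_real (d u)))"
  have OC: "oriented_cycles T \<subseteq> arc_permutations T"
    by (auto simp: oriented_cycles_def arc_permutations_def)
  have fin_OC: "finite (oriented_cycles T)"
    by (rule finite_subset[of _ "Pow (arcs G)"]) (auto simp: oriented_cycles_def)
  have rev_not: "arev e \<notin> M" if "C \<in> oriented_cycles T" "M \<in> arc_matchings (T - tail G ` C)" "e \<in> C" for C M e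
  proof
    assume "arev e \<in> M"
    then have "e \<in> M" using arc_matchingsD(2)[OF that(2)] by force
    then show False using arc_matchingsD(4)[OF that(2)] that(3) by force
  qed
  have "sum F (arc_permutations T) =
      (\<Sum>(C, M)\<in>(SIGMA C:oriented_cycles T. arc_matchings (T - tail G ` C)). F (C \<union> M))"
  proof (rule sum.reindex_bij_witness[where i = "\<lambda>(C, M). C \<union> M"
        and j = "\<lambda>X. ({e \<in> X. arev e \<notin> X}, {e \<in> X. arev e \<in> X})"], goal_cases)
    case (1 X)
    then show ?case by auto
  next
    case (2 X)
    then have X: "X \<subseteq> arcs G" "inj_on (tail G) X" "inj_on (head G) X" "tail G ` X = head G ` X" "tail G ` X \<subseteq> T"
      by (auto simp: arc_permutations_def)
    let ?C = "{e \<in> X. arev e \<notin> X}" and ?M = "{e \<in> X. arev e \<in> X}"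
    have XCM: "X - ?C = ?M" "X - ?M = ?C" by auto
    have "tail G ` ?M = head G ` ?M"
    proof (intro equalityI subsetI)
      fix v assume "v \<in> tail G ` ?M"
      then obtain e where "e \<in> ?M" "v = tail G e" by auto
      then show "v \<in> head G ` ?M" using X(1) by (intro image_eqI[of _ _ "arev e"]) auto
    next
      fix v assume "v \<in> head G ` ?M"
      then obtain e where "e \<in> ?M" "v = head G e" by auto
      then show "v \<in> tail G ` ?M" using X(1) by (intro image_eqI[of _ _ "arev e"]) auto
    qed
    then have "tail G ` ?C = head G ` ?C"
      using inj_on_image_set_diff[OF X(2), of X ?M] inj_on_image_set_diff[OF X(3), of X ?M] X(4)
      unfolding XCM by auto
    then have "?C \<in> oriented_cycles T"
      using X inj_on_subset[OF X(2), of ?C] inj_on_subset[OF X(3), of ?C]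
      unfolding oriented_cycles_def by auto
    moreover have "?M \<in> arc_matchings (T - tail G ` ?C)"
    proof -
      have "tail G ` ?M = tail G ` X - tail G ` ?C"
        using inj_on_image_set_diff[OF X(2), of X ?C] unfolding XCM by auto
      then show ?thesis
        using X inj_on_subset[OF X(2), of ?M] unfolding arc_matchings_def by auto
    qed
    ultimately show ?case by auto
  next
    case (3 x)
    then obtain C M where x: "x = (C, M)" "C \<in> oriented_cycles T" "M \<in> arc_matchings (T - tail G ` C)" by auto
    have "arev e \<notin> C \<union> M" if "e \<in> C" for e
      using rev_not[OF x(2,3) that] x(2) that by (auto simp: oriented_cycles_def)
    moreover have "C \<inter> M = {}" using arc_permutations_union(2)[of C T M] OC x by auto
    ultimately show ?case using arc_matchingsD(2)[OF x(3)] by (auto simp: x(1))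
  next
    case (4 x)
    then show ?case using arc_permutations_union(1) OC by auto
  next
    case (5 X)
    have "{e \<in> X. arev e \<notin> X} \<union> {e \<in> X. arev e \<in> X} = X" by auto
    then show ?case by simp
  qed
  also have "\<dots> = (\<Sum>C\<in>oriented_cycles T. \<Sum>M\<in>arc_matchings (T - tail G ` C). F (C \<union> M))"
    using fin_OC by (simp add: sum.Sigma)
  also have "\<dots> = (\<Sum>C\<in>oriented_cycles T. cycle_coefficient C * (\<Prod>e\<in>C. z e) *
      matching_sum (\<lambda>e. w e * z e) (\<lambda>u. complex_of_real (d u)) (T - tail G ` C))"
    unfolding matching_sum_def sum_distrib_left
  proof (intro sum.cong refl)
    fix C M assume C: "C \<in> oriented_cycles T" and M: "M \<in> arc_matchings (T - tail G ` C)"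
    have CP: "C \<in> arc_permutations T" using C OC by auto
    have fin: "finite C" "finite M"
      using C arc_matchingsD(5)[OF M] finite_subset[OF _ finite_arcs] by (auto simp: oriented_cycles_def)
    have neg: "(\<Prod>e\<in>Y. - (w e * z e)) = (-1) ^ card Y * (\<Prod>e\<in>Y. w e * z e)" for Y
      by (induction Y rule: infinite_finite_induct) auto
    have s: "even (card M)" "sign (arc_perm (C \<union> M)) = sign (arc_perm C) * (-1) ^ (card M div 2)"
      using sign_arc_perm_union[OF T CP M] by auto
    have rest: "T - tail G ` (C \<union> M) = T - tail G ` C - tail G ` M" by auto
    have "(\<Prod>e\<in>C \<union> M. - (w e * z e)) = (\<Prod>e\<in>C. - (w e * z e)) * (\<Prod>e\<in>M. - (w e * z e))"
      using fin arc_permutations_union(2)[OF CP M] by (rule prod.union_disjoint)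
    then show "F (C \<union> M) = cycle_coefficient C * (\<Prod>e\<in>C. z e) *
        ((-1) ^ (card M div 2) * (\<Prod>e\<in>M. w e * z e) *
          (\<Prod>u\<in>T - tail G ` C - tail G ` M. complex_of_real (d u)))"
      unfolding F_def rest neg s(2) cycle_coefficient_def using s(1) by (simp add: prod.distrib)
  qed
  also have "\<dots> = (\<Sum>C\<in>oriented_cycles T. cycle_coefficient C * (\<Prod>e\<in>C. z e) *
       complex_of_real (matching_value d (T - tail G ` C)))"
  proof (intro sum.cong refl arg_cong[where f = "(*) _"] matching_sum_complex)
    fix e assume e: "e \<in> arcs G"
    then have "w e * z e * (w (arev e) * z (arev e)) = w e * cnj (w e) * (z e * z (arev e))"
      by (simp add: weight_arev)
    then show "w e * z e * (w (arev e) * z (arev e)) = complex_of_real ((cmod (w e))\<^sup>2)"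
      by (simp only: complex_norm_square z[OF e] mult_1_right)
  qed (use T in auto)
  finally show ?thesis
    using schroedinger_det_arc_permutations[OF T, of d z] by (simp add: F_def)
qed

end

section \<open>Generic voltages and the choice of a starting vertex\<close>

lemma set_det_swap_rows:
  assumes S: "finite S" "a \<in> S" "b \<in> S" "a \<noteq> b"
  shows "set_det S (A(a := R, b := Q)) = - set_det S (A(a := Q, b := R))"
proof -
  let ?B = "\<lambda>R Q. set_det S (A(a := R, b := Q))"
  have eq0: "?B P P = 0" for P using S by (intro set_det_equal_rows[of S a b]) auto
  have left: "?B (\<lambda>j. P j + 1 * P' j) X = ?B P X + ?B P' X" for P P' X
    using set_det_row_add[OF S(1,2), of "A(b := X)" P 1 P'] S(4) by (simp add: fun_upd_twist)
  have right: "?B X (\<lambda>j. P j + 1 * P' j) = ?B X P + ?B X P'" for P P' X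
    using set_det_row_add[OF S(1,3), of "A(a := X)" P 1 P'] by simp
  have "0 = ?B R Q + ?B Q R"
    using eq0[of "\<lambda>j. R j + 1 * Q j"] unfolding left right by (simp add: eq0)
  then show ?thesis by (simp add: eq_neg_iff_add_eq_0)
qed

text \<open>The right side contains \<zeta>^2 with coefficient \<omega> S^2, while the left side has
  degree at most one; hence S = 0, and then the right side has no term of degree one either.\<close>

lemma Laurent_coefficient_vanishes:
  fixes A B C q R S T k \<omega> :: complex
  assumes eq: "\<And>\<zeta>. \<zeta> \<noteq> 0 \<Longrightarrow> (A + \<zeta> * B + C / \<zeta>) * q =
      (R + \<zeta> * S + T / \<zeta>) * (k + \<omega> * (R + \<zeta> * S + T / \<zeta>))"
    and "q \<noteq> 0" "\<omega> \<noteq> 0"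
  shows "B = 0"
proof -
  \<comment> \<open>\<open>c\<close>, \<open>b\<close>, \<open>m\<close>, \<open>b'\<close>,
    \<open>c'\<close> are the coefficients in degrees 4, 3, 2, 1, 0 of the right side minus the left
    side, multiplied by \<zeta>^2.\<close>
  define c where "c = \<omega> * S\<^sup>2"
  define c' where "c' = \<omega> * T\<^sup>2"
  define b where "b = k * S + 2 * \<omega> * R * S - B * q"
  define b' where "b' = k * T + 2 * \<omega> * R * T - C * q"
  define m where "m = k * R + \<omega> * R\<^sup>2 + 2 * \<omega> * S * T - A * q"
  have *: "c * \<zeta> ^ 4 + b * \<zeta> ^ 3 + m * \<zeta>\<^sup>2 + b' * \<zeta> + c' = 0" if "\<zeta> \<noteq> 0" for \<zeta>
  proof -
    have "Q * q * \<zeta> = P * (k * \<zeta> + \<omega> * P)" if "(Q / \<zeta>) * q = (P / \<zeta>) * (k + \<omega> * (P / \<zeta>))" for P Q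
      using that \<open>\<zeta> \<noteq> 0\<close> by (simp add: field_simps)
    moreover have "R + \<zeta> * S + T / \<zeta> = (R * \<zeta> + \<zeta>\<^sup>2 * S + T) / \<zeta>"
      "A + \<zeta> * B + C / \<zeta> = (A * \<zeta> + \<zeta>\<^sup>2 * B + C) / \<zeta>"
      using that by (simp_all add: field_simps power2_eq_square)
    ultimately have "(A * \<zeta> + \<zeta>\<^sup>2 * B + C) * q * \<zeta> = (R * \<zeta> + \<zeta>\<^sup>2 * S + T) * (k * \<zeta> + \<omega> * (R * \<zeta> + \<zeta>\<^sup>2 * S + T))"
      using eq[OF that] by simp
    then show ?thesis
      unfolding c_def c'_def b_def b'_def m_def by algebra
  qed
  let ?p = "[:c', b', m, b, c:]"
  have "poly ?p \<zeta> = 0" if "\<zeta> \<noteq> 0" for \<zeta>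
    using *[OF that] by (simp add: algebra_simps power2_eq_square power3_eq_cube power4_eq_xxxx)
  then have "UNIV - {0} \<subseteq> {\<zeta>. poly ?p \<zeta> = 0}" by blast
  moreover have "infinite (UNIV - {0 :: complex})" by (simp add: infinite_UNIV_char_0)
  ultimately have "?p = 0" using poly_roots_finite finite_subset by blast
  then have "c = 0" "b = 0" by simp_all
  then show "B = 0" using assms(2,3) by (simp add: c_def b_def)
qed

text \<open>The lowest nonzero digit would be divisible by 3, although its absolute value is at most
  2.\<close>

lemma ternary_digits_unique:
  fixes \<delta> :: "'a \<Rightarrow> int"
  assumes "finite A" "inj_on idx A" "\<And>x. x \<in> A \<Longrightarrow> \<bar>\<delta> x\<bar> \<le> 2" "(\<Sum>x\<in>A. \<delta> x * 3 ^ idx x) = 0" "x \<in> A"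
  shows "\<delta> x = 0"
proof (rule ccontr)
  assume "\<delta> x \<noteq> 0"
  define B where "B = {y \<in> A. \<delta> y \<noteq> 0}"
  have B: "finite B" "B \<noteq> {}" "x \<in> B" using assms \<open>\<delta> x \<noteq> 0\<close> by (auto simp: B_def)
  then obtain y where y: "y \<in> B" "\<And>u. u \<in> B \<Longrightarrow> idx y \<le> idx u"
    using ex_min_if_finite[of "idx ` B"] by (metis arg_min_if_finite(1) arg_min_least)
  have "0 = (\<Sum>x\<in>B. \<delta> x * 3 ^ idx x)"
  proof -
    have "(\<Sum>x\<in>B. \<delta> x * 3 ^ idx x) = (\<Sum>x\<in>A. \<delta> x * 3 ^ idx x)"
      using assms(1) by (intro sum.mono_neutral_left) (auto simp: B_def)
    then show ?thesis using assms(4) by simp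
  qed
  also have "\<dots> = \<delta> y * 3 ^ idx y + (\<Sum>x\<in>B - {y}. \<delta> x * 3 ^ idx x)"
    using B y by (intro sum.remove) auto
  also have "(\<Sum>x\<in>B - {y}. \<delta> x * 3 ^ idx x) = 3 ^ Suc (idx y) * (\<Sum>x\<in>B - {y}. \<delta> x * 3 ^ (idx x - Suc (idx y)))"
    unfolding sum_distrib_left
  proof (intro sum.cong refl)
    fix u assume u: "u \<in> B - {y}"
    then have "idx u \<noteq> idx y" using inj_onD[OF assms(2), of u y] y(1) by (auto simp: B_def)
    then have "Suc (idx y) \<le> idx u" using y(2)[of u] u by simp
    then have "(3 :: int) ^ idx u = 3 ^ Suc (idx y) * 3 ^ (idx u - Suc (idx y))"
      by (simp only: power_add[symmetric]) simp
    then show "\<delta> u * 3 ^ idx u = 3 ^ Suc (idx y) * (\<delta> u * 3 ^ (idx u - Suc (idx y)))"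
      by (simp only: mult_ac)
  qed
  finally have "3 ^ idx y * (\<delta> y + 3 * (\<Sum>x\<in>B - {y}. \<delta> x * 3 ^ (idx x - Suc (idx y)))) = 0"
    by (simp add: algebra_simps)
  then have "3 dvd \<delta> y" by (simp add: add_eq_0_iff) (metis dvd_minus_iff dvd_triv_left)
  moreover have "\<bar>\<delta> y\<bar> \<le> 2" "\<delta> y \<noteq> 0" using y(1) assms(3) by (auto simp: B_def)
  ultimately show False using dvd_imp_le_int[of "\<delta> y" 3] by simp
qed

context fin_schroedinger begin

text \<open>Voltages may be any nonzero complex numbers rather than only numbers of modulus one, so
  that each of them can serve as the variable of a Laurent polynomial.\<close>

definition is_voltage :: "('e \<Rightarrow> complex) \<Rightarrow> bool" where
  "is_voltage z \<longleftrightarrow> (\<forall>e\<in>arcs G. z e * z (arev e) = 1)"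

definition twist :: "'e \<Rightarrow> complex \<Rightarrow> ('e \<Rightarrow> complex) \<Rightarrow> 'e \<Rightarrow> complex" where
  "twist f \<zeta> z = (\<lambda>e. if e = f then \<zeta> * z e else if e = arev f then z e / \<zeta> else z e)"

lemma is_voltage_twist:
  assumes "is_voltage z" "f \<in> arcs G" "\<zeta> \<noteq> 0"
  shows "is_voltage (twist f \<zeta> z)"
  unfolding is_voltage_def
proof
  fix e assume e: "e \<in> arcs G"
  have "arev f \<noteq> f" using assms(2) by (rule arev_neq)
  moreover have "arev e = f \<longleftrightarrow> e = arev f" "arev e = arev f \<longleftrightarrow> e = f" by (metis arev_arev)+
  ultimately show "twist f \<zeta> z e * twist f \<zeta> z (arev e) = 1"
    using assms(1,3) e by (auto simp: twist_def is_voltage_def)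
qed

lemma finite_oriented_cycles [simp]: "finite (oriented_cycles T)"
  by (rule finite_subset[of _ "Pow (arcs G)"]) (auto simp: oriented_cycles_def)

lemma empty_in_oriented_cycles [simp]: "{} \<in> oriented_cycles T"
  by (simp add: oriented_cycles_def)

lemma oriented_cycles_reverse:
  assumes "C \<in> oriented_cycles T"
  shows "arev ` C \<in> oriented_cycles T" "tail G ` arev ` C = tail G ` C"
proof -
  have C: "C \<subseteq> arcs G" "inj_on (tail G) C" "inj_on (head G) C" "tail G ` C = head G ` C" "tail G ` C \<subseteq> T"
    "\<And>e. e \<in> C \<Longrightarrow> arev e \<notin> C"
    using assms by (auto simp: oriented_cycles_def)
  have th: "tail G ` arev ` C = head G ` C" "head G ` arev ` C = tail G ` C"
    unfolding image_image using C(1) by (auto intro!: image_cong)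
  show "tail G ` arev ` C = tail G ` C" using th C(4) by simp
  have "inj_on (tail G) (arev ` C)" "inj_on (head G) (arev ` C)"
    using C(1-3) by (auto simp: inj_on_def subset_eq)
  moreover have "arev e \<notin> arev ` C" if "e \<in> arev ` C" for e
    using that C(6) by auto
  moreover have "arev ` C \<subseteq> arcs G" using C(1) by auto
  ultimately show "arev ` C \<in> oriented_cycles T"
    using th C(4,5) unfolding oriented_cycles_def by auto
qed

text \<open>Only the empty cycle contributes to the expansion, so the voltages disappear from the
  determinant.\<close>

lemma schroedinger_det_const:
  assumes "finite U" "cycles_vanish d U" "is_voltage z"
  shows "set_det U (schroedinger_matrix d z) = complex_of_real (matching_value d U)"
proof -
  have "set_det U (schroedinger_matrix d z) = (\<Sum>C\<in>oriented_cycles U. cycle_coefficient C * (\<Prod>e\<in>C. z e) *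
       complex_of_real (matching_value d (U - tail G ` C)))"
    using assms by (intro schroedinger_det_cycles) (auto simp: is_voltage_def)
  also have "\<dots> = (\<Sum>C\<in>{{}}. cycle_coefficient C * (\<Prod>e\<in>C. z e) *
       complex_of_real (matching_value d (U - tail G ` C)))"
    using assms(2) by (intro sum.mono_neutral_right) (auto simp: cycles_vanish_def)
  also have "\<dots> = complex_of_real (matching_value d U)"
  proof -
    have "arc_perm {} = id" by (auto simp: arc_perm_def)
    then show ?thesis by (simp add: cycle_coefficient_def sign_id)
  qed
  finally show ?thesis .
qed

text \<open>When the determinant does not depend on the voltages, all cofactors at \<open>(a, b)\<close> that avoid the
  arc \<open>e\<close> vanish, and Jacobi's identity takes the following form.\<close>

lemma schroedinger_det_edge:
  assumes U: "finite U" "cycles_vanish d U" "matching_value d U \<noteq> 0" and z: "is_voltage z"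
    and e: "e \<in> arcs G" "tail G e = a" "head G e = b" "a \<in> U" "b \<in> U" "a \<noteq> b"
  shows "set_det (U - {a}) (schroedinger_matrix d z) * set_det (U - {b}) (schroedinger_matrix d z) =
    set_det (U - {a, b}) (schroedinger_matrix d z) * (complex_of_real (matching_value d U) +
      complex_of_real ((cmod (w e))\<^sup>2) * set_det (U - {a, b}) (schroedinger_matrix d z))"
proof -
  let ?k = "complex_of_real (matching_value d U)" and ?\<omega> = "complex_of_real ((cmod (w e))\<^sup>2)"
  define A where "A = (\<lambda>\<zeta>. schroedinger_matrix d (twist e \<zeta> z))"
  define \<alpha> where "\<alpha> = (\<lambda>\<zeta>. - (w e * (\<zeta> * z e)))"
  define \<beta> where "\<beta> = (\<lambda>\<zeta>. - (w (arev e) * (z (arev e) / \<zeta>)))"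
  \<comment> \<open>\<open>B\<close> is the matrix with the edge of \<open>e\<close> removed. The
    twisted matrix differs from it only by \<alpha> at (a, b) and by \<beta> at (b, a).\<close>
  define B where "B = (\<lambda>u v. (if v = u then complex_of_real (d u) else 0) -
    (\<Sum>f\<in>arcs_into u {v} - {e, arev e}. w f * z f))"
  have ae: "arev e \<in> arcs G" "arev e \<noteq> e" "tail G (arev e) = b" "head G (arev e) = a"
    using e arev_neq[OF e(1)] by auto
  note twist_upd = fun_upd_twist[OF e(6)[symmetric]]
  have A: "A \<zeta> = B(a := (\<lambda>v. B a v + \<alpha> \<zeta> * unit_row b v), b := (\<lambda>v. B b v + \<beta> \<zeta> * unit_row a v))" for \<zeta>
  proof (intro ext)
    fix u v
    have rest: "(\<Sum>f\<in>arcs_into u {v} - {e, arev e}. w f * twist e \<zeta> z f) = (\<Sum>f\<in>arcs_into u {v} - {e, arev e}. w f * z f)"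
      by (intro sum.cong) (auto simp: twist_def)
    define R where "R = (\<Sum>f\<in>arcs_into u {v} - {e, arev e}. w f * z f)"
    have entry: "A \<zeta> u v = (if v = u then complex_of_real (d u) else 0) - (\<Sum>f\<in>arcs_into u {v}. w f * twist e \<zeta> z f)"
      "B u v = (if v = u then complex_of_real (d u) else 0) - R"
      by (simp_all add: A_def B_def schroedinger_matrix_def R_def)
    have tw: "twist e \<zeta> z e = \<zeta> * z e" "twist e \<zeta> z (arev e) = z (arev e) / \<zeta>"
      using ae(2) by (simp_all add: twist_def)
    consider "u = a" "v = b" | "u = b" "v = a" | "(u, v) \<noteq> (a, b)" "(u, v) \<noteq> (b, a)" by blast
    then show "A \<zeta> u v = (B(a := (\<lambda>v. B a v + \<alpha> \<zeta> * unit_row b v), b := (\<lambda>v. B b v + \<beta> \<zeta> * unit_row a v))) u v"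
    proof cases
      case 1
      have "e \<in> arcs_into u {v}" "arev e \<notin> arcs_into u {v}" using e ae 1 by (simp_all add: arcs_into_def)
      moreover from this(2) have "arcs_into u {v} - {e} = arcs_into u {v} - {e, arev e}" by blast
      ultimately have "(\<Sum>f\<in>arcs_into u {v}. w f * twist e \<zeta> z f) = w e * (\<zeta> * z e) + R"
        using sum.remove[of "arcs_into u {v}" e "\<lambda>f. w f * twist e \<zeta> z f"] rest
        by (simp only: finite_arcs_into tw R_def)
      then have "A \<zeta> u v = B u v + \<alpha> \<zeta>" unfolding entry by (simp add: \<alpha>_def)
      then show ?thesis using 1 e(6) by (simp add: unit_row_def)
    next
      case 2
      have "arev e \<in> arcs_into u {v}" "e \<notin> arcs_into u {v}" using e ae 2 by (simp_all add: arcs_into_def)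
      moreover from this(2) have "arcs_into u {v} - {arev e} = arcs_into u {v} - {e, arev e}" by blast
      ultimately have "(\<Sum>f\<in>arcs_into u {v}. w f * twist e \<zeta> z f) = w (arev e) * (z (arev e) / \<zeta>) + R"
        using sum.remove[of "arcs_into u {v}" "arev e" "\<lambda>f. w f * twist e \<zeta> z f"] rest
        by (simp only: finite_arcs_into tw R_def)
      then have "A \<zeta> u v = B u v + \<beta> \<zeta>" unfolding entry by (simp add: \<beta>_def)
      then show ?thesis using 2 e(6) by (simp add: unit_row_def)
    next
      case 3
      have "e \<notin> arcs_into u {v}" "arev e \<notin> arcs_into u {v}" using e(2,3) ae(3,4) 3 by (auto simp: arcs_into_def)
      then have "arcs_into u {v} - {e, arev e} = arcs_into u {v}" by blast
      then have "A \<zeta> u v = B u v" using rest unfolding entry R_def by (simp only:)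
      then show ?thesis using 3 by (simp add: unit_row_def)
    qed
  qed
  define r where "r = set_det (U - {a, b}) (schroedinger_matrix d z)"
  define x where "x = set_det U (B(a := unit_row b))"
  define y where "y = set_det U (B(b := unit_row a))"
  have "twist e 1 z = z" by (auto simp: twist_def)
  then have A1: "schroedinger_matrix d z = A 1" by (simp add: A_def)
  have \<alpha>\<beta>: "\<alpha> \<zeta> * \<beta> \<zeta> = ?\<omega>" if "\<zeta> \<noteq> 0" for \<zeta>
  proof -
    have "\<alpha> \<zeta> * \<beta> \<zeta> = (w e * cnj (w e)) * (z e * z (arev e))"
      using that e(1) by (simp add: \<alpha>_def \<beta>_def weight_arev)
    also have "\<dots> = ?\<omega>" using z e(1) unfolding is_voltage_def by (simp only: complex_norm_square mult_1_right)
    finally show ?thesis .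
  qed
  have r: "set_det U (B(a := unit_row b, b := unit_row a)) = - r"
  proof -
    have "set_det U (B(a := unit_row b, b := unit_row a)) = - set_det U (B(b := unit_row b, a := unit_row a))"
      using U(1) e by (subst set_det_swap_rows) (simp_all add: twist_upd)
    also have "\<dots> = - set_det (U - {a} - {b}) B"
      using U(1) e by (subst set_det_remove, simp, simp, subst set_det_remove) auto
    also have "U - {a} - {b} = U - {a, b}" by auto
    also have "set_det (U - {a, b}) B = r"
      unfolding r_def A1 A by (rule set_det_cong) auto
    finally show ?thesis .
  qed
  have upd: "B(a := R, b := B b) = B(a := R)" for R using e(6) by auto
  have expand: "set_det U (A \<zeta>) = set_det U B + \<alpha> \<zeta> * x + \<beta> \<zeta> * y - \<alpha> \<zeta> * \<beta> \<zeta> * r" for \<zeta>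
  proof -
    have "set_det U (A \<zeta>) = set_det U (B(a := (\<lambda>v. B a v + \<alpha> \<zeta> * unit_row b v))) +
        \<beta> \<zeta> * set_det U (B(b := unit_row a, a := (\<lambda>v. B a v + \<alpha> \<zeta> * unit_row b v)))"
      unfolding A using set_det_row_add[OF U(1) e(5), of "B(a := (\<lambda>v. B a v + \<alpha> \<zeta> * unit_row b v))" "B b" "\<beta> \<zeta>" "unit_row a"] e(6)
      by (simp add: twist_upd upd)
    also have "set_det U (B(a := (\<lambda>v. B a v + \<alpha> \<zeta> * unit_row b v))) = set_det U B + \<alpha> \<zeta> * x"
      using set_det_row_add[OF U(1) e(4), of B "B a" "\<alpha> \<zeta>" "unit_row b"] by (simp add: x_def)
    also have "set_det U (B(b := unit_row a, a := (\<lambda>v. B a v + \<alpha> \<zeta> * unit_row b v))) = y - \<alpha> \<zeta> * r"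
    proof -
      have "(B(b := unit_row a))(a := B a) = B(b := unit_row a)" using e(6) by auto
      then show ?thesis
        using set_det_row_add[OF U(1) e(4), of "B(b := unit_row a)" "B a" "\<alpha> \<zeta>" "unit_row b"] r e(6)
        by (simp add: y_def twist_upd)
    qed
    finally show ?thesis by (simp add: algebra_simps)
  qed
  have k: "set_det U (A \<zeta>) = ?k" if "\<zeta> \<noteq> 0" for \<zeta>
    unfolding A_def using U z e(1) that by (intro schroedinger_det_const is_voltage_twist)
  have const: "\<alpha> \<zeta> * x + \<beta> \<zeta> * y = ?k - set_det U B + ?\<omega> * r" if "\<zeta> \<noteq> 0" for \<zeta>
    using expand[of \<zeta>] k[OF that] \<alpha>\<beta>[OF that] by (simp add: algebra_simps)
  define c where "c = ?k - set_det U B + ?\<omega> * r"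
  \<comment> \<open>The determinant is constant in \<zeta>, so a combination of \<zeta> and
    1/\<zeta> is constant. The values 1 and -1 show that the constant is zero, and the value 2
    separates the two terms.\<close>
  have "\<alpha> (-1) = - \<alpha> 1" "\<beta> (-1) = - \<beta> 1" "\<alpha> 2 = 2 * \<alpha> 1" "\<beta> 1 = 2 * \<beta> 2" by (auto simp: \<alpha>_def \<beta>_def)
  then have sys: "\<alpha> 1 * x + \<beta> 1 * y = c" "- (\<alpha> 1 * x) - \<beta> 1 * y = c" "4 * (\<alpha> 1 * x) + \<beta> 1 * y = 2 * c"
    using const[of 1] const[of "-1"] const[of 2] unfolding c_def[symmetric] by (auto simp: algebra_simps)
  have "c + c = (\<alpha> 1 * x + \<beta> 1 * y) + (- (\<alpha> 1 * x) - \<beta> 1 * y)" using sys(1,2) by (simp only:)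
  then have "c = 0" by simp
  moreover have "3 * (\<alpha> 1 * x) = (4 * (\<alpha> 1 * x) + \<beta> 1 * y) - (\<alpha> 1 * x + \<beta> 1 * y)" by simp
  ultimately have xy: "\<alpha> 1 * x = 0" "\<beta> 1 * y = 0" using sys by auto
  have nz: "\<alpha> 1 \<noteq> 0" "\<beta> 1 \<noteq> 0" using \<alpha>\<beta>[of 1] weight_nonzero[OF e(1)] by auto
  with xy have xy: "x = 0" "y = 0" by auto
  \<comment> \<open>With \<open>x\<close> and \<open>y\<close> gone, the two off-diagonal cofactors
    are multiples of \<open>r\<close>; their product in Jacobi's identity is |w e|^2 times
    \<open>r\<close> squared.\<close>
  have "set_det U ((A 1)(a := unit_row b)) = - (\<beta> 1 * r)"
  proof -
    have "(A 1)(a := unit_row b) = (B(a := unit_row b))(b := (\<lambda>v. B b v + \<beta> 1 * unit_row a v))"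
      unfolding A using e(6) by (auto simp: fun_eq_iff)
    moreover have "(B(a := unit_row b))(b := B b) = B(a := unit_row b)" using e(6) by auto
    ultimately show ?thesis
      using set_det_row_add[OF U(1) e(5), of "B(a := unit_row b)" "B b" "\<beta> 1" "unit_row a"] r xy
      by (simp add: x_def)
  qed
  moreover have "set_det U ((A 1)(b := unit_row a)) = - (\<alpha> 1 * r)"
  proof -
    have "(A 1)(b := unit_row a) = (B(b := unit_row a))(a := (\<lambda>v. B a v + \<alpha> 1 * unit_row b v))"
      unfolding A using e(6) by (auto simp: fun_eq_iff)
    moreover have "(B(b := unit_row a))(a := B a) = B(b := unit_row a)" using e(6) by auto
    ultimately show ?thesis
      using set_det_row_add[OF U(1) e(4), of "B(b := unit_row a)" "B a" "\<alpha> 1" "unit_row b"] r xy e(6)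
      by (simp add: y_def twist_upd)
  qed
  moreover have "set_det U (A 1) * set_det (U - {a, b}) (A 1) = set_det (U - {a}) (A 1) * set_det (U - {b}) (A 1) -
      set_det U ((A 1)(b := unit_row a)) * set_det U ((A 1)(a := unit_row b))"
    using U e k[of 1] by (intro set_det_Jacobi) auto
  ultimately show ?thesis
    using k[of 1] \<alpha>\<beta>[of 1] unfolding A1[symmetric] r_def[symmetric] by (simp add: algebra_simps)
qed

text \<open>The voltages \<open>z\<^sub>e = s ^ h(e)\<close> with \<open>h(e) = 3 ^ idx e - 3 ^ idx (arev e)\<close> separate the monomials of
  distinct oriented cycles.\<close>

lemma separating_exponents:
  "\<exists>h :: 'e \<Rightarrow> int. (\<forall>e. h (arev e) = - h e) \<and> inj_on (\<lambda>C. \<Sum>e\<in>C. h e) (oriented_cycles T)"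
proof -
  obtain idx :: "'e \<Rightarrow> nat" where idx: "inj_on idx (arcs G)"
    using finite_imp_inj_to_nat_seg[OF finite_arcs] by blast
  define h where "h = (\<lambda>e. (3 :: int) ^ idx e - 3 ^ idx (arev e))"
  \<comment> \<open>The ternary digits of the exponent of a cycle, with values -1, 0 and 1; digits
    of two cycles differ by at most 2.\<close>
  define \<epsilon> where "\<epsilon> = (\<lambda>C e. of_bool (e \<in> C) - of_bool (arev e \<in> C) :: int)"
  have sum: "(\<Sum>e\<in>C. h e) = (\<Sum>e\<in>arcs G. \<epsilon> C e * 3 ^ idx e)" if "C \<subseteq> arcs G" for C
  proof -
    have "(\<Sum>e\<in>arcs G. \<epsilon> C e * 3 ^ idx e) = (\<Sum>e\<in>arcs G. of_bool (e \<in> C) * 3 ^ idx e) -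
        (\<Sum>e\<in>arcs G. of_bool (arev e \<in> C) * 3 ^ idx e)"
      by (simp add: \<epsilon>_def left_diff_distrib sum_subtractf)
    also have "(\<Sum>e\<in>arcs G. of_bool (arev e \<in> C) * (3 :: int) ^ idx e) = (\<Sum>e\<in>arcs G. of_bool (e \<in> C) * 3 ^ idx (arev e))"
      by (rule sum.reindex_bij_witness[where i = arev and j = arev]) auto
    also have "(\<Sum>e\<in>arcs G. of_bool (e \<in> C) * (3 :: int) ^ idx e) - \<dots> = (\<Sum>e\<in>arcs G. of_bool (e \<in> C) * h e)"
      by (simp add: h_def right_diff_distrib sum_subtractf)
    also have "\<dots> = (\<Sum>e\<in>C. of_bool (e \<in> C) * h e)"
      using that by (intro sum.mono_neutral_right) auto
    finally show ?thesis by simp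
  qed
  have sub: "C \<subseteq> C'" if C: "C \<in> oriented_cycles T" "C' \<in> oriented_cycles T"
    "(\<Sum>e\<in>C. h e) = (\<Sum>e\<in>C'. h e)" for C C'
  proof
    fix e assume e: "e \<in> C"
    have arcs: "C \<subseteq> arcs G" "C' \<subseteq> arcs G" using C(1,2) by (auto simp: oriented_cycles_def)
    have "\<epsilon> C e - \<epsilon> C' e = 0"
    proof (rule ternary_digits_unique[OF finite_arcs idx])
      show "(\<Sum>x\<in>arcs G. (\<epsilon> C x - \<epsilon> C' x) * 3 ^ idx x) = 0"
        using C(3) unfolding sum[OF arcs(1)] sum[OF arcs(2)] by (simp add: left_diff_distrib sum_subtractf)
      show "e \<in> arcs G" using arcs e by blast
      show "\<bar>\<epsilon> C x - \<epsilon> C' x\<bar> \<le> 2" for x by (simp add: \<epsilon>_def of_bool_def)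
    qed
    moreover have "\<epsilon> C e = 1" using C(1) e by (simp add: \<epsilon>_def oriented_cycles_def)
    ultimately show "e \<in> C'" by (auto simp: \<epsilon>_def of_bool_def split: if_splits)
  qed
  show ?thesis
  proof (intro exI conjI)
    show "\<forall>e. h (arev e) = - h e" by (simp add: h_def)
    show "inj_on (\<lambda>C. \<Sum>e\<in>C. h e) (oriented_cycles T)"
    proof (rule inj_onI)
      fix C C' assume "C \<in> oriented_cycles T" "C' \<in> oriented_cycles T" "(\<Sum>e\<in>C. h e) = (\<Sum>e\<in>C'. h e)"
      then show "C = C'" using sub[of C C'] sub[of C' C] by simp
    qed
  qed
qed

text \<open>A Laurent polynomial with distinct exponents cannot cancel the term of \<open>x\<close>.
  Multiplying by a high enough power of \<open>s\<close> makes it an ordinary nonzero polynomial,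
  which has finitely many roots.\<close>

lemma generic_polynomial:
  fixes h :: "'b \<Rightarrow> int" and c :: "'b \<Rightarrow> complex"
  assumes F: "finite F" "inj_on h F" "x \<in> F" "c x \<noteq> 0"
  shows "finite {s. s \<noteq> 0 \<and> (\<Sum>y\<in>F. c y * s powi h y) = 0}"
proof -
  define N where "N = (\<Sum>y\<in>F. \<bar>h y\<bar>)"
  have N: "0 \<le> h y + N" if "y \<in> F" for y
    using member_le_sum[of y F "\<lambda>y. \<bar>h y\<bar>"] that F(1) by (simp add: N_def)
  define p where "p = (\<Sum>y\<in>F. monom (c y) (nat (h y + N)))"
  have "coeff p (nat (h x + N)) = (\<Sum>y\<in>F. if y = x then c y else 0)"
    unfolding p_def coeff_sum coeff_monom
  proof (intro sum.cong refl)
    fix y assume y: "y \<in> F"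
    have "nat (h y + N) = nat (h x + N) \<longleftrightarrow> h y = h x"
      using N[OF y] N[OF F(3)] by linarith
    then have "nat (h y + N) = nat (h x + N) \<longleftrightarrow> y = x"
      using inj_on_eq_iff[OF F(2) y F(3)] by simp
    then show "(if nat (h y + N) = nat (h x + N) then c y else 0) = (if y = x then c y else 0)" by simp
  qed
  then have "p \<noteq> 0" using F by auto
  moreover have "poly p s = s powi N * (\<Sum>y\<in>F. c y * s powi h y)" if "s \<noteq> 0" for s
    unfolding p_def poly_sum poly_monom sum_distrib_left
  proof (intro sum.cong refl)
    fix y assume "y \<in> F"
    then have "s ^ nat (h y + N) = s powi (N + h y)" using N[of y] by (simp add: power_int_def add.commute)
    also have "\<dots> = s powi N * s powi h y" using that by (simp add: power_int_add)
    finally show "c y * s ^ nat (h y + N) = s powi N * (c y * s powi h y)" by simp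
  qed
  ultimately show ?thesis
    by (intro finite_subset[OF _ poly_roots_finite[of p]]) auto
qed

text \<open>Substituting \<open>z e = s powi h e\<close> with separating exponents turns both sums
  into nonzero Laurent polynomials in \<open>s\<close>; a single \<open>s\<close> outside their
  finitely many roots serves for both.\<close>

lemma generic_voltage:
  assumes F: "F \<subseteq> oriented_cycles T" "C \<in> F" "c C \<noteq> 0"
    and F': "F' \<subseteq> oriented_cycles T" "C' \<in> F'" "c' C' \<noteq> 0"
  obtains z where "is_voltage z" "(\<Sum>C\<in>F. c C * (\<Prod>e\<in>C. z e)) \<noteq> 0" "(\<Sum>C\<in>F'. c' C * (\<Prod>e\<in>C. z e)) \<noteq> 0"
proof -
  obtain h :: "'e \<Rightarrow> int" where h: "\<forall>e. h (arev e) = - h e"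
    "inj_on (\<lambda>C. \<Sum>e\<in>C. h e) (oriented_cycles T)"
    using separating_exponents[of T] by (elim exE conjE)
  let ?B = "\<lambda>F c. {s. s \<noteq> 0 \<and> (\<Sum>C\<in>F. c C * s powi (\<Sum>e\<in>C. h e)) = 0}"
  have "finite (?B F c)"
    by (rule generic_polynomial[where c = c and x = C and h = "\<lambda>C. \<Sum>e\<in>C. h e", OF finite_subset[OF F(1) finite_oriented_cycles] inj_on_subset[OF h(2) F(1)] F(2,3)])
  moreover have "finite (?B F' c')"
    by (rule generic_polynomial[where c = c' and x = C' and h = "\<lambda>C. \<Sum>e\<in>C. h e", OF finite_subset[OF F'(1) finite_oriented_cycles] inj_on_subset[OF h(2) F'(1)] F'(2,3)])
  ultimately have "finite (?B F c \<union> ?B F' c' \<union> {0})" by (intro finite_UnI finite.intros)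
  then have "\<exists>s. s \<notin> ?B F c \<union> ?B F' c' \<union> {0}" by (rule ex_new_if_finite[OF infinite_UNIV_char_0])
  then obtain s where s: "s \<notin> ?B F c \<union> ?B F' c' \<union> {0}" by (elim exE)
  define z where "z = (\<lambda>e. s powi h e)"
  have s0: "s \<noteq> 0" using s by simp
  have "is_voltage z"
    using s0 by (simp add: is_voltage_def z_def h(1) power_int_minus)
  moreover have "(\<Prod>e\<in>C. z e) = s powi (\<Sum>e\<in>C. h e)" for C
    using s0 by (induction C rule: infinite_finite_induct) (simp_all add: z_def power_int_add)
  ultimately show ?thesis using s s0 by (intro that[of z]) simp_all
qed

definition cycle_term :: "('v \<Rightarrow> real) \<Rightarrow> 'v set \<Rightarrow> 'e set \<Rightarrow> complex" where
  "cycle_term d T C = cycle_coefficient C * complex_of_real (matching_value d (T - tail G ` C))"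

lemma cycle_term_eq_0: "C \<in> oriented_cycles T \<Longrightarrow> cycle_term d T C = 0 \<longleftrightarrow> matching_value d (T - tail G ` C) = 0"
  using cycle_coefficient_nonzero[of C] by (auto simp: cycle_term_def oriented_cycles_def)

text \<open>An oriented cycle contains at most one of \<open>f\<close> and \<open>arev f\<close>,
  and at most once, so the determinant has degree between -1 and 1 in \<zeta>.\<close>

lemma schroedinger_det_twist:
  assumes T: "finite T" and z: "is_voltage z" and f: "f \<in> arcs G" and "\<zeta> \<noteq> 0"
  shows "set_det T (schroedinger_matrix d (twist f \<zeta> z)) =
    (\<Sum>C | C \<in> oriented_cycles T \<and> f \<notin> C \<and> arev f \<notin> C. cycle_term d T C * (\<Prod>e\<in>C. z e)) +
    \<zeta> * (\<Sum>C | C \<in> oriented_cycles T \<and> f \<in> C. cycle_term d T C * (\<Prod>e\<in>C. z e)) +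
    (\<Sum>C | C \<in> oriented_cycles T \<and> arev f \<in> C. cycle_term d T C * (\<Prod>e\<in>C. z e)) / \<zeta>"
proof -
  let ?t = "\<lambda>C. cycle_term d T C * (\<Prod>e\<in>C. twist f \<zeta> z e)"
  have neq: "arev f \<noteq> f" using f by (rule arev_neq)
  have split: "oriented_cycles T = {C \<in> oriented_cycles T. f \<notin> C \<and> arev f \<notin> C} \<union>
      ({C \<in> oriented_cycles T. f \<in> C} \<union> {C \<in> oriented_cycles T. arev f \<in> C})"
    by auto
  have excl: "arev f \<notin> C" if "C \<in> oriented_cycles T" "f \<in> C" for C
    using that by (auto simp: oriented_cycles_def)
  have fin: "finite C" if "C \<in> oriented_cycles T" for C
    using that finite_subset[OF _ finite_arcs] by (auto simp: oriented_cycles_def)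
  have "set_det T (schroedinger_matrix d (twist f \<zeta> z)) = sum ?t (oriented_cycles T)"
    using schroedinger_det_cycles[OF T, of "twist f \<zeta> z" d] is_voltage_twist[OF z f \<open>\<zeta> \<noteq> 0\<close>]
    by (simp add: is_voltage_def cycle_term_def mult_ac)
  also have "\<dots> = sum ?t {C \<in> oriented_cycles T. f \<notin> C \<and> arev f \<notin> C} +
      (sum ?t {C \<in> oriented_cycles T. f \<in> C} + sum ?t {C \<in> oriented_cycles T. arev f \<in> C})"
    using excl by (subst split, subst sum.union_disjoint, simp, simp, blast, subst sum.union_disjoint) auto
  also have "sum ?t {C \<in> oriented_cycles T. f \<notin> C \<and> arev f \<notin> C} =
      (\<Sum>C | C \<in> oriented_cycles T \<and> f \<notin> C \<and> arev f \<notin> C. cycle_term d T C * (\<Prod>e\<in>C. z e))"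
    by (intro sum.cong refl arg_cong[where f = "(*) _"] prod.cong) (auto simp: twist_def)
  also have "sum ?t {C \<in> oriented_cycles T. f \<in> C} =
      \<zeta> * (\<Sum>C | C \<in> oriented_cycles T \<and> f \<in> C. cycle_term d T C * (\<Prod>e\<in>C. z e))"
    unfolding sum_distrib_left
  proof (intro sum.cong refl)
    fix C assume "C \<in> {C \<in> oriented_cycles T. f \<in> C}"
    then have C: "C \<in> oriented_cycles T" "f \<in> C" by auto
    have "(\<Prod>e\<in>C - {f}. twist f \<zeta> z e) = (\<Prod>e\<in>C - {f}. z e)"
      using excl[OF C] by (intro prod.cong) (auto simp: twist_def)
    then show "?t C = \<zeta> * (cycle_term d T C * (\<Prod>e\<in>C. z e))"
      using prod.remove[OF fin[OF C(1)] C(2), of "twist f \<zeta> z"] prod.remove[OF fin[OF C(1)] C(2), of z]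
      by (simp add: twist_def)
  qed
  also have "sum ?t {C \<in> oriented_cycles T. arev f \<in> C} =
      (\<Sum>C | C \<in> oriented_cycles T \<and> arev f \<in> C. cycle_term d T C * (\<Prod>e\<in>C. z e)) / \<zeta>"
    unfolding sum_divide_distrib
  proof (intro sum.cong refl)
    fix C assume "C \<in> {C \<in> oriented_cycles T. arev f \<in> C}"
    then have C: "C \<in> oriented_cycles T" "arev f \<in> C" by auto
    have "(\<Prod>e\<in>C - {arev f}. twist f \<zeta> z e) = (\<Prod>e\<in>C - {arev f}. z e)"
      using excl[OF C(1)] C(2) by (intro prod.cong) (auto simp: twist_def)
    then show "?t C = cycle_term d T C * (\<Prod>e\<in>C. z e) / \<zeta>"
      using prod.remove[OF fin[OF C(1)] C(2), of "twist f \<zeta> z"] prod.remove[OF fin[OF C(1)] C(2), of z] neq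
      by (simp add: twist_def)
  qed
  finally show ?thesis by (simp add: add.assoc)
qed

text \<open>Suppose \<open>f\<close> lies in no contributing cycle of \<open>U - {b}\<close>. Then
  the determinant there does not depend on the voltage \<zeta> of \<open>f\<close>, and it is
  nonzero for generic voltages because of \<open>C'\<close>. In the identity of
  \<open>schroedinger_det_edge\<close> the left side then has degree at most one in \<zeta>, so
  \<open>Laurent_coefficient_vanishes\<close> removes the cycles through \<open>f\<close> from the
  determinant at \<open>a\<close>, against the generic choice and \<open>C\<close>.\<close>

lemma cycles_at_neighbour:
  assumes U: "finite U" "cycles_vanish d U" "matching_value d U \<noteq> 0"
    and e: "e \<in> arcs G" "tail G e = a" "head G e = b" "a \<in> U" "b \<in> U"
    and C: "C \<in> oriented_cycles (U - {a})" "f \<in> C" "matching_value d (U - {a} - tail G ` C) \<noteq> 0"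
    and b: "C' \<in> oriented_cycles (U - {b})" "matching_value d (U - {b} - tail G ` C') \<noteq> 0"
  shows "\<exists>C\<in>oriented_cycles (U - {b}). f \<in> C \<and> matching_value d (U - {b} - tail G ` C) \<noteq> 0"
proof (cases "a = b")
  case True
  then show ?thesis using C by blast
next
  case False
  show ?thesis
  proof (rule ccontr)
    assume neg: "\<not> ?thesis"
    define Z where "Z = (\<lambda>T z. \<Sum>C | C \<in> oriented_cycles T \<and> f \<notin> C \<and> arev f \<notin> C. cycle_term d T C * (\<Prod>e\<in>C. z e))"
    define P where "P = (\<lambda>T z. \<Sum>C | C \<in> oriented_cycles T \<and> f \<in> C. cycle_term d T C * (\<Prod>e\<in>C. z e))"
    define N where "N = (\<lambda>T z. \<Sum>C | C \<in> oriented_cycles T \<and> arev f \<in> C. cycle_term d T C * (\<Prod>e\<in>C. z e))"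
    have f: "f \<in> arcs G" using C(1,2) by (auto simp: oriented_cycles_def)
    have Pb: "P (U - {b}) z = 0" for z
      unfolding P_def using neg by (intro sum.neutral) (auto simp: cycle_term_eq_0)
    \<comment> \<open>A contributing cycle through \<open>arev f\<close> reverses to one through
      \<open>f\<close> on the same vertices.\<close>
    have Nb: "N (U - {b}) z = 0" for z
      unfolding N_def
    proof (intro sum.neutral ballI)
      fix D assume "D \<in> {C \<in> oriented_cycles (U - {b}). arev f \<in> C}"
      then have D: "D \<in> oriented_cycles (U - {b})" "arev f \<in> D" by auto
      have "f \<in> arev ` D" using image_eqI[of f arev "arev f" D] D(2) by simp
      then have "matching_value d (U - {b} - tail G ` arev ` D) = 0"
        using neg oriented_cycles_reverse(1)[OF D(1)] by blast
      then have "matching_value d (U - {b} - tail G ` D) = 0"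
        unfolding oriented_cycles_reverse(2)[OF D(1)] .
      then show "cycle_term d (U - {b}) D * (\<Prod>e\<in>D. z e) = 0" using D(1) by (simp add: cycle_term_eq_0)
    qed
    obtain z where z: "is_voltage z" "P (U - {a}) z \<noteq> 0"
      "(\<Sum>C\<in>oriented_cycles (U - {b}). cycle_term d (U - {b}) C * (\<Prod>e\<in>C. z e)) \<noteq> 0"
    proof (rule generic_voltage[where T = U and F = "{C \<in> oriented_cycles (U - {a}). f \<in> C}"
          and F' = "oriented_cycles (U - {b})" and C = C and C' = C' and c = "cycle_term d (U - {a})"
          and c' = "cycle_term d (U - {b})"])
      show "{C \<in> oriented_cycles (U - {a}). f \<in> C} \<subseteq> oriented_cycles U" "oriented_cycles (U - {b}) \<subseteq> oriented_cycles U"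
        using oriented_cycles_mono[of "U - {a}" U] oriented_cycles_mono[of "U - {b}" U] by auto
    qed (use C b that in \<open>auto simp: cycle_term_eq_0 P_def\<close>)
    have det: "set_det T (schroedinger_matrix d (twist f \<zeta> z)) = Z T z + \<zeta> * P T z + N T z / \<zeta>"
      if "finite T" "\<zeta> \<noteq> 0" for T \<zeta>
      unfolding Z_def P_def N_def by (rule schroedinger_det_twist[OF that(1) z(1) f that(2)])
    have "twist f 1 z = z" by (auto simp: twist_def)
    then have "Z (U - {b}) z = set_det (U - {b}) (schroedinger_matrix d z)"
      using det[of "U - {b}" 1] U(1) Pb Nb by simp
    also have "\<dots> = (\<Sum>C\<in>oriented_cycles (U - {b}). cycle_term d (U - {b}) C * (\<Prod>e\<in>C. z e))"
      using schroedinger_det_cycles[of "U - {b}" z d] U(1) z(1) by (simp add: is_voltage_def cycle_term_def mult_ac)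
    finally have qb: "Z (U - {b}) z \<noteq> 0" using z(3) by simp
    have "P (U - {a}) z = 0"
    proof (rule Laurent_coefficient_vanishes)
      fix \<zeta> :: complex assume \<zeta>: "\<zeta> \<noteq> 0"
      show "(Z (U - {a}) z + \<zeta> * P (U - {a}) z + N (U - {a}) z / \<zeta>) * Z (U - {b}) z =
        (Z (U - {a, b}) z + \<zeta> * P (U - {a, b}) z + N (U - {a, b}) z / \<zeta>) *
        (complex_of_real (matching_value d U) + complex_of_real ((cmod (w e))\<^sup>2) *
          (Z (U - {a, b}) z + \<zeta> * P (U - {a, b}) z + N (U - {a, b}) z / \<zeta>))"
        using schroedinger_det_edge[OF U is_voltage_twist[OF z(1) f \<zeta>] e False]
          det[OF _ \<zeta>, of "U - {a}"] det[OF _ \<zeta>, of "U - {b}"] det[OF _ \<zeta>, of "U - {a, b}"] U(1) Pb Nb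
        by simp
    qed (use qb weight_nonzero[OF e(1)] in auto)
    with z(2) show False by simp
  qed
qed

text \<open>If every deletion leaves a contributing nonempty cycle, then the arcs of such a cycle C
  at \<open>a\<close> propagate from vertex to vertex through the component of \<open>a\<close>. A
  cycle cannot contribute after one of its own tails is deleted, so C lies in other components,
  where the deletion of \<open>a\<close> has no effect; hence C would contribute in U
  itself.\<close>

lemma exists_vanishing_start:
  assumes U: "finite U" "cycles_vanish d U" "matching_value d U \<noteq> 0" "U \<noteq> {}"
  shows "\<exists>c\<in>U. cycles_vanish d (U - {c})"
proof (rule ccontr)
  assume none: "\<not> ?thesis"
  have ex: "\<exists>C\<in>oriented_cycles (U - {c}). C \<noteq> {} \<and> matching_value d (U - {c} - tail G ` C) \<noteq> 0" if "c \<in> U" for c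
  proof -
    have "\<not> cycles_vanish d (U - {c})" using none that by simp
    then show ?thesis by (simp add: cycles_vanish_def)
  qed
  obtain a where a: "a \<in> U" using U(4) by blast
  obtain C where C: "C \<in> oriented_cycles (U - {a})" "C \<noteq> {}" "matching_value d (U - {a} - tail G ` C) \<noteq> 0"
    using ex[OF a] by (elim bexE conjE)
  \<comment> \<open>The vertices whose deletion leaves every arc of \<open>C\<close> in a
    contributing cycle. By \<open>cycles_at_neighbour\<close> no edge joins \<open>K\<close> to the
    rest of \<open>U\<close>, so matching values factor over the two parts.\<close>
  define K where "K = {b \<in> U. \<forall>f\<in>C. \<exists>D\<in>oriented_cycles (U - {b}). f \<in> D \<and> matching_value d (U - {b} - tail G ` D) \<noteq> 0}"
  have "\<forall>f\<in>C. \<exists>D\<in>oriented_cycles (U - {a}). f \<in> D \<and> matching_value d (U - {a} - tail G ` D) \<noteq> 0"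
    using C(1,3) by (intro ballI bexI[of _ C] conjI)
  then have aK: "a \<in> K" unfolding K_def by (intro CollectI conjI a)
  have closed: "head G e \<in> K" if e: "e \<in> arcs G" "tail G e \<in> K" "head G e \<in> U" for e
  proof -
    have tU: "tail G e \<in> U" using e(2) unfolding K_def by (elim CollectE conjE)
    obtain C' where C': "C' \<in> oriented_cycles (U - {head G e})" "matching_value d (U - {head G e} - tail G ` C') \<noteq> 0"
      using ex[OF e(3)] by (elim bexE conjE)
    have tK: "\<forall>f\<in>C. \<exists>D\<in>oriented_cycles (U - {tail G e}). f \<in> D \<and> matching_value d (U - {tail G e} - tail G ` D) \<noteq> 0"
      using e(2) unfolding K_def by (elim CollectE conjE)
    have "\<exists>D\<in>oriented_cycles (U - {head G e}). f \<in> D \<and> matching_value d (U - {head G e} - tail G ` D) \<noteq> 0"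
      if f: "f \<in> C" for f
    proof -
      obtain D where "D \<in> oriented_cycles (U - {tail G e})" "f \<in> D" "matching_value d (U - {tail G e} - tail G ` D) \<noteq> 0"
        using bspec[OF tK f] by (elim bexE conjE)
      then show ?thesis by (rule cycles_at_neighbour[OF U(1-3) e(1) refl refl tU e(3) _ _ _ C'])
    qed
    then show ?thesis unfolding K_def by (intro CollectI conjI ballI e(3))
  qed
  have no_edge: "edge_weight x y = 0" if "x \<in> K" "y \<in> U - K" for x y
    unfolding edge_weight_eq_0 using closed that by (auto simp: arcs_into_def)
  \<comment> \<open>After deletion of the tail of \<open>f\<close>, no cycle can contain
    \<open>f\<close>.\<close>
  have disj: "tail G f \<notin> K" if "f \<in> C" for f
  proof
    assume "tail G f \<in> K"
    then have "\<forall>f'\<in>C. \<exists>D\<in>oriented_cycles (U - {tail G f}). f' \<in> D \<and> matching_value d (U - {tail G f} - tail G ` D) \<noteq> 0"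
      unfolding K_def by (elim CollectE conjE)
    from bspec[OF this that] obtain D where D: "D \<in> oriented_cycles (U - {tail G f})" "f \<in> D"
      by (elim bexE conjE)
    show False using oriented_cycles_Diff[OF D(1)] D(2) by blast
  qed
  have "tail G ` C \<subseteq> U - {a}" using C(1) unfolding oriented_cycles_def by (elim CollectE conjE)
  then have tails: "tail G ` C \<subseteq> U - K" using disj by (simp add: image_subset_iff)
  have fin: "finite K" "finite (U - K)" using U(1) by (auto simp: K_def)
  have KU: "K \<subseteq> U" by (auto simp: K_def)
  have mult: "matching_value d (X \<union> Y) = matching_value d X * matching_value d Y" if "X \<subseteq> K" "Y \<subseteq> U - K" for X Y
  proof (rule matching_value_union)
    show "finite X" "finite Y" using that fin by (blast intro: finite_subset)+
    show "X \<inter> Y = {}" using that by blast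
    show "edge_weight x y = 0" if "x \<in> X" "y \<in> Y" for x y
      using that \<open>X \<subseteq> K\<close> \<open>Y \<subseteq> U - K\<close> by (intro no_edge) blast+
  qed
  have sets: "K \<union> (U - K) = U" "(K - {a}) \<union> (U - K - tail G ` C) = U - {a} - tail G ` C"
    "K \<union> (U - K - tail G ` C) = U - tail G ` C"
    using KU aK tails by auto
  have "matching_value d U = matching_value d K * matching_value d (U - K)"
    using mult[of K "U - K"] unfolding sets by simp
  moreover have "matching_value d (U - {a} - tail G ` C) = matching_value d (K - {a}) * matching_value d (U - K - tail G ` C)"
    using mult[of "K - {a}" "U - K - tail G ` C"] unfolding sets by simp
  moreover have "matching_value d (U - tail G ` C) = matching_value d K * matching_value d (U - K - tail G ` C)"
    using mult[of K "U - K - tail G ` C"] unfolding sets by simp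
  ultimately have "matching_value d (U - tail G ` C) \<noteq> 0" using U(3) C(3) by simp
  moreover have "C \<in> oriented_cycles U" using C(1) oriented_cycles_mono[of "U - {a}" U] by auto
  ultimately show False using U(2) C(2) by (auto simp: cycles_vanish_def)
qed

end

section \<open>Elimination of leaves\<close>

context fin_schroedinger begin

lemma exists_leaf:
  assumes "finite U" "cycles_vanish d U" "matching_value d U \<noteq> 0" "U \<noteq> {}"
  shows "\<exists>u\<in>U. card (arcs_into u U) \<le> 1"
  using exists_vanishing_start[OF assms] exists_leaf_of_start[OF assms(1-3)] by blast

lemma cycles_vanishI:
  assumes "\<And>C. C \<in> oriented_cycles T \<Longrightarrow> C \<noteq> {} \<Longrightarrow> matching_value d (T - tail G ` C) = 0"
  shows "cycles_vanish d T"
  using assms by (simp add: cycles_vanish_def)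

text \<open>Deleting vertices without changing the matching values of the remaining graph by more than a
  nonzero factor preserves the vanishing of all cycles.\<close>

lemma cycles_vanish_eliminate:
  assumes "cycles_vanish d U" "U' \<subseteq> U" "c \<noteq> 0"
    and "\<And>T. U - U' \<subseteq> T \<Longrightarrow> T \<subseteq> U \<Longrightarrow> matching_value d T = c * matching_value d' (T - (U - U'))"
  shows "cycles_vanish d' U'"
proof (rule cycles_vanishI)
  fix C assume C: "C \<in> oriented_cycles U'" "C \<noteq> {}"
  then have "C \<in> oriented_cycles U" using oriented_cycles_mono[OF assms(2)] by blast
  then have "matching_value d (U - tail G ` C) = 0" using assms(1) C(2) by (simp add: cycles_vanish_def)
  moreover have sub: "tail G ` C \<subseteq> U'" using C(1) unfolding oriented_cycles_def by (elim CollectE conjE)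
  then have "matching_value d (U - tail G ` C) = c * matching_value d' (U - tail G ` C - (U - U'))"
    by (intro assms(4)) blast+
  moreover have "U - tail G ` C - (U - U') = U' - tail G ` C" using assms(2) by blast
  ultimately show "matching_value d' (U' - tail G ` C) = 0" using assms(3) by simp
qed

lemma edge_weight_outside:
  assumes "arcs_into u U \<subseteq> E" "c \<in> U" "\<And>e. e \<in> E \<Longrightarrow> head G e \<noteq> c"
  shows "edge_weight u c = 0"
  unfolding edge_weight_eq_0 using assms by (auto simp: arcs_into_def)

lemma matching_value_isolated:
  assumes "finite U" "arcs_into u U = {}" "T \<subseteq> U" "u \<in> T"
  shows "matching_value d T = d u * matching_value d (T - {u})"
proof -
  have "edge_weight u c = 0" if "c \<in> T" for c
    using assms that by (intro edge_weight_outside[of u U "{}"]) auto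
  then show ?thesis
    using matching_value_recursion[of T u d] assms finite_subset[of T U] by simp
qed

lemma leaf_edge:
  assumes "arcs_into u U = {e}" "u \<in> U"
  shows "e \<in> arcs G" "tail G e = u" "head G e \<in> U" "head G e \<noteq> u" "edge_weight u (head G e) = (cmod (w e))\<^sup>2"
    "c \<in> U \<Longrightarrow> c \<noteq> head G e \<Longrightarrow> edge_weight u c = 0"
proof -
  have "e \<in> arcs_into u U" using assms(1) by simp
  then show e: "e \<in> arcs G" "tail G e = u" "head G e \<in> U" by (simp_all add: arcs_into_def)
  show "head G e \<noteq> u"
  proof
    assume "head G e = u"
    then have "arev e \<in> arcs_into u U" using e assms(2) by (simp add: arcs_into_def)
    then show False using assms(1) arev_neq[OF e(1)] by simp
  qed
  have "arcs_into u {head G e} \<subseteq> arcs_into u U" "e \<in> arcs_into u {head G e}"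
    using e by (auto simp: arcs_into_def)
  then have "arcs_into u {head G e} = {e}" unfolding assms(1) by blast
  then show "edge_weight u (head G e) = (cmod (w e))\<^sup>2" by (simp add: edge_weight_def)
  show "c \<in> U \<Longrightarrow> c \<noteq> head G e \<Longrightarrow> edge_weight u c = 0"
    by (rule edge_weight_outside[of u U "{e}"]) (simp_all add: assms(1))
qed

lemma matching_value_leaf:
  assumes "finite U" "arcs_into u U = {e}" "T \<subseteq> U" "u \<in> T"
  shows "matching_value d T = d u * matching_value d (T - {u}) -
    (if head G e \<in> T then (cmod (w e))\<^sup>2 * matching_value d (T - {u, head G e}) else 0)"
proof -
  have T: "finite T" "u \<in> U" using finite_subset[OF assms(3,1)] assms(3,4) by auto
  note L = leaf_edge[OF assms(2) T(2)]
  have "(\<Sum>c\<in>T - {u}. edge_weight u c * matching_value d (T - {u, c})) =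
      (\<Sum>c\<in>T - {u}. if c = head G e then (cmod (w e))\<^sup>2 * matching_value d (T - {u, head G e}) else 0)"
    using L(5,6) assms(3) by (intro sum.cong) auto
  also have "\<dots> = (if head G e \<in> T then (cmod (w e))\<^sup>2 * matching_value d (T - {u, head G e}) else 0)"
    using T(1) L(4) by simp
  finally show ?thesis using matching_value_recursion[OF T(1) assms(4), of d] by simp
qed

text \<open>The Schur complement of the pivot \<open>d u\<close>: since \<open>u\<close> has a
  single arc, only the diagonal entry at its neighbour changes, and it remains real.\<close>

definition leaf_update :: "('v \<Rightarrow> real) \<Rightarrow> 'v \<Rightarrow> 'e \<Rightarrow> 'v \<Rightarrow> real" where
  "leaf_update d u e = d(head G e := d (head G e) - (cmod (w e))\<^sup>2 / d u)"

text \<open>Expanding at \<open>u\<close> and at its neighbour, the changed potential enters only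
  when the neighbour is uncovered, and the correction there is exactly the term of matchings that
  use the edge at \<open>u\<close>.\<close>

lemma matching_value_leaf_update:
  assumes "finite U" "arcs_into u U = {e}" "T \<subseteq> U" "u \<in> T" "d u \<noteq> 0"
  shows "matching_value d T = d u * matching_value (leaf_update d u e) (T - {u})"
proof -
  let ?v = "head G e" and ?d' = "leaf_update d u e"
  have T: "finite T" "u \<in> U" using finite_subset[OF assms(3,1)] assms(3,4) by auto
  note L = leaf_edge[OF assms(2) T(2)]
  have same: "matching_value ?d' S = matching_value d S" if "?v \<notin> S" for S
    using that by (intro matching_value_cong) (auto simp: leaf_update_def)
  show ?thesis
  proof (cases "?v \<in> T")
    case False
    then show ?thesis using matching_value_leaf[OF assms(1-4), of d] same[of "T - {u}"] by simp
  next
    case True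
    have rec: "matching_value d0 (T - {u}) = d0 ?v * matching_value d0 (T - {u, ?v}) -
        (\<Sum>c\<in>T - {u} - {?v}. edge_weight ?v c * matching_value d0 (T - {u} - {?v, c}))" for d0
    proof -
      have "T - {u} - {?v} = T - {u, ?v}" by blast
      then show ?thesis using matching_value_recursion[of "T - {u}" ?v d0] T(1) True L(4) by simp
    qed
    have "matching_value ?d' (T - {u}) = ?d' ?v * matching_value d (T - {u, ?v}) -
        (\<Sum>c\<in>T - {u} - {?v}. edge_weight ?v c * matching_value d (T - {u} - {?v, c}))"
      using rec[of ?d'] by (simp add: same)
    also have "\<dots> = matching_value d (T - {u}) - (cmod (w e))\<^sup>2 / d u * matching_value d (T - {u, ?v})"
      using rec[of d] by (simp add: leaf_update_def left_diff_distrib)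
    finally have "d u * matching_value ?d' (T - {u}) =
        d u * matching_value d (T - {u}) - (cmod (w e))\<^sup>2 * matching_value d (T - {u, ?v})"
      using assms(5) by (simp add: right_diff_distrib)
    then show ?thesis using matching_value_leaf[OF assms(1-4), of d] True by simp
  qed
qed

text \<open>Induction along the pivots of a block \<open>LDL\<^sup>*\<close> decomposition.\<close>

lemma elimination_induct [consumes 3, case_names empty isolated leaf zero_leaf]:
  assumes "finite U" "cycles_vanish d U" "matching_value d U \<noteq> 0"
    and empty: "\<And>d. P d {}"
    and isolated: "\<And>d U u. finite U \<Longrightarrow> u \<in> U \<Longrightarrow> arcs_into u U = {} \<Longrightarrow> d u \<noteq> 0 \<Longrightarrow>
      P d (U - {u}) \<Longrightarrow> P d U"
    and leaf: "\<And>d U u e. finite U \<Longrightarrow> u \<in> U \<Longrightarrow> arcs_into u U = {e} \<Longrightarrow> d u \<noteq> 0 \<Longrightarrow>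
      P (leaf_update d u e) (U - {u}) \<Longrightarrow> P d U"
    and zero_leaf: "\<And>d U u e. finite U \<Longrightarrow> u \<in> U \<Longrightarrow> arcs_into u U = {e} \<Longrightarrow> d u = 0 \<Longrightarrow>
      P d (U - {u, head G e}) \<Longrightarrow> P d U"
  shows "P d U"
  using assms(1-3)
proof (induction "card U" arbitrary: d U rule: less_induct)
  case less
  show ?case
  proof (cases "U = {}")
    case True
    then show ?thesis using empty by simp
  next
    case False
    obtain u where u: "u \<in> U" "card (arcs_into u U) \<le> 1"
      using exists_leaf[OF less.prems False] by blast
    have card: "card U' < card U" if "U' \<subseteq> U - {u}" for U'
      using that u(1) less.prems(1) by (intro psubset_card_mono) auto
    consider "arcs_into u U = {}" | e where "arcs_into u U = {e}" "d u \<noteq> 0" | e where "arcs_into u U = {e}" "d u = 0"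
    proof -
      have "arcs_into u U = {} \<or> (\<exists>e. arcs_into u U = {e})"
        using u(2) card_1_singleton_iff[of "arcs_into u U"] by (cases "card (arcs_into u U) = 0") auto
      then show ?thesis using that by blast
    qed
    then show ?thesis
    proof cases
      case 1
      note iso = matching_value_isolated[OF less.prems(1) 1]
      have prod: "d u * matching_value d (U - {u}) \<noteq> 0" using iso[of U d] u(1) less.prems(3) by simp
      then have du: "d u \<noteq> 0" by simp
      have UU: "U - (U - {u}) = {u}" using u(1) by auto
      have "cycles_vanish d (U - {u})"
      proof (rule cycles_vanish_eliminate[OF less.prems(2) _ du])
        fix T assume "U - (U - {u}) \<subseteq> T" "T \<subseteq> U"
        then show "matching_value d T = d u * matching_value d (T - (U - (U - {u})))"
          using iso[of T d] unfolding UU by simp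
      qed blast
      moreover have "matching_value d (U - {u}) \<noteq> 0" using prod by simp
      ultimately have "P d (U - {u})" using less.prems(1) by (intro less.hyps card) simp_all
      then show ?thesis by (rule isolated[of U u d, OF less.prems(1) u(1) 1 du])
    next
      case (2 e)
      have upd: "matching_value d T = d u * matching_value (leaf_update d u e) (T - {u})"
        if "T \<subseteq> U" "u \<in> T" for T
        using matching_value_leaf_update[of U u e T d] less.prems(1) 2 that by simp
      have UU: "U - (U - {u}) = {u}" using u(1) by auto
      have "cycles_vanish (leaf_update d u e) (U - {u})"
      proof (rule cycles_vanish_eliminate[OF less.prems(2) _ 2(2)])
        fix T assume "U - (U - {u}) \<subseteq> T" "T \<subseteq> U"
        then show "matching_value d T = d u * matching_value (leaf_update d u e) (T - (U - (U - {u})))"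
          using upd[of T] unfolding UU by simp
      qed blast
      moreover have "matching_value (leaf_update d u e) (U - {u}) \<noteq> 0"
        using upd[OF subset_refl u(1)] less.prems(3) by simp
      ultimately have "P (leaf_update d u e) (U - {u})" using less.prems(1) by (intro less.hyps card) simp_all
      then show ?thesis by (rule leaf[of U u e d, OF less.prems(1) u(1) 2])
    next
      case (3 e)
      note L = leaf_edge[OF 3(1) u(1)]
      \<comment> \<open>With \<open>d u = 0\<close> every contributing matching covers
        \<open>u\<close>, hence uses the edge of \<open>e\<close>; this pair of vertices acts as one
        pivot of value - |w e|^2.\<close>
      have val: "matching_value d T = - (cmod (w e))\<^sup>2 * matching_value d (T - {u, head G e})"
        if "{u, head G e} \<subseteq> T" "T \<subseteq> U" for T
        using matching_value_leaf[OF less.prems(1) 3(1) that(2), of d] that(1) 3(2) by simp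
      have UU: "U - (U - {u, head G e}) = {u, head G e}" using u(1) L(3) by auto
      have nz: "- (cmod (w e))\<^sup>2 \<noteq> 0" using weight_nonzero[OF L(1)] by simp
      have "cycles_vanish d (U - {u, head G e})"
      proof (rule cycles_vanish_eliminate[OF less.prems(2) _ nz])
        fix T assume "U - (U - {u, head G e}) \<subseteq> T" "T \<subseteq> U"
        then show "matching_value d T = - (cmod (w e))\<^sup>2 * matching_value d (T - (U - (U - {u, head G e})))"
          using val[of T] unfolding UU by simp
      qed blast
      moreover have "matching_value d (U - {u, head G e}) \<noteq> 0"
      proof -
        have "{u, head G e} \<subseteq> U" using u(1) L(3) by blast
        then show ?thesis using val[OF _ subset_refl] less.prems(3) by simp
      qed
      moreover have "card (U - {u, head G e}) < card U" by (rule card) blast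
      ultimately have "P d (U - {u, head G e})" using less.prems(1) by (intro less.hyps) simp_all
      then show ?thesis by (rule zero_leaf[of U u e d, OF less.prems(1) u(1) 3])
    qed
  qed
qed

end

section \<open>Spectral gaps of bounded symmetric operators on square-summable functions\<close>

section \<open>Symmetric operators on square-summable functions\<close>

lemma ell2_vanishes: "f \<in> ell2 X \<Longrightarrow> p \<notin> X \<Longrightarrow> f p = 0"
  by (simp add: ell2_def)

lemma ell2_summable: "f \<in> ell2 X \<Longrightarrow> (\<lambda>p. (cmod (f p))\<^sup>2) summable_on X"
  by (simp add: ell2_def)

lemma ell2_norm_nonneg [simp]: "ell2_norm X f \<ge> 0"
  by (simp add: ell2_norm_def infsum_nonneg)

lemma ell2_norm_squared: "(ell2_norm X f)\<^sup>2 = (\<Sum>\<^sub>\<infinity>p\<in>X. (cmod (f p))\<^sup>2)"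
  by (simp add: ell2_norm_def infsum_nonneg)

lemma L2_set_le_ell2_norm:
  assumes "f \<in> ell2 X" "finite F" "F \<subseteq> X"
  shows "L2_set (\<lambda>p. cmod (f p)) F \<le> ell2_norm X f"
  unfolding L2_set_def ell2_norm_def
  using assms by (intro real_sqrt_le_mono finite_sum_le_infsum) (auto simp: ell2_def)

text \<open>Bounds over finite subsets give membership and the norm estimate at once, so
  inequalities for \<open>L2_set\<close> carry over directly.\<close>

lemma ell2I:
  assumes "\<And>p. p \<notin> X \<Longrightarrow> f p = 0" "\<And>F. finite F \<Longrightarrow> F \<subseteq> X \<Longrightarrow> L2_set (\<lambda>p. cmod (f p)) F \<le> C"
  shows "f \<in> ell2 X" "ell2_norm X f \<le> C"
proof -
  have C: "0 \<le> C" using assms(2)[of "{}"] by simp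
  have le: "(\<Sum>p\<in>F. (cmod (f p))\<^sup>2) \<le> C\<^sup>2" if "finite F" "F \<subseteq> X" for F
    using assms(2)[OF that] C by (simp add: L2_set_def real_sqrt_le_iff' real_le_lsqrt sqrt_le_D)
  have sum: "(\<lambda>p. (cmod (f p))\<^sup>2) summable_on X"
    by (rule nonneg_bdd_above_summable_on) (use le in \<open>auto intro!: bdd_aboveI[of _ "C\<^sup>2"]\<close>)
  then show "f \<in> ell2 X" using assms(1) by (simp add: ell2_def)
  have "(\<Sum>\<^sub>\<infinity>p\<in>X. (cmod (f p))\<^sup>2) \<le> C\<^sup>2" using sum le by (rule infsum_le_finite_sums)
  then show "ell2_norm X f \<le> C" using C unfolding ell2_norm_def by (rule real_le_lsqrt[rotated])
qed

lemma ell2_add: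
  assumes "f \<in> ell2 X" "g \<in> ell2 X"
  shows "(\<lambda>p. f p + g p) \<in> ell2 X" "ell2_norm X (\<lambda>p. f p + g p) \<le> ell2_norm X f + ell2_norm X g"
proof -
  have le: "L2_set (\<lambda>p. cmod (f p + g p)) F \<le> ell2_norm X f + ell2_norm X g" if "finite F" "F \<subseteq> X" for F
  proof -
    have "L2_set (\<lambda>p. cmod (f p + g p)) F \<le> L2_set (\<lambda>p. cmod (f p) + cmod (g p)) F"
      by (intro L2_set_mono norm_triangle_ineq) auto
    also have "\<dots> \<le> L2_set (\<lambda>p. cmod (f p)) F + L2_set (\<lambda>p. cmod (g p)) F" by (rule L2_set_triangle_ineq)
    also have "\<dots> \<le> ell2_norm X f + ell2_norm X g"
      using assms that by (intro add_mono L2_set_le_ell2_norm)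
    finally show ?thesis .
  qed
  have zero: "f p + g p = 0" if "p \<notin> X" for p using assms that by (simp add: ell2_vanishes)
  show "(\<lambda>p. f p + g p) \<in> ell2 X" by (rule ell2I(1)[OF zero le])
  show "ell2_norm X (\<lambda>p. f p + g p) \<le> ell2_norm X f + ell2_norm X g" by (rule ell2I(2)[OF zero le])
qed

lemma ell2_scale:
  assumes "f \<in> ell2 X"
  shows "(\<lambda>p. c * f p) \<in> ell2 X"
  using assms by (auto simp: ell2_def norm_mult power_mult_distrib intro: summable_on_cmult_right)

lemma ell2_norm_scale: "ell2_norm X (\<lambda>p. c * f p) = cmod c * ell2_norm X f"
  by (simp add: ell2_norm_def norm_mult power_mult_distrib infsum_cmult_right' real_sqrt_mult)

lemma ell2_diff:
  assumes "f \<in> ell2 X" "g \<in> ell2 X"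
  shows "(\<lambda>p. f p - g p) \<in> ell2 X" "ell2_norm X (\<lambda>p. f p - g p) \<le> ell2_norm X f + ell2_norm X g"
  using ell2_add[OF assms(1) ell2_scale[OF assms(2), of "-1"]] ell2_norm_scale[of X "-1" g] by simp_all

lemma ell2_zero [simp]: "(\<lambda>p. 0) \<in> ell2 X"
  by (simp add: ell2_def)

lemma norm_le_ell2_norm:
  assumes "f \<in> ell2 X"
  shows "cmod (f p) \<le> ell2_norm X f"
proof (cases "p \<in> X")
  case True
  then show ?thesis using L2_set_le_ell2_norm[OF assms, of "{p}"] by simp
qed (use assms in \<open>simp add: ell2_vanishes\<close>)

lemma ell2_sum:
  assumes "finite I" "\<And>i. i \<in> I \<Longrightarrow> f i \<in> ell2 X"
  shows "(\<lambda>p. \<Sum>i\<in>I. f i p) \<in> ell2 X" "ell2_norm X (\<lambda>p. \<Sum>i\<in>I. f i p) \<le> (\<Sum>i\<in>I. ell2_norm X (f i))"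
proof -
  have "(\<lambda>p. \<Sum>i\<in>I. f i p) \<in> ell2 X \<and> ell2_norm X (\<lambda>p. \<Sum>i\<in>I. f i p) \<le> (\<Sum>i\<in>I. ell2_norm X (f i))"
    using assms
  proof (induction I rule: finite_induct)
    case (insert i I)
    have IH: "(\<lambda>p. \<Sum>i\<in>I. f i p) \<in> ell2 X" "ell2_norm X (\<lambda>p. \<Sum>i\<in>I. f i p) \<le> (\<Sum>i\<in>I. ell2_norm X (f i))"
      using insert.IH insert.prems by simp_all
    show ?case
      using ell2_add[OF insert.prems[OF insertI1] IH(1)] IH(2) insert.hyps by simp
  qed (simp add: ell2_norm_def)
  then show "(\<lambda>p. \<Sum>i\<in>I. f i p) \<in> ell2 X" "ell2_norm X (\<lambda>p. \<Sum>i\<in>I. f i p) \<le> (\<Sum>i\<in>I. ell2_norm X (f i))"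
    by simp_all
qed

text \<open>The real part of the Hermitian inner product. Since the operators are complex linear,
  symmetry for the real part already yields self-adjointness.\<close>

definition ell2_inner :: "'a set \<Rightarrow> ('a \<Rightarrow> complex) \<Rightarrow> ('a \<Rightarrow> complex) \<Rightarrow> real" where
  "ell2_inner X f g = (\<Sum>\<^sub>\<infinity>p\<in>X. f p \<bullet> g p)"

lemma ell2_inner_summable:
  assumes "f \<in> ell2 X" "g \<in> ell2 X"
  shows "(\<lambda>p. f p \<bullet> g p) summable_on X"
proof -
  have "(\<lambda>p. (cmod (f p))\<^sup>2 + (cmod (g p))\<^sup>2) summable_on X"
    using assms by (intro summable_on_add ell2_summable)
  then have "(\<lambda>p. norm (f p \<bullet> g p)) summable_on X"
  proof (rule summable_on_comparison_test)
    fix p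
    have "norm (f p \<bullet> g p) \<le> cmod (f p) * cmod (g p)" using Cauchy_Schwarz_ineq2[of "f p" "g p"] by simp
    also have "\<dots> \<le> (cmod (f p))\<^sup>2 + (cmod (g p))\<^sup>2"
    proof -
      have "0 \<le> cmod (f p) * cmod (g p)" by simp
      then show ?thesis using sum_squares_bound[of "cmod (f p)" "cmod (g p)"] by linarith
    qed
    finally show "norm (f p \<bullet> g p) \<le> (cmod (f p))\<^sup>2 + (cmod (g p))\<^sup>2" .
  qed simp
  then show ?thesis by (rule abs_summable_summable)
qed

lemma ell2_inner_commute: "ell2_inner X f g = ell2_inner X g f"
  by (simp add: ell2_inner_def inner_commute)

lemma ell2_inner_self: "ell2_inner X f f = (ell2_norm X f)\<^sup>2"
  by (simp add: ell2_inner_def ell2_norm_squared power2_norm_eq_inner)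

lemma ell2_inner_add_right:
  assumes "f \<in> ell2 X" "g \<in> ell2 X" "h \<in> ell2 X"
  shows "ell2_inner X f (\<lambda>p. g p + h p) = ell2_inner X f g + ell2_inner X f h"
  unfolding ell2_inner_def inner_add_right
  using assms by (intro infsum_add ell2_inner_summable)

lemma ell2_inner_scale_right: "ell2_inner X f (\<lambda>p. complex_of_real c * g p) = c * ell2_inner X f g"
proof -
  have "f p \<bullet> (complex_of_real c * g p) = c * (f p \<bullet> g p)" for p
    by (simp add: inner_complex_def algebra_simps)
  then show ?thesis by (simp add: ell2_inner_def infsum_cmult_right')
qed

lemma ell2_inner_imaginary:
  "ell2_inner X (\<lambda>p. \<i> * f p) (\<lambda>p. \<i> * g p) = ell2_inner X f g"
  by (simp add: ell2_inner_def inner_complex_def add.commute)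

lemma ell2_inner_diff_right:
  assumes "f \<in> ell2 X" "g \<in> ell2 X" "h \<in> ell2 X"
  shows "ell2_inner X f (\<lambda>p. g p - h p) = ell2_inner X f g - ell2_inner X f h"
  using ell2_inner_add_right[OF assms(1,2) ell2_scale[OF assms(3), of "-1"]]
    ell2_inner_scale_right[of X f "-1" h] by simp

lemma ell2_Cauchy_Schwarz:
  assumes "f \<in> ell2 X" "g \<in> ell2 X"
  shows "\<bar>ell2_inner X f g\<bar> \<le> ell2_norm X f * ell2_norm X g"
proof -
  have le: "ell2_inner X f g \<le> ell2_norm X f * ell2_norm X g" if "f \<in> ell2 X" for f
    unfolding ell2_inner_def
  proof (rule infsum_le_finite_sums)
    show "(\<lambda>p. f p \<bullet> g p) summable_on X" using that assms(2) by (rule ell2_inner_summable)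
    fix F assume F: "finite F" "F \<subseteq> X"
    have "(\<Sum>p\<in>F. f p \<bullet> g p) \<le> (\<Sum>p\<in>F. \<bar>cmod (f p)\<bar> * \<bar>cmod (g p)\<bar>)"
      by (intro sum_mono) (simp add: norm_cauchy_schwarz)
    also have "\<dots> \<le> L2_set (\<lambda>p. cmod (f p)) F * L2_set (\<lambda>p. cmod (g p)) F" by (rule L2_set_mult_ineq)
    also have "\<dots> \<le> ell2_norm X f * ell2_norm X g"
      using that assms(2) F by (intro mult_mono L2_set_le_ell2_norm) auto
    finally show "(\<Sum>p\<in>F. f p \<bullet> g p) \<le> ell2_norm X f * ell2_norm X g" .
  qed
  have "- ell2_inner X f g = ell2_inner X (\<lambda>p. complex_of_real (-1) * f p) g"
    using ell2_inner_scale_right[of X g "-1" f] by (simp add: ell2_inner_commute)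
  also have "\<dots> \<le> ell2_norm X f * ell2_norm X g"
    using le[OF ell2_scale[OF assms(1), of "complex_of_real (-1)"]] by (simp only: ell2_norm_scale) simp
  finally show ?thesis using le[OF assms(1)] by simp
qed

locale ell2_symmetric =
  fixes X :: "'a set" and T :: "('a \<Rightarrow> complex) \<Rightarrow> 'a \<Rightarrow> complex" and B :: real
  assumes in_ell2: "f \<in> ell2 X \<Longrightarrow> T f \<in> ell2 X"
    and add: "f \<in> ell2 X \<Longrightarrow> g \<in> ell2 X \<Longrightarrow> T (\<lambda>p. f p + g p) = (\<lambda>p. T f p + T g p)"
    and scale: "f \<in> ell2 X \<Longrightarrow> T (\<lambda>p. c * f p) = (\<lambda>p. c * T f p)"
    and bound: "f \<in> ell2 X \<Longrightarrow> ell2_norm X (T f) \<le> B * ell2_norm X f"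
    and symmetric: "f \<in> ell2 X \<Longrightarrow> g \<in> ell2 X \<Longrightarrow> ell2_inner X (T f) g = ell2_inner X f (T g)"
begin

lemma diff: "f \<in> ell2 X \<Longrightarrow> g \<in> ell2 X \<Longrightarrow> T (\<lambda>p. f p - g p) = (\<lambda>p. T f p - T g p)"
  using add[of f "\<lambda>p. - 1 * g p"] ell2_scale[of g X "-1"] scale[of g "-1"] by simp

lemma numerical_range_bound:
  assumes "f \<in> ell2 X"
  shows "\<bar>ell2_inner X f (T f)\<bar> \<le> \<bar>B\<bar> * (ell2_norm X f)\<^sup>2"
proof -
  have "\<bar>ell2_inner X f (T f)\<bar> \<le> ell2_norm X f * ell2_norm X (T f)"
    using assms in_ell2 by (intro ell2_Cauchy_Schwarz)
  also have "\<dots> \<le> ell2_norm X f * (\<bar>B\<bar> * ell2_norm X f)"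
    using bound[OF assms] by (intro mult_left_mono order_trans[OF _ mult_right_mono[OF abs_ge_self]]) auto
  finally show ?thesis by (simp add: power2_eq_square mult_ac)
qed

lemma shift: "ell2_symmetric X (\<lambda>f p. T f p - complex_of_real m * f p) (\<bar>B\<bar> + \<bar>m\<bar>)"
proof
  fix f assume f: "f \<in> ell2 X"
  note Tf = in_ell2[OF f] and mf = ell2_scale[OF f, of "complex_of_real m"]
  show "(\<lambda>p. T f p - complex_of_real m * f p) \<in> ell2 X" using Tf mf by (rule ell2_diff)
  show "(\<lambda>p. T (\<lambda>p. c * f p) p - complex_of_real m * (c * f p)) = (\<lambda>p. c * (T f p - complex_of_real m * f p))" for c
    using scale[OF f, of c] by (simp add: algebra_simps)
  have "ell2_norm X (\<lambda>p. T f p - complex_of_real m * f p) \<le> ell2_norm X (T f) + \<bar>m\<bar> * ell2_norm X f"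
    using ell2_diff(2)[OF Tf mf] by (simp add: ell2_norm_scale)
  also have "\<dots> \<le> \<bar>B\<bar> * ell2_norm X f + \<bar>m\<bar> * ell2_norm X f"
    using bound[OF f] mult_right_mono[OF abs_ge_self ell2_norm_nonneg, of B X f] by simp
  finally show "ell2_norm X (\<lambda>p. T f p - complex_of_real m * f p) \<le> (\<bar>B\<bar> + \<bar>m\<bar>) * ell2_norm X f"
    by (simp add: algebra_simps)
  fix g assume g: "g \<in> ell2 X"
  show "(\<lambda>p. T (\<lambda>p. f p + g p) p - complex_of_real m * (f p + g p)) =
      (\<lambda>p. (T f p - complex_of_real m * f p) + (T g p - complex_of_real m * g p))"
    using add[OF f g] by (simp add: algebra_simps)
  show "ell2_inner X (\<lambda>p. T f p - complex_of_real m * f p) g = ell2_inner X f (\<lambda>p. T g p - complex_of_real m * g p)"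
    using f g Tf mf symmetric[OF f g] in_ell2[OF g] ell2_scale[OF g, of "complex_of_real m"]
    by (simp add: ell2_inner_diff_right ell2_inner_scale_right
        ell2_inner_commute[of X "\<lambda>p. T f p - complex_of_real m * f p"]) (simp add: ell2_inner_commute)
qed

text \<open>The form is nonnegative at f - T f / B. Expanding this gives 2/B times the squared norm
  of T f on the smaller side, and the term with T (T f) is at most 1/B times the same squared
  norm.\<close>

lemma positive_bound:
  assumes B: "B > 0" and pos: "\<And>f. f \<in> ell2 X \<Longrightarrow> 0 \<le> ell2_inner X f (T f)" and f: "f \<in> ell2 X"
  shows "(ell2_norm X (T f))\<^sup>2 \<le> B * ell2_inner X f (T f)"
proof -
  let ?c = "complex_of_real (1 / B)"
  let ?g = "\<lambda>p. f p - ?c * T f p"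
  note Tf = in_ell2[OF f]
  note TTf = in_ell2[OF Tf]
  note cTf = ell2_scale[OF Tf, of ?c]
  note cTTf = ell2_scale[OF TTf, of ?c]
  have Tg: "T ?g = (\<lambda>p. T f p - ?c * T (T f) p)"
    using diff[OF f cTf] scale[OF Tf, of ?c] by simp
  have g: "?g \<in> ell2 X" using f cTf by (rule ell2_diff)
  have "0 \<le> ell2_inner X ?g (T ?g)" by (rule pos[OF g])
  also have "\<dots> = ell2_inner X ?g (T f) - 1 / B * ell2_inner X ?g (T (T f))"
    unfolding Tg ell2_inner_diff_right[OF g Tf cTTf] ell2_inner_scale_right ..
  also have "ell2_inner X ?g (T f) = ell2_inner X f (T f) - 1 / B * (ell2_norm X (T f))\<^sup>2"
    unfolding ell2_inner_commute[of X ?g] ell2_inner_diff_right[OF Tf f cTf] ell2_inner_scale_right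
    by (simp add: ell2_inner_commute ell2_inner_self)
  also have "ell2_inner X ?g (T (T f)) = (ell2_norm X (T f))\<^sup>2 - 1 / B * ell2_inner X (T f) (T (T f))"
    unfolding ell2_inner_commute[of X ?g] ell2_inner_diff_right[OF TTf f cTf] ell2_inner_scale_right
    using symmetric[OF f Tf] by (simp add: ell2_inner_commute ell2_inner_self)
  finally have 1: "2 / B * (ell2_norm X (T f))\<^sup>2 \<le>
      ell2_inner X f (T f) + 1 / B * (1 / B * ell2_inner X (T f) (T (T f)))"
    by (simp add: algebra_simps)
  have "ell2_inner X (T f) (T (T f)) \<le> B * (ell2_norm X (T f))\<^sup>2"
    using numerical_range_bound[OF Tf] B by simp
  then have "1 / B * (1 / B * ell2_inner X (T f) (T (T f))) \<le> 1 / B * (1 / B * (B * (ell2_norm X (T f))\<^sup>2))"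
    using B by (intro mult_left_mono) auto
  with 1 have "1 / B * (ell2_norm X (T f))\<^sup>2 \<le> ell2_inner X f (T f)" using B by simp
  then show ?thesis using B by (simp add: field_simps)
qed

end

text \<open>The infimum of the numerical range is an approximate eigenvalue.\<close>

lemma (in ell2_symmetric) approximate_eigenvalue_below:
  assumes f0: "f0 \<in> ell2 X" "ell2_inner X f0 (T f0) < \<theta> * (ell2_norm X f0)\<^sup>2"
  shows "\<exists>m<\<theta>. \<not> (\<exists>C. \<forall>f\<in>ell2 X. ell2_norm X f \<le> C * ell2_norm X (\<lambda>p. T f p - complex_of_real m * f p))"
proof -
  \<comment> \<open>The lower bounds of the normalised numerical range; its supremum
    \<open>m\<close> is the infimum of that range and again a lower bound.\<close>
  define L where "L = {m. \<forall>f\<in>ell2 X. m * (ell2_norm X f)\<^sup>2 \<le> ell2_inner X f (T f)}"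
  define m where "m = Sup L"
  have "- \<bar>B\<bar> \<in> L" using numerical_range_bound by (force simp: L_def)
  then have ne: "L \<noteq> {}" by blast
  have N0: "(ell2_norm X f0)\<^sup>2 > 0"
  proof (rule ccontr)
    assume "\<not> 0 < (ell2_norm X f0)\<^sup>2"
    then have "(ell2_norm X f0)\<^sup>2 = 0" by simp
    then show False using f0(2) numerical_range_bound[OF f0(1)] by simp
  qed
  let ?q = "ell2_inner X f0 (T f0) / (ell2_norm X f0)\<^sup>2"
  have le: "x \<le> ?q" if "x \<in> L" for x
    using that f0(1) N0 by (simp add: L_def pos_le_divide_eq)
  then have bdd: "bdd_above L" by (rule bdd_aboveI)
  have "m \<le> ?q" unfolding m_def using ne le by (rule cSup_least)
  also have "?q < \<theta>" using f0(2) N0 by (simp add: pos_divide_less_eq)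
  finally have "m < \<theta>" .
  have mL: "m * (ell2_norm X f)\<^sup>2 \<le> ell2_inner X f (T f)" if f: "f \<in> ell2 X" for f
  proof (cases "(ell2_norm X f)\<^sup>2 = 0")
    case True
    then show ?thesis using numerical_range_bound[OF f] by simp
  next
    case False
    then have N: "(ell2_norm X f)\<^sup>2 > 0" by simp
    have "x \<le> ell2_inner X f (T f) / (ell2_norm X f)\<^sup>2" if "x \<in> L" for x
      using that f N by (simp add: L_def pos_le_divide_eq)
    then have "m \<le> ell2_inner X f (T f) / (ell2_norm X f)\<^sup>2" unfolding m_def by (rule cSup_least[OF ne])
    then show ?thesis using N by (simp add: pos_le_divide_eq)
  qed
  define A where "A = (\<lambda>f p. T f p - complex_of_real m * f p)"
  \<comment> \<open>The summand 1 makes the bound strictly positive, as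
    \<open>positive_bound\<close> requires.\<close>
  define b where "b = \<bar>B\<bar> + \<bar>m\<bar> + 1"
  interpret A: ell2_symmetric X A "\<bar>B\<bar> + \<bar>m\<bar>" unfolding A_def by (rule shift)
  have innerA: "ell2_inner X f (A f) = ell2_inner X f (T f) - m * (ell2_norm X f)\<^sup>2" if f: "f \<in> ell2 X" for f
    unfolding A_def ell2_inner_diff_right[OF f in_ell2[OF f] ell2_scale[OF f]] ell2_inner_scale_right ell2_inner_self ..
  interpret A': ell2_symmetric X A b
  proof
    fix f assume "f \<in> ell2 X"
    then have "ell2_norm X (A f) \<le> (\<bar>B\<bar> + \<bar>m\<bar>) * ell2_norm X f" by (rule A.bound)
    also have "\<dots> \<le> b * ell2_norm X f" unfolding b_def by (intro mult_right_mono) auto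
    finally show "ell2_norm X (A f) \<le> b * ell2_norm X f" .
  qed (fact A.in_ell2 A.add A.scale A.symmetric)+
  have b: "b > 0" by (simp add: b_def)
  have "\<not> (\<forall>f\<in>ell2 X. ell2_norm X f \<le> C * ell2_norm X (A f))" for C
  proof
    assume C: "\<forall>f\<in>ell2 X. ell2_norm X f \<le> C * ell2_norm X (A f)"
    \<comment> \<open>If the shifted operator were bounded below with constant \<open>C\<close>,
      then \<open>positive_bound\<close> would raise the lower bound \<open>m\<close> by
      \<open>1 / K\<close>. The summand 1 keeps \<open>K\<close> positive when \<open>C\<close> is
      zero.\<close>
    define K where "K = (C\<^sup>2 + 1) * b"
    have K: "K > 0" using b by (simp add: K_def add_pos_pos zero_less_mult_iff add_nonneg_pos)
    have "(m + 1 / K) * (ell2_norm X f)\<^sup>2 \<le> ell2_inner X f (T f)" if f: "f \<in> ell2 X" for f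
    proof -
      have "(ell2_norm X f)\<^sup>2 \<le> (C * ell2_norm X (A f))\<^sup>2" using C f by (intro power_mono) auto
      also have "\<dots> \<le> (C\<^sup>2 + 1) * (ell2_norm X (A f))\<^sup>2" by (simp add: power_mult_distrib distrib_right)
      also have "\<dots> \<le> (C\<^sup>2 + 1) * (b * ell2_inner X f (A f))"
        using A'.positive_bound[OF b _ f] innerA mL by (intro mult_left_mono) auto
      finally have "(ell2_norm X f)\<^sup>2 \<le> K * ell2_inner X f (A f)" by (simp add: K_def mult_ac)
      then have "1 / K * (ell2_norm X f)\<^sup>2 \<le> ell2_inner X f (A f)" using K by (simp add: field_simps)
      then show ?thesis using innerA[OF f] by (simp add: distrib_right)
    qed
    then have "m + 1 / K \<in> L" by (simp add: L_def)
    then have "m + 1 / K \<le> m" unfolding m_def using bdd by (rule cSup_upper)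
    then show False using K by simp
  qed
  then show ?thesis using \<open>m < \<theta>\<close> unfolding A_def by blast
qed

lemma in_spectrum_if_not_bounded_below:
  assumes "\<not> (\<exists>C. \<forall>f\<in>ell2 X. ell2_norm X f \<le> C * ell2_norm X (\<lambda>p. T f p - z * f p))"
    and T: "\<And>f. f \<in> ell2 X \<Longrightarrow> T f \<in> ell2 X"
  shows "z \<in> ell2_spectrum X T"
proof (rule ccontr)
  assume "z \<notin> ell2_spectrum X T"
  then obtain R where R: "ell2_bounded_operator X R" "\<And>f. f \<in> ell2 X \<Longrightarrow> R (\<lambda>p. T f p - z * f p) = f"
    by (auto simp: ell2_spectrum_def)
  obtain C where C: "\<forall>f\<in>ell2 X. ell2_norm X (R f) \<le> C * ell2_norm X f"
    using R(1) unfolding ell2_bounded_operator_def by (elim conjE exE)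
  have "ell2_norm X f \<le> C * ell2_norm X (\<lambda>p. T f p - z * f p)" if f: "f \<in> ell2 X" for f
  proof -
    have "(\<lambda>p. T f p - z * f p) \<in> ell2 X" using T[OF f] ell2_scale[OF f] by (rule ell2_diff)
    from bspec[OF C this] show ?thesis unfolding R(2)[OF f] .
  qed
  with assms(1) show False by blast
qed

lemma ell2_norm_eq_0:
  assumes "f \<in> ell2 X" "ell2_norm X f = 0"
  shows "f = (\<lambda>p. 0)"
  using norm_le_ell2_norm[OF assms(1)] assms(2) by (auto simp: fun_eq_iff)

lemma (in ell2_symmetric) not_in_spectrum:
  assumes c: "c > 0" "\<And>f. f \<in> ell2 X \<Longrightarrow> c * ell2_norm X f \<le> ell2_norm X (\<lambda>p. T f p - z * f p)"
    and surj: "\<And>h. h \<in> ell2 X \<Longrightarrow> \<exists>f\<in>ell2 X. (\<lambda>p. T f p - z * f p) = h"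
  shows "z \<notin> ell2_spectrum X T"
proof -
  let ?A = "\<lambda>f p. T f p - z * f p"
  have A_in: "?A f \<in> ell2 X" if "f \<in> ell2 X" for f
    using in_ell2[OF that] ell2_scale[OF that] by (rule ell2_diff)
  have inj: "f = g" if "f \<in> ell2 X" "g \<in> ell2 X" "?A f = ?A g" for f g
  proof -
    have fg: "(\<lambda>p. f p - g p) \<in> ell2 X" using that(1,2) by (rule ell2_diff)
    have "?A (\<lambda>p. f p - g p) p = ?A f p - ?A g p" for p
      using diff[OF that(1,2)] by (simp add: algebra_simps)
    then have "?A (\<lambda>p. f p - g p) = (\<lambda>p. 0)" using fun_cong[OF that(3)] by simp
    then have "ell2_norm X (?A (\<lambda>p. f p - g p)) = 0" by (simp add: ell2_norm_def)
    then have "c * ell2_norm X (\<lambda>p. f p - g p) \<le> 0" using c(2)[OF fg] by simp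
    then have "ell2_norm X (\<lambda>p. f p - g p) = 0"
      using c(1) ell2_norm_nonneg[of X "\<lambda>p. f p - g p"] by (simp add: mult_le_0_iff)
    from ell2_norm_eq_0[OF fg this] have "\<And>p. f p - g p = 0" by (rule fun_cong)
    then show "f = g" by (simp add: fun_eq_iff)
  qed
  define R where "R = (\<lambda>h. SOME f. f \<in> ell2 X \<and> ?A f = h)"
  have R: "R h \<in> ell2 X" "?A (R h) = h" if "h \<in> ell2 X" for h
  proof -
    have "\<exists>f. f \<in> ell2 X \<and> ?A f = h" using surj[OF that] by blast
    then have "R h \<in> ell2 X \<and> ?A (R h) = h" unfolding R_def by (rule someI_ex)
    then show "R h \<in> ell2 X" "?A (R h) = h" by simp_all
  qed
  have RA: "R (?A f) = f" if "f \<in> ell2 X" for f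
    by (rule inj[OF R(1)[OF A_in[OF that]] that R(2)[OF A_in[OF that]]])
  have "ell2_bounded_operator X R"
    unfolding ell2_bounded_operator_def
  proof (intro conjI ballI allI)
    fix f assume f: "f \<in> ell2 X"
    show "R f \<in> ell2 X" by (rule R(1)[OF f])
    show "R (\<lambda>p. a * f p) = (\<lambda>p. a * R f p)" for a
    proof (rule inj)
      have "?A (\<lambda>p. a * R f p) p = a * ?A (R f) p" for p
        unfolding scale[OF R(1)[OF f]] by (simp add: right_diff_distrib mult.left_commute)
      then have "?A (\<lambda>p. a * R f p) = (\<lambda>p. a * f p)" unfolding fun_cong[OF R(2)[OF f]] by (rule ext)
      then show "?A (R (\<lambda>p. a * f p)) = ?A (\<lambda>p. a * R f p)"
        unfolding R(2)[OF ell2_scale[OF f, of a]] by (rule sym)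
    qed (use R(1) f in \<open>simp_all add: ell2_scale\<close>)
    fix h assume h: "h \<in> ell2 X"
    show "R (\<lambda>p. f p + h p) = (\<lambda>p. R f p + R h p)"
    proof (rule inj)
      have "?A (\<lambda>p. R f p + R h p) p = ?A (R f) p + ?A (R h) p" for p
        unfolding add[OF R(1)[OF f] R(1)[OF h]] by (simp add: algebra_simps)
      then have "?A (\<lambda>p. R f p + R h p) = (\<lambda>p. f p + h p)"
        unfolding fun_cong[OF R(2)[OF f]] fun_cong[OF R(2)[OF h]] by (rule ext)
      then show "?A (R (\<lambda>p. f p + h p)) = ?A (\<lambda>p. R f p + R h p)"
        unfolding R(2)[OF ell2_add(1)[OF f h]] by (rule sym)
    qed (use R(1) f h in \<open>simp_all add: ell2_add\<close>)
  next
    show "\<exists>C. \<forall>f\<in>ell2 X. ell2_norm X (R f) \<le> C * ell2_norm X f"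
    proof (intro exI[of _ "1 / c"] ballI)
      fix f assume f: "f \<in> ell2 X"
      show "ell2_norm X (R f) \<le> 1 / c * ell2_norm X f"
        using c(2)[OF R(1)[OF f]] c(1) unfolding R(2)[OF f] by (simp add: field_simps)
    qed
  qed
  moreover have "\<forall>f\<in>ell2 X. R (?A f) = f \<and> ?A (R f) = f" using R(2) RA by simp
  ultimately show ?thesis unfolding ell2_spectrum_def by (intro notI) (elim CollectE, blast)
qed

context ell2_symmetric begin

text \<open>The shifted operator is symmetric and commutes with multiplication by \<i>, so its value
  at \<open>f\<close> is orthogonal to \<i> f for the real inner product, and the cross terms
  vanish.\<close>

lemma norm_shift_imaginary:
  assumes f: "f \<in> ell2 X"
  shows "(ell2_norm X (\<lambda>p. T f p - Complex \<theta> t * f p))\<^sup>2 =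
    (ell2_norm X (\<lambda>p. T f p - complex_of_real \<theta> * f p))\<^sup>2 + t\<^sup>2 * (ell2_norm X f)\<^sup>2"
proof -
  define A where "A = (\<lambda>f p. T f p - complex_of_real \<theta> * f p)"
  interpret A: ell2_symmetric X A "\<bar>B\<bar> + \<bar>\<theta>\<bar>" unfolding A_def by (rule shift)
  let ?i = "\<lambda>p. \<i> * f p"
  let ?ti = "\<lambda>p. complex_of_real t * ?i p"
  have i: "?i \<in> ell2 X" using f by (rule ell2_scale)
  have ti: "?ti \<in> ell2 X" using i by (rule ell2_scale)
  note Af = A.in_ell2[OF f]
  have "ell2_inner X (A f) ?i = ell2_inner X f (\<lambda>p. \<i> * A f p)"
    unfolding A.symmetric[OF f i] A.scale[OF f] ..
  also have "\<dots> = ell2_inner X ?i (\<lambda>p. \<i> * (\<i> * A f p))" by (rule ell2_inner_imaginary[symmetric])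
  also have "(\<lambda>p. \<i> * (\<i> * A f p)) = (\<lambda>p. complex_of_real (-1) * A f p)" by (simp add: mult.assoc[symmetric])
  also have "ell2_inner X ?i \<dots> = - ell2_inner X (A f) ?i"
    unfolding ell2_inner_scale_right by (simp add: ell2_inner_commute)
  finally have "ell2_inner X (A f) ?i = 0" by simp
  then have 0: "ell2_inner X (A f) ?ti = 0" by (simp only: ell2_inner_scale_right mult_zero_right)
  have "(\<lambda>p. T f p - Complex \<theta> t * f p) = (\<lambda>p. A f p - ?ti p)"
    by (simp add: A_def Complex_eq algebra_simps)
  then have "(ell2_norm X (\<lambda>p. T f p - Complex \<theta> t * f p))\<^sup>2 =
      ell2_inner X (\<lambda>p. A f p - ?ti p) (\<lambda>p. A f p - ?ti p)"
    by (simp only: ell2_inner_self)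
  also have "\<dots> = ell2_inner X (\<lambda>p. A f p - ?ti p) (A f) - ell2_inner X (\<lambda>p. A f p - ?ti p) ?ti"
    by (rule ell2_inner_diff_right[OF ell2_diff(1)[OF Af ti] Af ti])
  also have "ell2_inner X (\<lambda>p. A f p - ?ti p) (A f) = (ell2_norm X (A f))\<^sup>2"
    unfolding ell2_inner_commute[of X "\<lambda>p. A f p - ?ti p"] ell2_inner_diff_right[OF Af Af ti] 0 ell2_inner_self by simp
  also have "ell2_inner X (\<lambda>p. A f p - ?ti p) ?ti = - (ell2_norm X ?ti)\<^sup>2"
    unfolding ell2_inner_commute[of X "\<lambda>p. A f p - ?ti p"] ell2_inner_diff_right[OF ti Af ti]
      ell2_inner_commute[of X ?ti "A f"] 0 ell2_inner_self by simp
  also have "(ell2_norm X ?ti)\<^sup>2 = t\<^sup>2 * (ell2_norm X f)\<^sup>2"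
    unfolding ell2_norm_scale by (simp add: power_mult_distrib)
  finally show ?thesis by (simp add: A_def)
qed

definition solvable_at :: "complex \<Rightarrow> bool" where
  "solvable_at z \<longleftrightarrow> (\<forall>h\<in>ell2 X. \<exists>f\<in>ell2 X. (\<lambda>p. T f p - z * f p) = h)"

end

lemma ell2_limit:
  assumes "\<And>n. F n \<in> ell2 X" "\<And>n. ell2_norm X (F n) \<le> M" "\<And>p. (\<lambda>n. F n p) \<longlonglongrightarrow> f p"
  shows "f \<in> ell2 X"
proof (rule ell2I(1))
  fix p assume "p \<notin> X"
  then have "F n p = 0" for n using ell2_vanishes[OF assms(1)] by simp
  then have "(\<lambda>n. 0) \<longlonglongrightarrow> f p" using assms(3)[of p] by simp
  then show "f p = 0" by (simp only: LIMSEQ_const_iff)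
next
  fix S assume S: "finite S" "S \<subseteq> X"
  have "(\<lambda>n. cmod (F n p)) \<longlonglongrightarrow> cmod (f p)" for p
    by (rule tendsto_norm) (rule assms(3))
  then have lim: "(\<lambda>n. L2_set (\<lambda>p. cmod (F n p)) S) \<longlonglongrightarrow> L2_set (\<lambda>p. cmod (f p)) S"
    unfolding L2_set_def by (intro tendsto_real_sqrt tendsto_sum tendsto_power)
  show "L2_set (\<lambda>p. cmod (f p)) S \<le> M"
    by (rule LIMSEQ_le_const2[OF lim]) (use L2_set_le_ell2_norm[OF assms(1) S] assms(2) order_trans in metis)
qed

text \<open>Pointwise continuity, which holds when each value of \<open>T f\<close> depends on
  finitely many values of \<open>f\<close>, takes the place of completeness: limits are formed at
  each point and inserted into the equation there.\<close>

locale ell2_symmetric_local = ell2_symmetric +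
  assumes pointwise_continuous: "(\<And>p. (\<lambda>n. F n p) \<longlonglongrightarrow> f p) \<Longrightarrow> (\<lambda>n. T (F n) p) \<longlonglongrightarrow> T f p"
begin

text \<open>A Neumann series, which is summed pointwise.\<close>

lemma solvable_at_near:
  assumes c: "c > 0" "\<And>f. f \<in> ell2 X \<Longrightarrow> c * ell2_norm X f \<le> ell2_norm X (\<lambda>p. T f p - z * f p)"
    and z: "solvable_at z" "cmod (z' - z) \<le> c / 2"
  shows "solvable_at z'"
  unfolding solvable_at_def
proof
  fix h assume h: "h \<in> ell2 X"
  let ?A = "\<lambda>f p. T f p - z * f p" and ?\<delta> = "z' - z"
  define S where "S = (\<lambda>h. SOME f. f \<in> ell2 X \<and> ?A f = h)"
  have S: "S h \<in> ell2 X \<and> ?A (S h) = h" if "h \<in> ell2 X" for h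
  proof -
    have "\<exists>f. f \<in> ell2 X \<and> ?A f = h" using bspec[OF z(1)[unfolded solvable_at_def] that] by (elim bexE) (intro exI conjI)
    then show ?thesis unfolding S_def by (rule someI_ex)
  qed
  \<comment> \<open>The iteration solves (T - z) F(n+1) = h + (z' - z) F(n), whose fixed point
    solves the equation at \<open>z'\<close>. Successive differences shrink by the factor 1/2, since
    |z' - z| is at most half the lower bound \<open>c\<close>.\<close>
  define F where "F = rec_nat (S h) (\<lambda>_ f. S (\<lambda>p. h p + ?\<delta> * f p))"
  have F0: "F 0 = S h" and FSuc: "F (Suc n) = S (\<lambda>p. h p + ?\<delta> * F n p)" for n
    by (simp_all add: F_def)
  have F: "F n \<in> ell2 X" for n
  proof (induction n)
    case 0
    show ?case unfolding F0 using S[OF h] by (rule conjunct1)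
  next
    case (Suc n)
    show ?case unfolding FSuc by (rule conjunct1[OF S[OF ell2_add(1)[OF h ell2_scale[OF Suc]]]])
  qed
  have AF0: "?A (F 0) = h" unfolding F0 by (rule conjunct2[OF S[OF h]])
  have AF: "?A (F (Suc n)) = (\<lambda>p. h p + ?\<delta> * F n p)" for n
    unfolding FSuc by (rule conjunct2[OF S[OF ell2_add(1)[OF h ell2_scale[OF F]]]])
  define D where "D = (\<lambda>n p. F (Suc n) p - F n p)"
  have D: "D n \<in> ell2 X" for n unfolding D_def using F by (intro ell2_diff)
  have AD: "?A (D n) p = ?A (F (Suc n)) p - ?A (F n) p" for n p
    unfolding D_def diff[OF F F] by (simp add: right_diff_distrib)
  have step: "ell2_norm X (D (Suc n)) \<le> ell2_norm X (D n) / 2" for n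
  proof -
    have "?A (D (Suc n)) p = ?\<delta> * D n p" for p
      unfolding AD fun_cong[OF AF] by (simp add: D_def algebra_simps)
    then have "?A (D (Suc n)) = (\<lambda>p. ?\<delta> * D n p)" by (rule ext)
    then have "c * ell2_norm X (D (Suc n)) \<le> cmod ?\<delta> * ell2_norm X (D n)"
      using c(2)[OF D, of "Suc n"] by (simp only: ell2_norm_scale)
    also have "\<dots> \<le> c / 2 * ell2_norm X (D n)" using z(2) by (intro mult_right_mono) auto
    finally have "c * ell2_norm X (D (Suc n)) \<le> c * (ell2_norm X (D n) / 2)" by simp
    then show ?thesis using c(1) by (simp only: mult_le_cancel_left_pos)
  qed
  define K where "K = ell2_norm X (D 0)"
  have DK: "ell2_norm X (D n) \<le> K * (1 / 2) ^ n" for n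
  proof (induction n)
    case (Suc n)
    then show ?case using step[of n] by simp
  qed (simp add: K_def)
  have geo: "summable (\<lambda>n. K * (1 / 2) ^ n)" by (intro summable_mult summable_geometric) simp
  have summ: "summable (\<lambda>n. D n p)" for p
    by (rule summable_comparison_test'[OF geo, of 0]) (rule order_trans[OF norm_le_ell2_norm[OF D] DK])
  have F_eq: "F n p = F 0 p + (\<Sum>i<n. D i p)" for n p
    by (induction n) (simp_all add: D_def)
  define f where "f = (\<lambda>p. F 0 p + (\<Sum>i. D i p))"
  have lim: "(\<lambda>n. F n p) \<longlonglongrightarrow> f p" for p
  proof -
    have "(\<lambda>n. F 0 p + (\<Sum>i<n. D i p)) \<longlonglongrightarrow> f p"
      unfolding f_def by (intro tendsto_intros summable_LIMSEQ summ)
    then show ?thesis unfolding F_eq[symmetric] .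
  qed
  have bound: "ell2_norm X (F n) \<le> ell2_norm X (F 0) + 2 * K" for n
  proof -
    have eq: "F n = (\<lambda>p. F 0 p + (\<Sum>i<n. D i p))" by (rule ext) (rule F_eq)
    have "ell2_norm X (F n) \<le> ell2_norm X (F 0) + ell2_norm X (\<lambda>p. \<Sum>i<n. D i p)"
      unfolding eq by (rule ell2_add(2)[OF F ell2_sum(1)]) (simp_all add: D)
    also have "ell2_norm X (\<lambda>p. \<Sum>i<n. D i p) \<le> (\<Sum>i<n. ell2_norm X (D i))" by (rule ell2_sum(2)) (simp_all add: D)
    also have "\<dots> \<le> (\<Sum>i<n. K * (1 / 2) ^ i)" by (intro sum_mono DK)
    also have "\<dots> \<le> (\<Sum>i. K * (1 / 2) ^ i)" using geo by (rule sum_le_suminf) (auto simp: K_def)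
    also have "\<dots> = 2 * K" by (simp add: suminf_mult suminf_geometric summable_geometric)
    finally show ?thesis by simp
  qed
  have f: "f \<in> ell2 X" using F bound lim by (rule ell2_limit)
  have "T f p - z' * f p = h p" for p
  proof -
    have "(\<lambda>n. T (F (Suc n)) p - z * F (Suc n) p) \<longlonglongrightarrow> T f p - z * f p"
      by (intro tendsto_intros LIMSEQ_Suc[OF lim] LIMSEQ_Suc[OF pointwise_continuous[OF lim]])
    moreover have "(\<lambda>n. h p + ?\<delta> * F n p) \<longlonglongrightarrow> h p + ?\<delta> * f p" by (intro tendsto_intros lim)
    ultimately have "T f p - z * f p = h p + ?\<delta> * f p"
      unfolding fun_cong[OF AF] by (rule LIMSEQ_unique)
    then show ?thesis by (simp add: algebra_simps)
  qed
  then have "(\<lambda>p. T f p - z' * f p) = h" by (rule ext)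
  then show "\<exists>f\<in>ell2 X. (\<lambda>p. T f p - z' * f p) = h" using f by (rule bexI)
qed

lemma bounded_below_imaginary:
  assumes c: "c > 0" "c * ell2_norm X f \<le> ell2_norm X (\<lambda>p. T f p - complex_of_real \<theta> * f p)"
    and f: "f \<in> ell2 X"
  shows "c * ell2_norm X f \<le> ell2_norm X (\<lambda>p. T f p - Complex \<theta> t * f p)"
proof -
  have "ell2_norm X (\<lambda>p. T f p - complex_of_real \<theta> * f p) \<le> ell2_norm X (\<lambda>p. T f p - Complex \<theta> t * f p)"
    by (rule power2_le_imp_le) (simp_all add: norm_shift_imaginary[OF f])
  with c(2) show ?thesis by simp
qed

text \<open>The lower bound \<open>c\<close> persists on the whole line by
  \<open>norm_shift_imaginary\<close>, so solvability can be carried along it in steps of length at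
  most c/2 without shrinking the step.\<close>

lemma vertical_line_not_in_spectrum:
  assumes c: "c > 0" "\<And>f. f \<in> ell2 X \<Longrightarrow> c * ell2_norm X f \<le> ell2_norm X (\<lambda>p. T f p - complex_of_real \<theta> * f p)"
    and surj: "solvable_at (complex_of_real \<theta>)"
  shows "Complex \<theta> t \<notin> ell2_spectrum X T"
proof -
  have below: "c * ell2_norm X f \<le> ell2_norm X (\<lambda>p. T f p - Complex \<theta> t * f p)" if "f \<in> ell2 X" for f t
    by (rule bounded_below_imaginary[OF c(1) c(2)[OF that] that])
  have solv: "solvable_at (Complex \<theta> t)" if "\<bar>t\<bar> \<le> real n * (c / 2)" for n t
    using that
  proof (induction n arbitrary: t)
    case 0
    then show ?case using surj by (simp add: complex_of_real_def)
  next
    case (Suc n)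
    \<comment> \<open>The point \<open>s\<close> divides the segment from 0 to \<open>t\<close> so
      that one of \<open>Suc n\<close> equal steps remains, and each step has length at most
      c/2.\<close>
    define s where "s = t * (real n / real (Suc n))"
    have "\<bar>s\<bar> = \<bar>t\<bar> * (real n / real (Suc n))" by (simp add: s_def abs_mult)
    also have "\<dots> \<le> real (Suc n) * (c / 2) * (real n / real (Suc n))"
      using Suc.prems by (intro mult_right_mono) auto
    also have "\<dots> = real n * (c / 2)" by (simp del: of_nat_Suc)
    finally have "solvable_at (Complex \<theta> s)" by (rule Suc.IH)
    moreover have "cmod (Complex \<theta> t - Complex \<theta> s) \<le> c / 2"
    proof -
      have "t - s = t / real (Suc n)" by (simp add: s_def field_simps)
      then have "cmod (Complex \<theta> t - Complex \<theta> s) = \<bar>t\<bar> / real (Suc n)" by (simp add: cmod_def)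
      also have "\<dots> \<le> c / 2" using Suc.prems by (simp add: pos_divide_le_eq mult.commute)
      finally show ?thesis .
    qed
    ultimately show ?case by - (rule solvable_at_near[OF c(1) below])
  qed
  have "\<exists>n. \<bar>t\<bar> < real n * (c / 2)" using reals_Archimedean3[of "c / 2"] c(1) by simp
  then obtain n where "\<bar>t\<bar> < real n * (c / 2)" ..
  then have "\<bar>t\<bar> \<le> real n * (c / 2)" by simp
  then have "\<forall>h\<in>ell2 X. \<exists>f\<in>ell2 X. (\<lambda>p. T f p - Complex \<theta> t * f p) = h"
    using solv unfolding solvable_at_def by blast
  with c(1) below show ?thesis by (intro not_in_spectrum[where c = c]) simp_all
qed

end

lemma (in ell2_symmetric) negate: "ell2_symmetric X (\<lambda>f p. - T f p) B"
proof
  fix f g assume f: "f \<in> ell2 X" and g: "g \<in> ell2 X"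
  have neg: "ell2_inner X h (\<lambda>p. - k p) = - ell2_inner X h k" for h k
    using ell2_inner_scale_right[of X h "-1" k] by simp
  show "ell2_inner X (\<lambda>p. - T f p) g = ell2_inner X f (\<lambda>p. - T g p)"
    using neg[of g "T f"] neg[of f "T g"] symmetric[OF f g] by (simp add: ell2_inner_commute)
qed (use in_ell2 ell2_scale[of _ X "-1"] add scale bound ell2_norm_scale[of X "-1"] in auto)

text \<open>The point below \<theta> is the infimum of the numerical range of \<open>T\<close>, the
  point above comes from the same argument for \<open>- T\<close>. The spectrum misses the line Re z
  = \<theta>, so two open half-planes disconnect it in the complex plane.\<close>

theorem (in ell2_symmetric_local) spectral_gap:
  assumes c: "c > 0" "\<And>f. f \<in> ell2 X \<Longrightarrow> c * ell2_norm X f \<le> ell2_norm X (\<lambda>p. T f p - complex_of_real \<theta> * f p)"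
    and surj: "solvable_at (complex_of_real \<theta>)"
    and below: "f \<in> ell2 X" "ell2_inner X f (\<lambda>p. T f p - complex_of_real \<theta> * f p) < 0"
    and above: "g \<in> ell2 X" "ell2_inner X g (\<lambda>p. T g p - complex_of_real \<theta> * g p) > 0"
  shows "complex_of_real \<theta> \<notin> ell2_spectrum X T"
    and "\<exists>\<theta>\<^sub>1 \<theta>\<^sub>2. complex_of_real \<theta>\<^sub>1 \<in> ell2_spectrum X T \<and> complex_of_real \<theta>\<^sub>2 \<in> ell2_spectrum X T \<and>
      \<theta>\<^sub>1 < \<theta> \<and> \<theta> < \<theta>\<^sub>2"
    and "\<not> topological_space_class.connected (ell2_spectrum X T)"
proof -
  note line = vertical_line_not_in_spectrum[OF c surj]
  show "complex_of_real \<theta> \<notin> ell2_spectrum X T" using line[of 0] by (simp add: complex_of_real_def)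
  have inner: "ell2_inner X f (\<lambda>p. T f p - complex_of_real \<theta> * f p) = ell2_inner X f (T f) - \<theta> * (ell2_norm X f)\<^sup>2"
    if "f \<in> ell2 X" for f
    unfolding ell2_inner_diff_right[OF that in_ell2[OF that] ell2_scale[OF that]] ell2_inner_scale_right ell2_inner_self ..
  have "ell2_inner X f (T f) < \<theta> * (ell2_norm X f)\<^sup>2" using below inner[OF below(1)] by simp
  from approximate_eigenvalue_below[OF below(1) this] obtain \<theta>1 where
    1: "\<theta>1 < \<theta>" "\<not> (\<exists>C. \<forall>f\<in>ell2 X. ell2_norm X f \<le> C * ell2_norm X (\<lambda>p. T f p - complex_of_real \<theta>1 * f p))"
    by blast
  have s1: "complex_of_real \<theta>1 \<in> ell2_spectrum X T" using 1(2) in_ell2 by (rule in_spectrum_if_not_bounded_below)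
  interpret N: ell2_symmetric X "\<lambda>f p. - T f p" B by (rule negate)
  have neg: "ell2_inner X h (\<lambda>p. - k p) = - ell2_inner X h k" for h k
    using ell2_inner_scale_right[of X h "-1" k] by simp
  have "ell2_inner X g (\<lambda>p. - T g p) < (- \<theta>) * (ell2_norm X g)\<^sup>2"
    using above inner[OF above(1)] by (simp add: neg)
  from N.approximate_eigenvalue_below[OF above(1) this] obtain m where
    m: "m < - \<theta>" "\<not> (\<exists>C. \<forall>f\<in>ell2 X. ell2_norm X f \<le> C * ell2_norm X (\<lambda>p. - T f p - complex_of_real m * f p))"
    by blast
  have "ell2_norm X (\<lambda>p. - T f p - complex_of_real m * f p) = ell2_norm X (\<lambda>p. T f p - complex_of_real (- m) * f p)" for f
    using ell2_norm_scale[of X "-1" "\<lambda>p. T f p - complex_of_real (- m) * f p"] by (simp add: algebra_simps)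
  with m(2) have s2: "complex_of_real (- m) \<in> ell2_spectrum X T"
    by (intro in_spectrum_if_not_bounded_below in_ell2) simp_all
  show "\<exists>\<theta>\<^sub>1 \<theta>\<^sub>2. complex_of_real \<theta>\<^sub>1 \<in> ell2_spectrum X T \<and> complex_of_real \<theta>\<^sub>2 \<in> ell2_spectrum X T \<and>
      \<theta>\<^sub>1 < \<theta> \<and> \<theta> < \<theta>\<^sub>2"
    using s1 s2 1(1) m(1) by (intro exI[of _ \<theta>1] exI[of _ "- m"] conjI) simp_all
  show "\<not> topological_space_class.connected (ell2_spectrum X T)"
  proof
    assume conn: "topological_space_class.connected (ell2_spectrum X T)"
    let ?L = "{z. Re z < \<theta>}" and ?R = "{z. Re z > \<theta>}"
    have "z \<in> ?L \<union> ?R" if "z \<in> ell2_spectrum X T" for z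
    proof (rule ccontr)
      assume "z \<notin> ?L \<union> ?R"
      then have "z = Complex \<theta> (Im z)" by (simp add: complex_eq_iff)
      then show False using line[of "Im z"] that by simp
    qed
    then have "ell2_spectrum X T \<subseteq> ?L \<union> ?R" by blast
    moreover have "?L \<inter> ?R \<inter> ell2_spectrum X T = {}" by auto
    moreover have "open ?L" "open ?R" by (rule open_halfspace_Re_lt open_halfspace_Re_gt)+
    moreover have "complex_of_real \<theta>1 \<in> ?L \<inter> ell2_spectrum X T" "complex_of_real (- m) \<in> ?R \<inter> ell2_spectrum X T"
      using s1 s2 1(1) m(1) by simp_all
    then have "?L \<inter> ell2_spectrum X T \<noteq> {}" "?R \<inter> ell2_spectrum X T \<noteq> {}" by blast+
    ultimately show False using connectedD[OF conn, of ?L ?R] by simp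
  qed
qed

section \<open>Inverting the operator on the cover by elimination\<close>

section \<open>Operators on covers\<close>

lemma ell2_norm_zero [simp]: "ell2_norm X (\<lambda>p. 0) = 0"
  by (simp add: ell2_norm_def)

lemma ell2_inner_zero [simp]: "ell2_inner X (\<lambda>p. 0) f = 0" "ell2_inner X f (\<lambda>p. 0) = 0"
  by (simp_all add: ell2_inner_def)

lemma ell2_inner_cnj: "ell2_inner X (\<lambda>p. c * f p) h = ell2_inner X f (\<lambda>p. cnj c * h p)"
  unfolding ell2_inner_def by (intro infsum_cong) (simp add: inner_complex_def algebra_simps)

locale schroedinger_cover = fin_schroedinger G arev w + \<Gamma>: group \<Gamma>
  for G :: "('v, 'e) pre_digraph" and arev and w and \<Gamma> :: "('g, 'm) monoid_scheme" +
  fixes g :: "'e \<Rightarrow> 'g"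
  assumes voltage: "voltage_assignment G arev \<Gamma> g"
begin

abbreviation H :: "('g \<Rightarrow> complex) set" where "H \<equiv> ell2 (carrier \<Gamma>)"
abbreviation norm\<^sub>H :: "('g \<Rightarrow> complex) \<Rightarrow> real" where "norm\<^sub>H \<equiv> ell2_norm (carrier \<Gamma>)"
abbreviation inner\<^sub>H :: "('g \<Rightarrow> complex) \<Rightarrow> ('g \<Rightarrow> complex) \<Rightarrow> real" where "inner\<^sub>H \<equiv> ell2_inner (carrier \<Gamma>)"

text \<open>The voltage of \<open>e\<close> as an operator on one fibre: an isometry inverse to that
  of \<open>arev e\<close>. Such operators of different arcs need not commute.\<close>

definition translate :: "'e \<Rightarrow> ('g \<Rightarrow> complex) \<Rightarrow> 'g \<Rightarrow> complex" where
  "translate e f = (\<lambda>x. if x \<in> carrier \<Gamma> then f (x \<otimes>\<^bsub>\<Gamma>\<^esub> g e) else 0)"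

lemma voltage_carrier: "e \<in> arcs G \<Longrightarrow> g e \<in> carrier \<Gamma>"
  and voltage_arev: "e \<in> arcs G \<Longrightarrow> g (arev e) = inv\<^bsub>\<Gamma>\<^esub> (g e)"
  using voltage by (auto simp: voltage_assignment_def)

lemma bij_translate: "e \<in> arcs G \<Longrightarrow> bij_betw (\<lambda>x. x \<otimes>\<^bsub>\<Gamma>\<^esub> g e) (carrier \<Gamma>) (carrier \<Gamma>)"
  by (rule bij_betw_byWitness[where f' = "\<lambda>x. x \<otimes>\<^bsub>\<Gamma>\<^esub> inv\<^bsub>\<Gamma>\<^esub> (g e)"])
    (auto simp: voltage_carrier \<Gamma>.m_assoc)

lemma translate_arev:
  assumes "e \<in> arcs G" "f \<in> H"
  shows "translate e (translate (arev e) f) = f" "translate (arev e) (translate e f) = f"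
  using assms voltage_carrier[OF assms(1)] voltage_arev[OF assms(1)]
  by (auto simp: translate_def fun_eq_iff ell2_vanishes \<Gamma>.m_assoc)

lemma translate_in:
  assumes "e \<in> arcs G" "f \<in> H"
  shows "translate e f \<in> H"
proof -
  have "(\<lambda>x. (cmod (f (x \<otimes>\<^bsub>\<Gamma>\<^esub> g e)))\<^sup>2) summable_on carrier \<Gamma>"
    using summable_on_reindex_bij_betw[OF bij_translate[OF assms(1)], of "\<lambda>x. (cmod (f x))\<^sup>2"] ell2_summable[OF assms(2)]
    by simp
  then have "(\<lambda>x. (cmod (translate e f x))\<^sup>2) summable_on carrier \<Gamma>"
    by (rule summable_on_cong[THEN iffD1, rotated]) (simp add: translate_def)
  then show ?thesis by (simp add: ell2_def translate_def)
qed

lemma norm_translate: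
  assumes "e \<in> arcs G"
  shows "norm\<^sub>H (translate e f) = norm\<^sub>H f"
proof -
  have "(\<Sum>\<^sub>\<infinity>x\<in>carrier \<Gamma>. (cmod (translate e f x))\<^sup>2) = (\<Sum>\<^sub>\<infinity>x\<in>carrier \<Gamma>. (cmod (f (x \<otimes>\<^bsub>\<Gamma>\<^esub> g e)))\<^sup>2)"
    by (intro infsum_cong) (simp add: translate_def)
  also have "\<dots> = (\<Sum>\<^sub>\<infinity>x\<in>carrier \<Gamma>. (cmod (f x))\<^sup>2)"
    by (rule infsum_reindex_bij_betw[OF bij_translate[OF assms]])
  finally show ?thesis by (simp add: ell2_norm_def)
qed

lemma inner_translate:
  assumes e: "e \<in> arcs G"
  shows "inner\<^sub>H (translate e f) h = inner\<^sub>H f (translate (arev e) h)"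
proof -
  have "inner\<^sub>H f (translate (arev e) h) =
      (\<Sum>\<^sub>\<infinity>x\<in>carrier \<Gamma>. f (x \<otimes>\<^bsub>\<Gamma>\<^esub> g e) \<bullet> translate (arev e) h (x \<otimes>\<^bsub>\<Gamma>\<^esub> g e))"
    unfolding ell2_inner_def by (rule infsum_reindex_bij_betw[OF bij_translate[OF e], symmetric])
  also have "\<dots> = inner\<^sub>H (translate e f) h"
    unfolding ell2_inner_def using voltage_carrier[OF e] voltage_arev[OF e]
    by (intro infsum_cong) (simp add: translate_def \<Gamma>.m_assoc)
  finally show ?thesis by simp
qed

lemma translate_scale: "translate e (\<lambda>x. c * f x) = (\<lambda>x. c * translate e f x)"
  by (auto simp: translate_def)

lemma translate_add: "translate e (\<lambda>x. f x + h x) = (\<lambda>x. translate e f x + translate e h x)"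
  by (auto simp: translate_def)

lemma translate_diff: "translate e (\<lambda>x. f x - h x) = (\<lambda>x. translate e f x - translate e h x)"
  by (auto simp: translate_def)

lemma translate_zero [simp]: "translate e (\<lambda>x. 0) = (\<lambda>x. 0)"
  by (auto simp: translate_def)

definition fields :: "'v set \<Rightarrow> ('v \<Rightarrow> 'g \<Rightarrow> complex) set" where
  "fields U = {F. \<forall>v\<in>U. F v \<in> H}"

lemma fieldsD: "F \<in> fields U \<Longrightarrow> v \<in> U \<Longrightarrow> F v \<in> H"
  by (simp add: fields_def)

lemma fields_mono: "F \<in> fields U \<Longrightarrow> U' \<subseteq> U \<Longrightarrow> F \<in> fields U'"
  by (auto simp: fields_def)

text \<open>For \<open>d = \<lambda>v. \<theta> - V v\<close> this is \<theta> minus the lifted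
  operator, restricted to \<open>U\<close>. A function on the cover is regarded as a vector of
  fibres, so elimination acts on a finite system with operator entries.\<close>

definition cover_op :: "('v \<Rightarrow> real) \<Rightarrow> 'v set \<Rightarrow> ('v \<Rightarrow> 'g \<Rightarrow> complex) \<Rightarrow> 'v \<Rightarrow> 'g \<Rightarrow> complex" where
  "cover_op d U F v = (\<lambda>x. complex_of_real (d v) * F v x - (\<Sum>e\<in>arcs_into v U. w e * translate e (F (head G e)) x))"

lemma cover_op_cong:
  assumes "\<And>u. u \<in> insert v U \<Longrightarrow> F u = F' u"
  shows "cover_op d U F v = cover_op d U F' v"
proof -
  have "F (head G e) = F' (head G e)" if "e \<in> arcs_into v U" for e
    using assms that by (simp add: arcs_into_def)
  then show ?thesis using assms[of v] unfolding cover_op_def by (intro ext arg_cong2[where f = "(-)"] sum.cong) simp_all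
qed

lemma sum_translate_in:
  assumes "F \<in> fields U" "E \<subseteq> arcs_into v U"
  shows "(\<lambda>x. \<Sum>e\<in>E. w e * translate e (F (head G e)) x) \<in> H"
    "norm\<^sub>H (\<lambda>x. \<Sum>e\<in>E. w e * translate e (F (head G e)) x) \<le> (\<Sum>e\<in>E. cmod (w e) * norm\<^sub>H (F (head G e)))"
proof -
  have fin: "finite E" using assms(2) by (rule finite_subset) simp
  have E: "e \<in> arcs G" "F (head G e) \<in> H" if "e \<in> E" for e
    using that assms by (auto simp: arcs_into_def fields_def)
  have in_H: "(\<lambda>x. w e * translate e (F (head G e)) x) \<in> H" if "e \<in> E" for e
    using E[OF that] by (intro ell2_scale translate_in)
  show "(\<lambda>x. \<Sum>e\<in>E. w e * translate e (F (head G e)) x) \<in> H" by (rule ell2_sum(1)[OF fin in_H])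
  have "norm\<^sub>H (\<lambda>x. \<Sum>e\<in>E. w e * translate e (F (head G e)) x) \<le> (\<Sum>e\<in>E. norm\<^sub>H (\<lambda>x. w e * translate e (F (head G e)) x))"
    by (rule ell2_sum(2)[OF fin in_H])
  also have "\<dots> = (\<Sum>e\<in>E. cmod (w e) * norm\<^sub>H (F (head G e)))"
    using E by (intro sum.cong) (simp_all add: ell2_norm_scale norm_translate)
  finally show "norm\<^sub>H (\<lambda>x. \<Sum>e\<in>E. w e * translate e (F (head G e)) x) \<le> (\<Sum>e\<in>E. cmod (w e) * norm\<^sub>H (F (head G e)))" .
qed

lemma cover_op_in:
  assumes "F \<in> fields U" "v \<in> U"
  shows "cover_op d U F v \<in> H"
  unfolding cover_op_def
  by (rule ell2_diff(1)[OF ell2_scale[OF fieldsD[OF assms]] sum_translate_in(1)[OF assms(1) subset_refl]])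

text \<open>Quantities that are bounded by a multiple of the norm of the image under the operator.\<close>

definition controlled :: "('v \<Rightarrow> real) \<Rightarrow> 'v set \<Rightarrow> (('v \<Rightarrow> 'g \<Rightarrow> complex) \<Rightarrow> real) \<Rightarrow> bool" where
  "controlled d U Q \<longleftrightarrow> (\<exists>C. \<forall>F\<in>fields U. Q F \<le> C * (\<Sum>v\<in>U. norm\<^sub>H (cover_op d U F v)))"

lemma controlled_mono:
  assumes "controlled d U Q'" "\<And>F. F \<in> fields U \<Longrightarrow> Q F \<le> Q' F"
  shows "controlled d U Q"
  using assms unfolding controlled_def by (meson order_trans)

lemma controlled_add:
  assumes "controlled d U Q" "controlled d U Q'"
  shows "controlled d U (\<lambda>F. Q F + Q' F)"
proof -
  from assms obtain C C' where
    C: "\<forall>F\<in>fields U. Q F \<le> C * (\<Sum>v\<in>U. norm\<^sub>H (cover_op d U F v))" and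
    C': "\<forall>F\<in>fields U. Q' F \<le> C' * (\<Sum>v\<in>U. norm\<^sub>H (cover_op d U F v))"
    unfolding controlled_def by blast
  have "\<forall>F\<in>fields U. Q F + Q' F \<le> (C + C') * (\<Sum>v\<in>U. norm\<^sub>H (cover_op d U F v))"
    unfolding distrib_right by (intro ballI add_mono bspec[OF C] bspec[OF C'])
  then show ?thesis unfolding controlled_def by (rule exI)
qed

lemma controlled_scale:
  assumes "controlled d U Q" "c \<ge> 0"
  shows "controlled d U (\<lambda>F. c * Q F)"
proof -
  from assms(1) obtain C where C: "\<forall>F\<in>fields U. Q F \<le> C * (\<Sum>v\<in>U. norm\<^sub>H (cover_op d U F v))"
    unfolding controlled_def by blast
  have "\<forall>F\<in>fields U. c * Q F \<le> (c * C) * (\<Sum>v\<in>U. norm\<^sub>H (cover_op d U F v))"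
    unfolding mult.assoc by (intro ballI mult_left_mono bspec[OF C] assms(2))
  then show ?thesis unfolding controlled_def by (rule exI)
qed

lemma controlled_zero: "controlled d U (\<lambda>F. 0)"
  unfolding controlled_def by (intro exI[of _ 0]) simp

lemma controlled_sum:
  assumes "finite I" "\<And>i. i \<in> I \<Longrightarrow> controlled d U (Q i)"
  shows "controlled d U (\<lambda>F. \<Sum>i\<in>I. Q i F)"
  using assms by (induction I rule: finite_induct) (simp_all add: controlled_add controlled_zero)

lemma controlled_op:
  assumes "finite U" "v \<in> U"
  shows "controlled d U (\<lambda>F. norm\<^sub>H (cover_op d U F v))"
proof -
  have "norm\<^sub>H (cover_op d U F v) \<le> 1 * (\<Sum>v\<in>U. norm\<^sub>H (cover_op d U F v))" for F
    using member_le_sum[OF assms(2) _ assms(1), of "\<lambda>v. norm\<^sub>H (cover_op d U F v)"] by simp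
  then show ?thesis unfolding controlled_def by blast
qed

text \<open>Carries an estimate from the reduced system to the original one, provided that the
  reduced equations are controlled by the original equations.\<close>

lemma controlled_reduce:
  assumes "controlled d' U' Q" "U' \<subseteq> U" "finite U'"
    and "\<And>v. v \<in> U' \<Longrightarrow> controlled d U (\<lambda>F. norm\<^sub>H (cover_op d' U' F v))"
  shows "controlled d U Q"
proof -
  from assms(1) obtain C where C: "\<forall>F\<in>fields U'. Q F \<le> C * (\<Sum>v\<in>U'. norm\<^sub>H (cover_op d' U' F v))"
    unfolding controlled_def by blast
  have "controlled d U (\<lambda>F. \<bar>C\<bar> * (\<Sum>v\<in>U'. norm\<^sub>H (cover_op d' U' F v)))"
    using assms(3,4) by (intro controlled_scale controlled_sum) simp_all
  then show ?thesis
  proof (rule controlled_mono)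
    fix F assume "F \<in> fields U"
    then have "F \<in> fields U'" using assms(2) by (rule fields_mono)
    then have "Q F \<le> C * (\<Sum>v\<in>U'. norm\<^sub>H (cover_op d' U' F v))" by (rule bspec[OF C])
    also have "\<dots> \<le> \<bar>C\<bar> * (\<Sum>v\<in>U'. norm\<^sub>H (cover_op d' U' F v))"
      by (intro mult_right_mono sum_nonneg) simp_all
    finally show "Q F \<le> \<bar>C\<bar> * (\<Sum>v\<in>U'. norm\<^sub>H (cover_op d' U' F v))" .
  qed
qed

text \<open>Boundedness below and surjectivity, stated for separate vertices so that both pass
  through the elimination steps.\<close>

definition regular :: "('v \<Rightarrow> real) \<Rightarrow> 'v set \<Rightarrow> bool" where
  "regular d U \<longleftrightarrow> (\<forall>v\<in>U. controlled d U (\<lambda>F. norm\<^sub>H (F v))) \<and>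
     (\<forall>h\<in>fields U. \<exists>F\<in>fields U. \<forall>v\<in>U. cover_op d U F v = h v)"

lemma arcs_into_isolated:
  assumes "arcs_into u U = {}" "t \<in> U"
  shows "arcs_into t U = arcs_into t (U - {u})"
proof -
  have "head G f \<noteq> u" if "f \<in> arcs_into t U" for f
  proof
    assume "head G f = u"
    then have "arev f \<in> arcs_into u U" using that assms(2) by (simp add: arcs_into_def)
    then show False using assms(1) by simp
  qed
  then show ?thesis by (auto simp: arcs_into_def)
qed

lemma arcs_into_leaf:
  assumes "arcs_into u U = {e}" "u \<in> U" "t \<in> U"
  shows "arcs_into t U = (if t = head G e then insert (arev e) (arcs_into t (U - {u})) else arcs_into t (U - {u}))"
    "arev e \<notin> arcs_into t (U - {u})"
proof -
  note L = leaf_edge[OF assms(1,2)]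
  have 1: "f = arev e \<and> t = head G e" if "f \<in> arcs_into t U" "head G f = u" for f
  proof -
    have f: "f \<in> arcs G" "tail G f = t" using that(1) by (simp_all add: arcs_into_def)
    then have "arev f \<in> arcs_into u U" using that(2) assms(3) by (simp add: arcs_into_def)
    then have "arev f = e" using assms(1) by simp
    then have "arev (arev f) = arev e" by (rule arg_cong)
    then have "f = arev e" unfolding arev_arev .
    then show ?thesis using f(2) L(1) by simp
  qed
  have 2: "arev e \<in> arcs_into t U" if "t = head G e"
    using that L assms(2) by (simp add: arcs_into_def)
  have 3: "arcs_into t U = arcs_into t (U - {u}) \<union> {f \<in> arcs_into t U. head G f = u}"
    by (auto simp: arcs_into_def)
  show "arev e \<notin> arcs_into t (U - {u})" using L by (simp add: arcs_into_def)
  show "arcs_into t U = (if t = head G e then insert (arev e) (arcs_into t (U - {u})) else arcs_into t (U - {u}))"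
  proof (cases "t = head G e")
    case True
    have "{f \<in> arcs_into t U. head G f = u} \<subseteq> {arev e}" using 1 by blast
    moreover have "arev e \<in> {f \<in> arcs_into t U. head G f = u}" using 2[OF True] L(1,2) by simp
    ultimately have only: "{f \<in> arcs_into t U. head G f = u} = {arev e}" by blast
    show ?thesis using 3[unfolded only] True by simp
  next
    case False
    have none: "{f \<in> arcs_into t U. head G f = u} = {}" using 1 False by blast
    show ?thesis using 3[unfolded none] False by simp
  qed
qed

lemma cover_op_leaf_self:
  assumes "arcs_into u U = {e}"
  shows "cover_op d U F u = (\<lambda>x. complex_of_real (d u) * F u x - w e * translate e (F (head G e)) x)"
  by (simp add: cover_op_def assms)

lemma cover_op_leaf_other:
  assumes "arcs_into u U = {e}" "u \<in> U" "t \<in> U"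
  shows "cover_op d U F t = (\<lambda>x. cover_op d (U - {u}) F t x -
    (if t = head G e then w (arev e) * translate (arev e) (F u) x else 0))"
proof (cases "t = head G e")
  case True
  have "arcs_into t U = insert (arev e) (arcs_into t (U - {u}))" using arcs_into_leaf(1)[OF assms] True by simp
  then show ?thesis
    using arcs_into_leaf(2)[OF assms] leaf_edge(1,2)[OF assms(1,2)] True unfolding cover_op_def by (simp add: fun_eq_iff)
next
  case False
  then show ?thesis using arcs_into_leaf(1)[OF assms] unfolding cover_op_def by (simp add: fun_eq_iff)
qed

text \<open>The block row operation for the pivot \<open>d u\<close>. Its correction passes along
  \<open>e\<close> and back along \<open>arev e\<close>, and these translations cancel; the Schur
  complement therefore stays scalar even for a noncommutative group.\<close>

lemma cover_op_leaf_update: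
  assumes "arcs_into u U = {e}" "u \<in> U" "t \<in> U - {u}" "d u \<noteq> 0" "F \<in> fields U"
  shows "cover_op (leaf_update d u e) (U - {u}) F t = (\<lambda>x. cover_op d U F t x +
    (if t = head G e then w (arev e) / complex_of_real (d u) * translate (arev e) (cover_op d U F u) x else 0))"
proof (cases "t = head G e")
  case False
  then show ?thesis
    using cover_op_leaf_other[OF assms(1,2), of t d F] assms(3) by (simp add: cover_op_def leaf_update_def)
next
  case True
  note L = leaf_edge[OF assms(1,2)]
  have tU: "t \<in> U" using assms(3) by simp
  have tr: "translate (arev e) (cover_op d U F u) x =
      complex_of_real (d u) * translate (arev e) (F u) x - w e * F t x" for x
    unfolding cover_op_leaf_self[OF assms(1)] translate_diff translate_scale
    using translate_arev(2)[OF L(1) fieldsD[OF assms(5) L(3)]] True by simp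
  have ww: "w (arev e) * w e = complex_of_real ((cmod (w e))\<^sup>2)"
    using weight_arev[OF L(1)] by (simp only: complex_norm_square mult.commute)
  have "w (arev e) / complex_of_real (d u) * translate (arev e) (cover_op d U F u) x =
      w (arev e) * translate (arev e) (F u) x - complex_of_real ((cmod (w e))\<^sup>2 / d u) * F t x" for x
    unfolding tr ww[symmetric] of_real_divide using assms(4) by (simp add: field_simps)
  moreover have "cover_op (leaf_update d u e) (U - {u}) F t x =
      cover_op d (U - {u}) F t x - complex_of_real ((cmod (w e))\<^sup>2 / d u) * F t x" for x
    using True by (simp add: cover_op_def leaf_update_def algebra_simps)
  ultimately show ?thesis
    using cover_op_leaf_other[OF assms(1,2) tU, of d F] True by (simp add: fun_eq_iff)
qed

lemma regular_isolated:
  assumes U: "finite U" "u \<in> U" "arcs_into u U = {}" "d u \<noteq> 0" and IH: "regular d (U - {u})"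
  shows "regular d U"
proof -
  have self: "cover_op d U F u = (\<lambda>x. complex_of_real (d u) * F u x)" for F
    by (simp add: cover_op_def U(3))
  have other: "cover_op d U F t = cover_op d (U - {u}) F t" if "t \<in> U - {u}" for F t
    using arcs_into_isolated[OF U(3), of t] that by (simp add: cover_op_def)
  show ?thesis
    unfolding regular_def
  proof (intro conjI ballI)
    fix v assume v: "v \<in> U"
    show "controlled d U (\<lambda>F. norm\<^sub>H (F v))"
    proof (cases "v = u")
      case True
      have "controlled d U (\<lambda>F. (1 / \<bar>d u\<bar>) * norm\<^sub>H (cover_op d U F u))"
        by (intro controlled_scale controlled_op U(1,2)) simp
      then show ?thesis
        by (rule controlled_mono) (use U(4) True in \<open>simp add: self ell2_norm_scale\<close>)
    next
      case False
      then have "controlled d (U - {u}) (\<lambda>F. norm\<^sub>H (F v))" using IH v by (simp add: regular_def)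
      then show ?thesis
      proof (rule controlled_reduce)
        fix t assume t: "t \<in> U - {u}"
        then show "controlled d U (\<lambda>F. norm\<^sub>H (cover_op d (U - {u}) F t))"
          using controlled_op[OF U(1), of t d] by (simp add: other)
      qed (use U(1) in auto)
    qed
  next
    fix h assume h: "h \<in> fields U"
    then have "h \<in> fields (U - {u})" by (rule fields_mono) blast
    then obtain F where F: "F \<in> fields (U - {u})" "\<forall>v\<in>U - {u}. cover_op d (U - {u}) F v = h v"
      using IH unfolding regular_def by blast
    define F' where "F' = F(u := (\<lambda>x. (1 / complex_of_real (d u)) * h u x))"
    have "F' u \<in> H" unfolding F'_def fun_upd_same by (rule ell2_scale[OF fieldsD[OF h U(2)]])
    then have "F' \<in> fields U" using F(1) by (auto simp: fields_def F'_def)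
    moreover have "cover_op d U F' v = h v" if v: "v \<in> U" for v
    proof (cases "v = u")
      case True
      then show ?thesis using U(4) by (simp add: self F'_def)
    next
      case False
      have "cover_op d U F' v = cover_op d (U - {u}) F' v" using v False by (intro other) simp
      also have "\<dots> = cover_op d (U - {u}) F v"
        by (rule cover_op_cong) (use False in \<open>auto simp: F'_def\<close>)
      finally show ?thesis using F(2) v False by simp
    qed
    ultimately show "\<exists>F\<in>fields U. \<forall>v\<in>U. cover_op d U F v = h v" by blast
  qed
qed

text \<open>Forward elimination and back substitution: the reduced equations are combinations of the
  original ones, and the equation at \<open>u\<close> recovers the value at \<open>u\<close> after
  division by \<open>d u\<close>.\<close>

lemma regular_leaf:
  assumes U: "finite U" "u \<in> U" "arcs_into u U = {e}" "d u \<noteq> 0"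
    and IH: "regular (leaf_update d u e) (U - {u})"
  shows "regular d U"
proof -
  let ?v = "head G e" and ?d' = "leaf_update d u e"
  let ?c = "w (arev e) / complex_of_real (d u)"
  note L = leaf_edge[OF U(3,2)]
  note self = cover_op_leaf_self[OF U(3)]
  have vU: "?v \<in> U - {u}" using L by simp
  have ae: "arev e \<in> arcs G" using L(1) by simp
  have upd: "cover_op ?d' (U - {u}) F t = (\<lambda>x. cover_op d U F t x +
      (if t = ?v then ?c * translate (arev e) (cover_op d U F u) x else 0))"
    if "t \<in> U - {u}" "F \<in> fields U" for t F
    using cover_op_leaf_update[OF U(3,2) that(1) _ that(2)] U(4) by blast
  have ctl: "controlled d U (\<lambda>F. norm\<^sub>H (F t))" if t: "t \<in> U - {u}" for t
  proof -
    have "controlled ?d' (U - {u}) (\<lambda>F. norm\<^sub>H (F t))" using IH t by (simp add: regular_def)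
    then show ?thesis
    proof (rule controlled_reduce)
      fix s assume s: "s \<in> U - {u}"
      have "controlled d U (\<lambda>F. norm\<^sub>H (cover_op d U F s) + cmod ?c * norm\<^sub>H (cover_op d U F u))"
        using s U by (intro controlled_add controlled_scale controlled_op) auto
      then show "controlled d U (\<lambda>F. norm\<^sub>H (cover_op ?d' (U - {u}) F s))"
      proof (rule controlled_mono)
        fix F assume F: "F \<in> fields U"
        have su: "cover_op d U F s \<in> H" "cover_op d U F u \<in> H" using s U(2) cover_op_in[OF F] by auto
        show "norm\<^sub>H (cover_op ?d' (U - {u}) F s) \<le> norm\<^sub>H (cover_op d U F s) + cmod ?c * norm\<^sub>H (cover_op d U F u)"
        proof (cases "s = ?v")
          case True
          have eq: "cover_op ?d' (U - {u}) F s = (\<lambda>x. cover_op d U F s x + ?c * translate (arev e) (cover_op d U F u) x)"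
            unfolding upd[OF s F] if_P[OF True] ..
          have "norm\<^sub>H (cover_op ?d' (U - {u}) F s) \<le> norm\<^sub>H (cover_op d U F s) +
              norm\<^sub>H (\<lambda>x. ?c * translate (arev e) (cover_op d U F u) x)"
            unfolding eq by (rule ell2_add(2)[OF su(1) ell2_scale[OF translate_in[OF ae su(2)]]])
          then show ?thesis by (simp only: ell2_norm_scale norm_translate[OF ae])
        next
          case False
          then show ?thesis by (simp add: upd[OF s F])
        qed
      qed
    qed (use U(1) in auto)
  qed
  show ?thesis
    unfolding regular_def
  proof (intro conjI ballI)
    fix t assume t: "t \<in> U"
    show "controlled d U (\<lambda>F. norm\<^sub>H (F t))"
    proof (cases "t = u")
      case True
      have "controlled d U (\<lambda>F. (1 / \<bar>d u\<bar>) * (norm\<^sub>H (cover_op d U F u) + cmod (w e) * norm\<^sub>H (F ?v)))"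
        using ctl[OF vU] U by (intro controlled_scale controlled_add controlled_op) auto
      then show ?thesis
      proof (rule controlled_mono)
        fix F assume F: "F \<in> fields U"
        have in_H: "cover_op d U F u \<in> H" "(\<lambda>x. w e * translate e (F ?v) x) \<in> H"
          using cover_op_in[OF F U(2)] ell2_scale[OF translate_in[OF L(1) fieldsD[OF F L(3)]]] by auto
        have "\<bar>d u\<bar> * norm\<^sub>H (F u) = norm\<^sub>H (\<lambda>x. complex_of_real (d u) * F u x)" by (simp add: ell2_norm_scale)
        also have "(\<lambda>x. complex_of_real (d u) * F u x) = (\<lambda>x. cover_op d U F u x + w e * translate e (F ?v) x)"
          by (simp add: self)
        also have "norm\<^sub>H \<dots> \<le> norm\<^sub>H (cover_op d U F u) + cmod (w e) * norm\<^sub>H (F ?v)"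
          using ell2_add(2)[OF in_H] by (simp only: ell2_norm_scale norm_translate[OF L(1)])
        finally show "norm\<^sub>H (F t) \<le> (1 / \<bar>d u\<bar>) * (norm\<^sub>H (cover_op d U F u) + cmod (w e) * norm\<^sub>H (F ?v))"
          using U(4) True by (simp add: field_simps)
      qed
    next
      case False
      then show ?thesis using ctl t by simp
    qed
  next
    fix h assume h: "h \<in> fields U"
    \<comment> \<open>The right-hand side after the row operation that eliminates
      \<open>u\<close>.\<close>
    define h' where "h' = h(?v := (\<lambda>x. h ?v x + ?c * translate (arev e) (h u) x))"
    have "h' ?v \<in> H" unfolding h'_def fun_upd_same
      by (intro ell2_scale ell2_add(1) translate_in ae fieldsD[OF h U(2)] fieldsD[OF h L(3)])
    then have "h' \<in> fields (U - {u})" using h by (auto simp: fields_def h'_def)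
    then obtain F where F: "F \<in> fields (U - {u})" "\<forall>v\<in>U - {u}. cover_op ?d' (U - {u}) F v = h' v"
      using IH unfolding regular_def by blast
    define F' where "F' = F(u := (\<lambda>x. (1 / complex_of_real (d u)) * (h u x + w e * translate e (F ?v) x)))"
    have "F' u \<in> H" unfolding F'_def fun_upd_same
      by (intro ell2_scale ell2_add(1) translate_in L(1) fieldsD[OF h U(2)] fieldsD[OF F(1) vU])
    then have F': "F' \<in> fields U" using F(1) by (auto simp: fields_def F'_def)
    have F'v: "F' ?v = F ?v" using L(4) by (simp add: F'_def)
    have u: "cover_op d U F' u = h u"
      unfolding self F'v using U(4) by (simp add: F'_def)
    have "cover_op d U F' t = h t" if t: "t \<in> U" for t
    proof (cases "t = u")
      case False
      have "cover_op ?d' (U - {u}) F' t = cover_op ?d' (U - {u}) F t"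
        using False by (intro cover_op_cong) (auto simp: F'_def)
      also have "\<dots> = h' t" using F(2) t False by simp
      finally have eq: "cover_op ?d' (U - {u}) F' t = h' t" .
      have tU: "t \<in> U - {u}" using t False by simp
      have "cover_op d U F' t x + (if t = ?v then ?c * translate (arev e) (h u) x else 0) =
          h t x + (if t = ?v then ?c * translate (arev e) (h u) x else 0)" for x
        using fun_cong[OF eq, of x] unfolding upd[OF tU F'] u h'_def by (cases "t = ?v") simp_all
      then show ?thesis by (simp add: fun_eq_iff)
    qed (simp add: u)
    then show "\<exists>F\<in>fields U. \<forall>v\<in>U. cover_op d U F v = h v" using F' by blast
  qed
qed

lemma cover_op_split:
  assumes "T = T1 \<union> T2" "T1 \<inter> T2 = {}"
  shows "cover_op d T F t = (\<lambda>x. cover_op d T1 F t x - (\<Sum>f\<in>arcs_into t T2. w f * translate f (F (head G f)) x))"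
proof -
  have "arcs_into t T = arcs_into t T1 \<union> arcs_into t T2" "arcs_into t T1 \<inter> arcs_into t T2 = {}"
    using assms by (auto simp: arcs_into_def)
  then show ?thesis by (simp add: cover_op_def sum.union_disjoint fun_eq_iff)
qed

text \<open>With \<open>d u = 0\<close> the equation at \<open>u\<close> fixes the value at the
  neighbour, the smaller system then fixes all values off the edge, and the equation at the
  neighbour finally fixes the value at \<open>u\<close>.\<close>

lemma regular_zero_leaf:
  assumes U: "finite U" "u \<in> U" "arcs_into u U = {e}" "d u = 0"
    and IH: "regular d (U - {u, head G e})"
  shows "regular d U"
proof -
  let ?v = "head G e" and ?U = "U - {u, head G e}"
  note L = leaf_edge[OF U(3,2)]
  have self: "cover_op d U F u = (\<lambda>x. - w e * translate e (F ?v) x)" for F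
    using cover_op_leaf_self[OF U(3), of d F] U(4) by simp
  have we: "w e \<noteq> 0" "w (arev e) \<noteq> 0" using weight_nonzero L(1) by auto
  have ae: "arev e \<in> arcs G" using L(1) by simp
  have Uu: "U - {u} = ?U \<union> {?v}" "?U \<inter> {?v} = {}" using L(3,4) by auto
  have v: "cover_op d U F ?v = (\<lambda>x. cover_op d (U - {u}) F ?v x - w (arev e) * translate (arev e) (F u) x)" for F
    using cover_op_leaf_other[OF U(3,2) L(3), of d F] by simp
  have other: "cover_op d U F t = (\<lambda>x. cover_op d ?U F t x - (\<Sum>f\<in>arcs_into t {?v}. w f * translate f (F ?v) x))"
    if t: "t \<in> ?U" for F t
  proof -
    have "cover_op d U F t = cover_op d (U - {u}) F t"
      using cover_op_leaf_other[OF U(3,2), of t d F] t by simp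
    also have "\<dots> = (\<lambda>x. cover_op d ?U F t x - (\<Sum>f\<in>arcs_into t {?v}. w f * translate f (F (head G f)) x))"
      by (rule cover_op_split[OF Uu])
    also have "\<dots> = (\<lambda>x. cover_op d ?U F t x - (\<Sum>f\<in>arcs_into t {?v}. w f * translate f (F ?v) x))"
      by (intro ext arg_cong2[where f = "(-)"] sum.cong refl) (simp add: arcs_into_def)
    finally show ?thesis .
  qed
  have sum_in: "(\<lambda>x. \<Sum>f\<in>arcs_into t {?v}. w f * translate f k x) \<in> H"
    "norm\<^sub>H (\<lambda>x. \<Sum>f\<in>arcs_into t {?v}. w f * translate f k x) \<le> (\<Sum>f\<in>arcs_into t {?v}. cmod (w f)) * norm\<^sub>H k"
    if "k \<in> H" for t k
    using sum_translate_in[of "\<lambda>_. k" "{?v}" "arcs_into t {?v}" t] that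
    by (simp_all add: fields_def sum_distrib_right)
  have ctl_v: "controlled d U (\<lambda>F. norm\<^sub>H (F ?v))"
  proof -
    have "controlled d U (\<lambda>F. (1 / cmod (w e)) * norm\<^sub>H (cover_op d U F u))"
      by (intro controlled_scale controlled_op U(1,2)) simp
    then show ?thesis
    proof (rule controlled_mono)
      fix F
      have "norm\<^sub>H (cover_op d U F u) = cmod (w e) * norm\<^sub>H (F ?v)"
        unfolding self by (simp only: ell2_norm_scale norm_translate[OF L(1)] norm_minus_cancel)
      then show "norm\<^sub>H (F ?v) \<le> (1 / cmod (w e)) * norm\<^sub>H (cover_op d U F u)" using we(1) by simp
    qed
  qed
  have ctl: "controlled d U (\<lambda>F. norm\<^sub>H (F t))" if t: "t \<in> ?U" for t
  proof -
    have "controlled d ?U (\<lambda>F. norm\<^sub>H (F t))" using IH t by (simp add: regular_def)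
    then show ?thesis
    proof (rule controlled_reduce)
      fix s assume s: "s \<in> ?U"
      have "controlled d U (\<lambda>F. norm\<^sub>H (cover_op d U F s) + (\<Sum>f\<in>arcs_into s {?v}. cmod (w f)) * norm\<^sub>H (F ?v))"
        using s U(1) by (intro controlled_add controlled_scale controlled_op ctl_v sum_nonneg) auto
      then show "controlled d U (\<lambda>F. norm\<^sub>H (cover_op d ?U F s))"
      proof (rule controlled_mono)
        fix F assume F: "F \<in> fields U"
        have "cover_op d U F s \<in> H" using s cover_op_in[OF F] by simp
        note add = ell2_add(2)[OF this sum_in(1)[OF fieldsD[OF F L(3)], of s]]
        have "norm\<^sub>H (cover_op d ?U F s) = norm\<^sub>H (\<lambda>x. cover_op d U F s x + (\<Sum>f\<in>arcs_into s {?v}. w f * translate f (F ?v) x))"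
          by (simp add: other[OF s])
        also have "\<dots> \<le> norm\<^sub>H (cover_op d U F s) + (\<Sum>f\<in>arcs_into s {?v}. cmod (w f)) * norm\<^sub>H (F ?v)"
          using add sum_in(2)[OF fieldsD[OF F L(3)], of s] by simp
        finally show "norm\<^sub>H (cover_op d ?U F s) \<le>
            norm\<^sub>H (cover_op d U F s) + (\<Sum>f\<in>arcs_into s {?v}. cmod (w f)) * norm\<^sub>H (F ?v)" .
      qed
    qed (use U(1) in auto)
  qed
  have ctl': "controlled d U (\<lambda>F. norm\<^sub>H (F t))" if "t \<in> U - {u}" for t
    using that ctl ctl_v by (cases "t = ?v") auto
  show ?thesis
    unfolding regular_def
  proof (intro conjI ballI)
    fix t assume t: "t \<in> U"
    show "controlled d U (\<lambda>F. norm\<^sub>H (F t))"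
    proof (cases "t = u")
      case True
      have "controlled d U (\<lambda>F. (1 / cmod (w (arev e))) * (norm\<^sub>H (cover_op d U F ?v) +
          (\<bar>d ?v\<bar> * norm\<^sub>H (F ?v) + (\<Sum>f\<in>arcs_into ?v (U - {u}). cmod (w f) * norm\<^sub>H (F (head G f))))))"
        using U(1) L(3) by (intro controlled_scale controlled_add controlled_op controlled_sum ctl_v ctl')
          (auto simp: arcs_into_def)
      then show ?thesis
      proof (rule controlled_mono)
        fix F assume F: "F \<in> fields U"
        have Fu: "F \<in> fields (U - {u})" using F by (rule fields_mono) blast
        have Fv: "F ?v \<in> H" by (rule fieldsD[OF F L(3)])
        note s = sum_translate_in[OF Fu subset_refl, of ?v]
        have r_in: "cover_op d (U - {u}) F ?v \<in> H" by (rule cover_op_in[OF Fu]) (use L in simp)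
        have "norm\<^sub>H (cover_op d (U - {u}) F ?v) \<le> norm\<^sub>H (\<lambda>x. complex_of_real (d ?v) * F ?v x) +
            norm\<^sub>H (\<lambda>x. \<Sum>f\<in>arcs_into ?v (U - {u}). w f * translate f (F (head G f)) x)"
          unfolding cover_op_def by (rule ell2_diff(2)[OF ell2_scale[OF Fv] s(1)])
        also have "\<dots> \<le> \<bar>d ?v\<bar> * norm\<^sub>H (F ?v) + (\<Sum>f\<in>arcs_into ?v (U - {u}). cmod (w f) * norm\<^sub>H (F (head G f)))"
          using s(2) by (simp add: ell2_norm_scale)
        finally have r: "norm\<^sub>H (cover_op d (U - {u}) F ?v) \<le>
            \<bar>d ?v\<bar> * norm\<^sub>H (F ?v) + (\<Sum>f\<in>arcs_into ?v (U - {u}). cmod (w f) * norm\<^sub>H (F (head G f)))" .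
        have "cmod (w (arev e)) * norm\<^sub>H (F u) = norm\<^sub>H (\<lambda>x. w (arev e) * translate (arev e) (F u) x)"
          by (simp only: ell2_norm_scale norm_translate[OF ae])
        also have "(\<lambda>x. w (arev e) * translate (arev e) (F u) x) = (\<lambda>x. cover_op d (U - {u}) F ?v x - cover_op d U F ?v x)"
          by (simp add: v)
        also have "norm\<^sub>H \<dots> \<le> norm\<^sub>H (cover_op d (U - {u}) F ?v) + norm\<^sub>H (cover_op d U F ?v)"
          by (rule ell2_diff(2)[OF r_in cover_op_in[OF F L(3)]])
        also have "\<dots> \<le> norm\<^sub>H (cover_op d U F ?v) +
          (\<bar>d ?v\<bar> * norm\<^sub>H (F ?v) + (\<Sum>f\<in>arcs_into ?v (U - {u}). cmod (w f) * norm\<^sub>H (F (head G f))))"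
          using r by simp
        finally show "norm\<^sub>H (F t) \<le> (1 / cmod (w (arev e))) * (norm\<^sub>H (cover_op d U F ?v) +
          (\<bar>d ?v\<bar> * norm\<^sub>H (F ?v) + (\<Sum>f\<in>arcs_into ?v (U - {u}). cmod (w f) * norm\<^sub>H (F (head G f)))))"
          using we(2) True by (simp add: pos_le_divide_eq mult.commute)
      qed
    next
      case False
      then show ?thesis using ctl' t by simp
    qed
  next
    fix h assume h: "h \<in> fields U"
    \<comment> \<open>The value that the equation at \<open>u\<close> forces at the
      neighbour.\<close>
    define k where "k = (\<lambda>x. - 1 / w e * translate (arev e) (h u) x)"
    have k: "k \<in> H" unfolding k_def by (intro ell2_scale translate_in ae fieldsD[OF h U(2)])
    define h' where "h' = (\<lambda>t x. h t x + (\<Sum>f\<in>arcs_into t {?v}. w f * translate f k x))"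
    have "h' \<in> fields ?U" unfolding fields_def h'_def
      using ell2_add(1)[OF fieldsD[OF h] sum_in(1)[OF k]] by auto
    then obtain F where F: "F \<in> fields ?U" "\<forall>v\<in>?U. cover_op d ?U F v = h' v"
      using IH unfolding regular_def by blast
    define F1 where "F1 = F(?v := k)"
    have F1: "F1 \<in> fields (U - {u})" using F(1) k by (auto simp: fields_def F1_def)
    \<comment> \<open>The value at \<open>u\<close> is read off from the neighbour's equation, where
      all other terms are known by now.\<close>
    define F' where "F' = F1(u := (\<lambda>x. 1 / w (arev e) * translate e (\<lambda>y. cover_op d (U - {u}) F1 ?v y - h ?v y) x))"
    have r_in: "(\<lambda>y. cover_op d (U - {u}) F1 ?v y - h ?v y) \<in> H"
      by (rule ell2_diff(1)[OF cover_op_in[OF F1] fieldsD[OF h L(3)]]) (use L in simp)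
    have "F' u \<in> H" unfolding F'_def fun_upd_same by (intro ell2_scale translate_in L(1) r_in)
    then have F': "F' \<in> fields U" using F1 by (auto simp: fields_def F'_def)
    have F'v: "F' ?v = k" using L(4) by (simp add: F'_def F1_def)
    have u: "cover_op d U F' u = h u"
    proof -
      have "translate e k = (\<lambda>x. - 1 / w e * h u x)"
        unfolding k_def translate_scale translate_arev(1)[OF L(1) fieldsD[OF h U(2)]] ..
      then show ?thesis unfolding self F'v using we(1) by simp
    qed
    have hv: "cover_op d U F' ?v = h ?v"
    proof -
      have "cover_op d (U - {u}) F' ?v = cover_op d (U - {u}) F1 ?v"
        using L(4) by (intro cover_op_cong) (auto simp: F'_def)
      moreover have "translate (arev e) (F' u) = (\<lambda>x. 1 / w (arev e) * (cover_op d (U - {u}) F1 ?v x - h ?v x))"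
        unfolding F'_def fun_upd_same translate_scale translate_arev(2)[OF L(1) r_in] ..
      ultimately show ?thesis unfolding v using we(2) by simp
    qed
    have "cover_op d U F' t = h t" if t: "t \<in> U" for t
    proof -
      consider "t = u" | "t = ?v" | "t \<in> ?U" using t by blast
      then show ?thesis
      proof cases
        case 3
        have "cover_op d ?U F' t = cover_op d ?U F t"
          using 3 by (intro cover_op_cong) (auto simp: F'_def F1_def)
        also have "\<dots> = h' t" using F(2) 3 by simp
        finally show ?thesis unfolding other[OF 3] F'v by (simp add: h'_def)
      qed (simp_all add: u hv)
    qed
    then show "\<exists>F\<in>fields U. \<forall>v\<in>U. cover_op d U F v = h v" using F' by blast
  qed
qed

theorem regular_if_cycles_vanish:
  assumes "finite U" "cycles_vanish d U" "matching_value d U \<noteq> 0"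
  shows "regular d U"
  using assms
proof (induction rule: elimination_induct)
  case (empty d)
  show ?case by (simp add: regular_def fields_def)
qed (fact regular_isolated regular_leaf regular_zero_leaf)+

end

section \<open>Indefiniteness of the quadratic form\<close>

context schroedinger_cover begin

definition cover_form :: "('v \<Rightarrow> real) \<Rightarrow> 'v set \<Rightarrow> ('v \<Rightarrow> 'g \<Rightarrow> complex) \<Rightarrow> real" where
  "cover_form d U F = (\<Sum>v\<in>U. inner\<^sub>H (F v) (cover_op d U F v))"

definition indefinite :: "('v \<Rightarrow> real) \<Rightarrow> 'v set \<Rightarrow> bool" where
  "indefinite d U \<longleftrightarrow> (\<exists>F\<in>fields U. cover_form d U F < 0) \<and> (\<exists>F\<in>fields U. 0 < cover_form d U F)"

text \<open>A cycle through \<open>u\<close> has an arc leaving \<open>u\<close> and an arc entering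
  it. If only one arc at \<open>u\<close> is available, these are reverses of each other, which
  oriented cycles forbid.\<close>

lemma oriented_cycles_avoid_leaf:
  assumes "C \<in> oriented_cycles U" "arcs_into u U \<subseteq> {e}"
  shows "C \<in> oriented_cycles (U - {u})"
proof -
  have C: "C \<subseteq> arcs G" "tail G ` C = head G ` C" "tail G ` C \<subseteq> U" "\<forall>e\<in>C. arev e \<notin> C"
    using assms(1) unfolding oriented_cycles_def by blast+
  have "u \<notin> tail G ` C"
  proof
    assume u: "u \<in> tail G ` C"
    then obtain f where f: "f \<in> C" "tail G f = u" by blast
    have "u \<in> head G ` C" using u unfolding C(2) .
    then obtain f' where f': "f' \<in> C" "head G f' = u" by blast
    have arcs: "f \<in> arcs G" "f' \<in> arcs G" using f f' C(1) by blast+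
    have "head G f \<in> tail G ` C" unfolding C(2) using f(1) by (rule imageI)
    then have "f \<in> arcs_into u U" using f arcs C(3) by (auto simp: arcs_into_def)
    moreover have "tail G f' \<in> U" using f'(1) C(3) by blast
    then have "arev f' \<in> arcs_into u U" using f' arcs by (simp add: arcs_into_def)
    ultimately have "arev f' = f" using assms(2) by blast
    then show False using f(1) f'(1) C(4) by blast
  qed
  then have "tail G ` C \<subseteq> U - {u}" using C(3) by blast
  then show ?thesis using assms(1) unfolding oriented_cycles_def by blast
qed

text \<open>Choosing the value at \<open>u\<close> so that the equation there gives zero makes the
  form on \<open>U\<close> agree with the form of the reduced system; both signs are thus
  inherited.\<close>

lemma indefinite_extend:
  assumes U: "finite U" "u \<in> U" and IH: "indefinite d' (U - {u})"
    and ext: "\<And>F. F \<in> fields (U - {u}) \<Longrightarrow> \<exists>f\<in>H. cover_op d U (F(u := f)) u = (\<lambda>x. 0) \<and>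
      (\<forall>t\<in>U - {u}. cover_op d U (F(u := f)) t = cover_op d' (U - {u}) F t)"
  shows "indefinite d U"
proof -
  have "\<exists>F'\<in>fields U. cover_form d U F' = cover_form d' (U - {u}) F" if F: "F \<in> fields (U - {u})" for F
  proof -
    obtain f where f: "f \<in> H" "cover_op d U (F(u := f)) u = (\<lambda>x. 0)"
      "\<forall>t\<in>U - {u}. cover_op d U (F(u := f)) t = cover_op d' (U - {u}) F t"
      using ext[OF F] by blast
    have "cover_form d U (F(u := f)) = inner\<^sub>H f (cover_op d U (F(u := f)) u) +
        (\<Sum>v\<in>U - {u}. inner\<^sub>H ((F(u := f)) v) (cover_op d U (F(u := f)) v))"
      unfolding cover_form_def using U by (simp add: sum.remove[of U u])
    also have "(\<Sum>v\<in>U - {u}. inner\<^sub>H ((F(u := f)) v) (cover_op d U (F(u := f)) v)) = cover_form d' (U - {u}) F"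
      unfolding cover_form_def using f(3) by (intro sum.cong) simp_all
    finally have "cover_form d U (F(u := f)) = cover_form d' (U - {u}) F" by (simp only: f(2) ell2_inner_zero add_0_left)
    moreover have "F(u := f) \<in> fields U" using F f(1) by (auto simp: fields_def)
    ultimately show ?thesis by blast
  qed
  then show ?thesis using IH unfolding indefinite_def by metis
qed

lemma indefinite_isolated:
  assumes U: "finite U" "u \<in> U" "arcs_into u U = {}" and IH: "indefinite d (U - {u})"
  shows "indefinite d U"
proof (rule indefinite_extend[OF U(1,2) IH])
  fix F assume "F \<in> fields (U - {u})"
  let ?F = "F(u := (\<lambda>x. 0))"
  have "cover_op d U ?F u = (\<lambda>x. 0)" by (simp add: cover_op_def U(3))
  moreover have "cover_op d U ?F t = cover_op d (U - {u}) F t" if t: "t \<in> U - {u}" for t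
  proof -
    have "cover_op d U ?F t = cover_op d (U - {u}) ?F t"
      using arcs_into_isolated[OF U(3), of t] t by (simp add: cover_op_def)
    also have "\<dots> = cover_op d (U - {u}) F t" by (rule cover_op_cong) (use t in auto)
    finally show ?thesis .
  qed
  ultimately show "\<exists>f\<in>H. cover_op d U (F(u := f)) u = (\<lambda>x. 0) \<and>
      (\<forall>t\<in>U - {u}. cover_op d U (F(u := f)) t = cover_op d (U - {u}) F t)"
    by (intro bexI[of _ "\<lambda>x. 0"]) simp_all
qed

lemma indefinite_leaf:
  assumes U: "finite U" "u \<in> U" "arcs_into u U = {e}" "d u \<noteq> 0"
    and IH: "indefinite (leaf_update d u e) (U - {u})"
  shows "indefinite d U"
proof (rule indefinite_extend[OF U(1,2) IH])
  fix F assume F: "F \<in> fields (U - {u})"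
  note L = leaf_edge[OF U(3,2)]
  let ?f = "\<lambda>x. w e / complex_of_real (d u) * translate e (F (head G e)) x"
  let ?F = "F(u := ?f)"
  have f: "?f \<in> H" using L by (intro ell2_scale translate_in fieldsD[OF F]) auto
  then have F': "?F \<in> fields U" using F by (auto simp: fields_def)
  have zero: "cover_op d U ?F u = (\<lambda>x. 0)"
    unfolding cover_op_leaf_self[OF U(3)] using U(4) L(4) by simp
  have "cover_op d U ?F t = cover_op (leaf_update d u e) (U - {u}) F t" if t: "t \<in> U - {u}" for t
  proof -
    have "cover_op (leaf_update d u e) (U - {u}) ?F t = cover_op d U ?F t"
      unfolding cover_op_leaf_update[where d = d, OF U(3,2) t U(4) F'] zero translate_zero by simp
    moreover have "cover_op (leaf_update d u e) (U - {u}) ?F t = cover_op (leaf_update d u e) (U - {u}) F t"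
      by (rule cover_op_cong) (use t in auto)
    ultimately show ?thesis by simp
  qed
  with f zero show "\<exists>f\<in>H. cover_op d U (F(u := f)) u = (\<lambda>x. 0) \<and>
      (\<forall>t\<in>U - {u}. cover_op d U (F(u := f)) t = cover_op (leaf_update d u e) (U - {u}) F t)"
    by (intro bexI[of _ ?f]) simp_all
qed

text \<open>The test field is a unit vector at the neighbour and \<open>l\<close> times its
  translate at \<open>u\<close>. As the diagonal term at \<open>u\<close> vanishes, the form is
  affine in \<open>l\<close> with nonzero slope and takes both signs.\<close>

lemma indefinite_zero_leaf:
  assumes U: "finite U" "u \<in> U" "arcs_into u U = {e}" "d u = 0"
  shows "indefinite d U"
proof -
  let ?v = "head G e" and ?\<omega> = "(cmod (w e))\<^sup>2"
  note L = leaf_edge[OF U(3,2)]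
  have \<omega>: "?\<omega> > 0" using weight_nonzero[OF L(1)] by simp
  define \<delta> :: "'g \<Rightarrow> complex" where "\<delta> = (\<lambda>x. if x = \<one>\<^bsub>\<Gamma>\<^esub> then 1 else 0)"
  have sum\<delta>: "((\<lambda>x. (cmod (\<delta> x))\<^sup>2) has_sum 1) (carrier \<Gamma>)"
  proof -
    have "((\<lambda>x. (cmod (\<delta> x))\<^sup>2) has_sum (\<Sum>x\<in>{\<one>\<^bsub>\<Gamma>\<^esub>}. (cmod (\<delta> x))\<^sup>2)) {\<one>\<^bsub>\<Gamma>\<^esub>}"
      by (rule has_sum_finite) simp
    moreover have "((\<lambda>x. (cmod (\<delta> x))\<^sup>2) has_sum s) {\<one>\<^bsub>\<Gamma>\<^esub>} \<longleftrightarrow> ((\<lambda>x. (cmod (\<delta> x))\<^sup>2) has_sum s) (carrier \<Gamma>)" for s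
      by (rule has_sum_cong_neutral) (auto simp: \<delta>_def)
    ultimately show ?thesis by (simp add: \<delta>_def)
  qed
  have \<delta>: "\<delta> \<in> H" using has_sum_imp_summable[OF sum\<delta>] by (auto simp: ell2_def \<delta>_def)
  have n\<delta>: "norm\<^sub>H \<delta> = 1" using infsumI[OF sum\<delta>] by (simp add: ell2_norm_def)
  define y where "y = (\<lambda>x. w e * translate e \<delta> x)"
  have y: "y \<in> H" unfolding y_def by (intro ell2_scale translate_in L(1) \<delta>)
  have ny: "(norm\<^sub>H y)\<^sup>2 = ?\<omega>"
    unfolding y_def ell2_norm_scale norm_translate[OF L(1)] n\<delta> by simp
  define F where "F = (\<lambda>l t. if t = u then (\<lambda>x. complex_of_real l * y x) else if t = ?v then \<delta> else (\<lambda>x. 0))"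
  define K where "K = cover_op d (U - {u}) (F 0) ?v"
  have F: "F l \<in> fields U" for l
    unfolding fields_def F_def using ell2_scale[OF y] \<delta> by simp
  have K_in: "K \<in> H" unfolding K_def
    by (rule cover_op_in[OF fields_mono[OF F]]) (use L in auto)
  have form: "cover_form d U (F l) = inner\<^sub>H \<delta> K - 2 * l * ?\<omega>" for l
  proof -
    have Fu: "F l u = (\<lambda>x. complex_of_real l * y x)" and Fv: "F l ?v = \<delta>" using L(4) by (simp_all add: F_def)
    have "cover_op d U (F l) u = (\<lambda>x. complex_of_real (-1) * y x)"
      unfolding cover_op_leaf_self[OF U(3)] Fv using U(4) by (simp add: y_def)
    then have 1: "inner\<^sub>H (F l u) (cover_op d U (F l) u) = - l * ?\<omega>"
      unfolding Fu ell2_inner_commute[of _ "\<lambda>x. complex_of_real l * y x"]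
      by (simp only: ell2_inner_scale_right ell2_inner_commute[of _ "\<lambda>x. complex_of_real (-1) * y x"] ell2_inner_self ny)
    have K: "cover_op d (U - {u}) (F l) ?v = K"
      unfolding K_def by (rule cover_op_cong) (use L(4) in \<open>auto simp: F_def\<close>)
    have tr: "translate (arev e) (F l u) = (\<lambda>x. complex_of_real l * (w e * \<delta> x))"
      unfolding Fu y_def translate_scale translate_arev(2)[OF L(1) \<delta>] ..
    have coeff: "w (arev e) * (complex_of_real l * (w e * \<delta> x)) = complex_of_real (l * ?\<omega>) * \<delta> x" for x
    proof -
      have "w (arev e) * w e = complex_of_real ?\<omega>"
        using weight_arev[OF L(1)] by (simp only: complex_norm_square mult.commute)
      then show ?thesis unfolding of_real_mult by (metis mult.assoc mult.commute)
    qed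
    have "cover_op d U (F l) ?v = (\<lambda>x. K x - complex_of_real (l * ?\<omega>) * \<delta> x)"
      unfolding cover_op_leaf_other[OF U(3,2) L(3)] K tr by (simp only: coeff if_True refl)
    then have 2: "inner\<^sub>H (F l ?v) (cover_op d U (F l) ?v) = inner\<^sub>H \<delta> K - l * ?\<omega>"
      unfolding Fv by (simp only: ell2_inner_diff_right[OF \<delta> K_in ell2_scale[OF \<delta>]] ell2_inner_scale_right ell2_inner_self n\<delta>) simp
    have "cover_form d U (F l) = (\<Sum>t\<in>{u, ?v}. inner\<^sub>H (F l t) (cover_op d U (F l) t))"
      unfolding cover_form_def using U(1,2) L(3) by (intro sum.mono_neutral_right) (auto simp: F_def)
    also have "\<dots> = inner\<^sub>H (F l u) (cover_op d U (F l) u) + inner\<^sub>H (F l ?v) (cover_op d U (F l) ?v)"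
      using L(4) by simp
    finally show ?thesis unfolding 1 2 by simp
  qed
  \<comment> \<open>At these two values of \<open>l\<close> the form equals -1 and 1.\<close>
  have "cover_form d U (F ((inner\<^sub>H \<delta> K + 1) / (2 * ?\<omega>))) < 0" "0 < cover_form d U (F ((inner\<^sub>H \<delta> K - 1) / (2 * ?\<omega>)))"
    unfolding form using \<omega> by (simp_all add: field_simps)
  then show ?thesis
    unfolding indefinite_def by (intro conjI bexI[OF _ F])
qed

text \<open>A cycle survives the removal of an isolated vertex or of a leaf with nonzero pivot, and
  none is left in the empty graph. So the elimination must reach a leaf with zero pivot, which makes
  the form indefinite, and both signs pass back through the earlier steps.\<close>

theorem indefinite_if_cycle:
  assumes "finite U" "cycles_vanish d U" "matching_value d U \<noteq> 0" "C \<in> oriented_cycles U" "C \<noteq> {}"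
  shows "indefinite d U"
  using assms
proof (induction rule: elimination_induct)
  case (empty d)
  then show ?case by (auto simp: oriented_cycles_def)
next
  case (isolated d U u)
  \<comment> \<open>No arc leaves \<open>u\<close> inside \<open>U\<close>, so any arc may stand for
    \<open>e\<close> in the avoidance lemma.\<close>
  have "C \<in> oriented_cycles (U - {u})"
    by (rule oriented_cycles_avoid_leaf[OF isolated.prems(1), of _ undefined]) (simp add: isolated.hyps)
  from isolated.IH[OF this isolated.prems(2)] show ?case by (rule indefinite_isolated[OF isolated.hyps(1-3)])
next
  case (leaf d U u e)
  have "C \<in> oriented_cycles (U - {u})"
    by (rule oriented_cycles_avoid_leaf[OF leaf.prems(1), of _ e]) (simp add: leaf.hyps)
  from leaf.IH[OF this leaf.prems(2)] show ?case by (rule indefinite_leaf[where d = d, OF leaf.hyps(1-4)])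
next
  case (zero_leaf d U u e)
  then show ?case by (intro indefinite_zero_leaf)
qed

end

section \<open>From the phobic condition to vanishing oriented cycles\<close>

section \<open>Phobic graphs\<close>

context fin_schroedinger begin

lemma edge_ends_edge: "c \<in> arcs G \<Longrightarrow> edge_ends (G \<restriction> T) {c, arev c} = {tail G c, head G c}"
  by (auto simp: edge_ends_def)

lemma matchings_edge:
  assumes M: "M \<in> matchings (G \<restriction> T) arev" and a: "a \<in> e" "e \<in> M"
  shows "e = {a, arev a}" "a \<in> arcs G" "tail G a \<in> T" "tail G a \<noteq> head G a"
    "edge_ends (G \<restriction> T) e = {tail G a, head G a}"
proof -
  have "e \<in> edges (G \<restriction> T) arev" using M a(2) by (auto simp: matchings_def)
  then obtain c where c: "e = {c, arev c}" "c \<in> arcs G" "tail G c \<in> T" "head G c \<in> T"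
    by (auto simp: edges_def)
  show e: "e = {a, arev a}" using a(1) c(1) by auto
  show a': "a \<in> arcs G" and "tail G a \<in> T" using a(1) c by auto
  show "tail G a \<noteq> head G a" using M a by (auto simp: matchings_def)
  show "edge_ends (G \<restriction> T) e = {tail G a, head G a}" unfolding e by (rule edge_ends_edge[OF a'])
qed

text \<open>Matchings as sets of edges and matchings as reversal-closed arc sets correspond under
  union; the sign and the covered vertices are matched here as well.\<close>

lemma Union_matching:
  assumes M: "M \<in> matchings (G \<restriction> T) arev"
  shows "\<Union>M \<in> arc_matchings T" "(\<lambda>a. {a, arev a}) ` \<Union>M = M" "card (\<Union>M) div 2 = card M"
    "(\<Union>e\<in>M. edge_ends (G \<restriction> T) e) = tail G ` \<Union>M"
proof -
  note E = matchings_edge[OF M]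
  have arev_in: "arev a \<in> \<Union>M" if "a \<in> \<Union>M" for a using E(1) that by blast
  have disjoint: "e = e'" if "e \<in> M" "e' \<in> M" "edge_ends (G \<restriction> T) e \<inter> edge_ends (G \<restriction> T) e' \<noteq> {}" for e e'
    using M that unfolding matchings_def by blast
  have inj: "inj_on (tail G) (\<Union>M)"
  proof (rule inj_onI)
    fix a b assume ab: "a \<in> \<Union>M" "b \<in> \<Union>M" "tail G a = tail G b"
    then obtain e e' where e: "a \<in> e" "e \<in> M" "b \<in> e'" "e' \<in> M" by blast
    have "e = e'" using e(2,4) by (rule disjoint) (simp add: E(5)[OF e(1,2)] E(5)[OF e(3,4)] ab(3))
    then have "b \<in> {a, arev a}" using e(3) E(1)[OF e(1,2)] by simp
    then show "a = b" using E(2,4)[OF e(1,2)] ab(3) by auto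
  qed
  show "\<Union>M \<in> arc_matchings T"
    unfolding arc_matchings_def
  proof (intro CollectI conjI inj)
    show "\<Union>M \<subseteq> arcs G" using E(2) by blast
    show "arev ` \<Union>M \<subseteq> \<Union>M" using arev_in by (rule image_subsetI)
    show "tail G ` \<Union>M \<subseteq> T" using E(3) by blast
  qed
  have nonempty: "e \<noteq> {}" if "e \<in> M" for e
    using M that by (auto simp: matchings_def edges_def)
  show "(\<lambda>a. {a, arev a}) ` \<Union>M = M"
  proof (rule Set.set_eqI)
    show "e \<in> (\<lambda>a. {a, arev a}) ` \<Union>M \<longleftrightarrow> e \<in> M" for e
    proof
      assume "e \<in> (\<lambda>a. {a, arev a}) ` \<Union>M"
      then obtain a e' where "e = {a, arev a}" "a \<in> e'" "e' \<in> M" by blast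
      then show "e \<in> M" using E(1)[of a e'] by simp
    next
      assume e: "e \<in> M"
      then obtain a where a: "a \<in> e" using nonempty by blast
      then show "e \<in> (\<lambda>a. {a, arev a}) ` \<Union>M" using e E(1)[OF a e] by (intro image_eqI[of _ _ a]) auto
    qed
  qed
  show "card (\<Union>M) div 2 = card M"
  proof -
    have "M \<subseteq> Pow (arcs G)" using E(2) by blast
    then have fin: "finite M" by (rule finite_subset) simp
    have "2 * card M = card (\<Union>M)"
    proof (rule card_partition[OF fin])
      show "finite (\<Union>M)" by (rule finite_subset[of _ "arcs G"]) (use E(2) in auto)
      fix e assume e: "e \<in> M"
      then obtain a where a: "a \<in> e" using nonempty by blast
      have "a \<noteq> arev a" using arev_neq[OF E(2)[OF a e]] by simp
      then show "card e = 2" by (subst E(1)[OF a e]) simp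
    next
      fix e e' assume ee: "e \<in> M" "e' \<in> M" "e \<noteq> e'"
      show "e \<inter> e' = {}"
      proof (rule ccontr)
        assume "e \<inter> e' \<noteq> {}"
        then obtain a where a: "a \<in> e" "a \<in> e'" by blast
        show False using E(1)[OF a(1) ee(1)] E(1)[OF a(2) ee(2)] ee(3) by simp
      qed
    qed
    then show ?thesis by simp
  qed
  show "(\<Union>e\<in>M. edge_ends (G \<restriction> T) e) = tail G ` \<Union>M"
  proof (rule subset_antisym)
    show "tail G ` \<Union>M \<subseteq> (\<Union>e\<in>M. edge_ends (G \<restriction> T) e)" by (auto simp: edge_ends_def)
    show "(\<Union>e\<in>M. edge_ends (G \<restriction> T) e) \<subseteq> tail G ` \<Union>M"
    proof
      fix v assume "v \<in> (\<Union>e\<in>M. edge_ends (G \<restriction> T) e)"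
      then obtain e a where a: "e \<in> M" "a \<in> e" "v = tail G a \<or> v = head G a" by (auto simp: edge_ends_def)
      have "a \<in> \<Union>M" using a by blast
      note this arev_in[OF this]
      moreover have "tail G (arev a) = head G a" using E(2)[OF a(2,1)] by simp
      ultimately show "v \<in> tail G ` \<Union>M" using a(3) by (metis image_eqI)
    qed
  qed
qed

lemma arc_matching_edges:
  assumes A: "A \<in> arc_matchings T"
  shows "(\<lambda>a. {a, arev a}) ` A \<in> matchings (G \<restriction> T) arev" "\<Union>((\<lambda>a. {a, arev a}) ` A) = A"
proof -
  note D = arc_matchingsD[OF A]
  have arcs: "a \<in> arcs G" if "a \<in> A" for a using D(1) that by blast
  show "\<Union>((\<lambda>a. {a, arev a}) ` A) = A" using D(2) by auto
  have "(\<lambda>a. {a, arev a}) ` A \<subseteq> edges (G \<restriction> T) arev"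
    unfolding edges_def using arcs D(4,6) by (intro image_mono) auto
  moreover have "tail G b \<noteq> head G b" if "a \<in> A" "b \<in> {a, arev a}" for a b
    using D(7)[of b] D(2)[OF that(1)] that by auto
  moreover have "{a, arev a} = {b, arev b}"
    if ab: "a \<in> A" "b \<in> A" "edge_ends (G \<restriction> T) {a, arev a} \<inter> edge_ends (G \<restriction> T) {b, arev b} \<noteq> {}" for a b
  proof -
    have "{tail G a, tail G (arev a)} \<inter> {tail G b, tail G (arev b)} \<noteq> {}"
      using ab(3) edge_ends_edge[OF arcs[OF ab(1)]] edge_ends_edge[OF arcs[OF ab(2)]] arcs[OF ab(1)] arcs[OF ab(2)]
      by simp
    then obtain a' b' where "a' \<in> {a, arev a}" "b' \<in> {b, arev b}" "tail G a' = tail G b'" by blast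
    moreover have "a' \<in> A" "b' \<in> A" using calculation(1,2) ab(1,2) D(2) by blast+
    ultimately have "a' = b'" "{a', arev a'} = {a, arev a}" "{b', arev b'} = {b, arev b}"
      using inj_onD[OF D(3)] by auto
    then show ?thesis by simp
  qed
  ultimately show "(\<lambda>a. {a, arev a}) ` A \<in> matchings (G \<restriction> T) arev"
    unfolding matchings_def by (simp add: image_iff) blast
qed

lemma bij_betw_Union_matchings: "bij_betw (\<lambda>M. \<Union>M) (matchings (G \<restriction> T) arev) (arc_matchings T)"
proof (rule bij_betw_byWitness[where f' = "(`) (\<lambda>a. {a, arev a})"])
  show "\<forall>M\<in>matchings (G \<restriction> T) arev. (\<lambda>a. {a, arev a}) ` \<Union>M = M"
    by (intro ballI Union_matching(2))
  show "\<forall>A\<in>arc_matchings T. \<Union>((\<lambda>a. {a, arev a}) ` A) = A"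
    by (intro ballI arc_matching_edges(2))
  show "(\<lambda>M. \<Union>M) ` matchings (G \<restriction> T) arev \<subseteq> arc_matchings T"
    by (intro image_subsetI Union_matching(1))
  show "(`) (\<lambda>a. {a, arev a}) ` arc_matchings T \<subseteq> matchings (G \<restriction> T) arev"
    by (intro image_subsetI arc_matching_edges(1))
qed

lemma poly_matching_poly:
  assumes "T \<subseteq> verts G"
  shows "poly (matching_poly (G \<restriction> T) arev w V) (complex_of_real \<theta>) = complex_of_real (matching_value (\<lambda>v. \<theta> - V v) T)"
proof -
  have fin: "finite T" using assms finite_verts by (rule finite_subset)
  have "poly (matching_poly (G \<restriction> T) arev w V) (complex_of_real \<theta>) =
      (\<Sum>M\<in>matchings (G \<restriction> T) arev. (-1) ^ card M * (\<Prod>a\<in>\<Union>M. w a) *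
        (\<Prod>u\<in>T - (\<Union>e\<in>M. edge_ends (G \<restriction> T) e). complex_of_real (\<theta> - V u)))"
    unfolding matching_poly_def by (simp add: poly_sum poly_prod)
  also have "\<dots> = (\<Sum>M\<in>matchings (G \<restriction> T) arev. (-1) ^ (card (\<Union>M) div 2) * (\<Prod>a\<in>\<Union>M. w a) *
        (\<Prod>u\<in>T - tail G ` \<Union>M. complex_of_real (\<theta> - V u)))"
    by (rule sum.cong[OF refl]) (simp only: Union_matching(3,4))
  also have "\<dots> = matching_sum w (\<lambda>u. complex_of_real (\<theta> - V u)) T"
    unfolding matching_sum_def by (rule sum.reindex_bij_betw[OF bij_betw_Union_matchings])
  also have "\<dots> = complex_of_real (matching_value (\<lambda>v. \<theta> - V v) T)"
    by (rule matching_sum_complex[OF fin]) (simp add: weight_arev flip: complex_norm_square)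
  finally show ?thesis .
qed

text \<open>Each vertex is left by its arc of \<open>C\<close> and by the reverse of the arc
  entering it. These differ because \<open>C\<close> contains no reversed pair, which also gives a
  loop degree two.\<close>

lemma two_regular_if_oriented_cycle:
  assumes "C \<in> oriented_cycles (verts G)"
  shows "\<lparr>verts = tail G ` C, arcs = C \<union> arev ` C, tail = tail G, head = head G\<rparr> \<in> two_regular_subgraphs G arev"
    (is "?H \<in> _")
proof -
  have C: "C \<subseteq> arcs G" "inj_on (tail G) C" "inj_on (head G) C" "tail G ` C = head G ` C" "\<And>e. e \<in> C \<Longrightarrow> arev e \<notin> C"
    using assms unfolding oriented_cycles_def by blast+
  have tail_in: "tail G e \<in> tail G ` C" if "e \<in> C" for e
    using that by (rule imageI)
  have head_in: "head G e \<in> tail G ` C" if "e \<in> C" for e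
    unfolding C(4) using that by (rule imageI)
  have arcs: "e \<in> arcs G" if "e \<in> C" for e using C(1) that by blast
  have "wf_digraph ?H"
    by unfold_locales (use tail_in head_in arcs in \<open>auto simp del: image_eqI\<close>)
  then have "subgraph ?H G"
    using wf_digraph_axioms arcs by (auto simp: subgraph_def compatible_def)
  moreover have "out_degree ?H v = 2" if v: "v \<in> tail G ` C" for v
  proof -
    obtain a where a: "a \<in> C" "tail G a = v" using v by blast
    obtain b where b: "b \<in> C" "head G b = v" using v unfolding C(4) by blast
    have "out_arcs ?H v = {a, arev b}"
    proof (rule Set.set_eqI)
      show "e \<in> out_arcs ?H v \<longleftrightarrow> e \<in> {a, arev b}" for e
      proof
        assume "e \<in> out_arcs ?H v"
        then have "e \<in> C \<and> tail G e = v \<or> (\<exists>f\<in>C. e = arev f \<and> tail G e = v)" by auto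
        then show "e \<in> {a, arev b}"
        proof (elim disjE bexE conjE)
          assume "e \<in> C" "tail G e = v"
          then show ?thesis using inj_onD[OF C(2), of e a] a by simp
        next
          fix f assume f: "f \<in> C" "e = arev f" "tail G e = v"
          then have "head G f = v" using arcs[of f] by simp
          then show ?thesis using inj_onD[OF C(3), of f b] b f by simp
        qed
      next
        assume "e \<in> {a, arev b}"
        then show "e \<in> out_arcs ?H v" using a b arcs[OF b(1)] by auto
      qed
    qed
    moreover have "a \<noteq> arev b" using C(5)[OF b(1)] a(1) by blast
    ultimately show ?thesis by (simp add: out_degree_def)
  qed
  ultimately show ?thesis by (auto simp: two_regular_subgraphs_def)
qed

lemma awalk_verts_cas:
  "cas u p v \<Longrightarrow> awalk_verts u p = u # map (head G) p"
  "cas u p v \<Longrightarrow> awalk_verts u p = map (tail G) p @ [v]"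
  by (induction p arbitrary: u) auto

lemma oriented_cycle_if_graph_cycle:
  assumes "graph_cycle G arev p"
  shows "set p \<in> oriented_cycles (verts G)" "set p \<noteq> {}"
proof -
  from assms obtain u where p: "awalk u p u" "distinct (tl (awalk_verts u p))" "p \<noteq> []" "\<forall>a\<in>set p. arev a \<notin> set p"
    unfolding graph_cycle_def cycle_def by blast
  have cas: "cas u p u" and arcs: "set p \<subseteq> arcs G" using p(1) by (auto simp: awalk_def)
  \<comment> \<open>The vertices of a closed walk are its tails followed by the end, or its start
    followed by the heads; so heads and tails agree as multisets, and distinct heads give distinct
    tails.\<close>
  have "mset (map (tail G) p @ [u]) = mset (u # map (head G) p)"
    using awalk_verts_cas[OF cas] by simp
  then have mset: "mset (map (tail G) p) = mset (map (head G) p)" by simp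
  have head: "distinct (map (head G) p)" using p(2) awalk_verts_cas(1)[OF cas] by simp
  then have tail: "distinct (map (tail G) p)" using mset_eq_imp_distinct_iff[OF mset] by simp
  have "tail G ` set p = head G ` set p" using mset_eq_setD[OF mset] by simp
  moreover have "tail G ` set p \<subseteq> verts G" using arcs by auto
  ultimately show "set p \<in> oriented_cycles (verts G)"
    using head tail arcs p(4) unfolding oriented_cycles_def distinct_map by blast
  show "set p \<noteq> {}" using p(3) by simp
qed

lemma induce_subgraph_verts_self: "G \<restriction> verts G = G"
proof -
  have "{e \<in> arcs G. tail G e \<in> verts G \<and> head G e \<in> verts G} = arcs G" by auto
  then show ?thesis by (simp add: induce_subgraph_def)
qed

lemma phobicD:
  assumes "phobic \<theta> G arev w V"
  shows "matching_value (\<lambda>v. \<theta> - V v) (verts G) \<noteq> 0" "cycles_vanish (\<lambda>v. \<theta> - V v) (verts G)"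
    "\<exists>C\<in>oriented_cycles (verts G). C \<noteq> {}"
proof -
  note ph = assms[unfolded phobic_def]
  have "poly (matching_poly (G \<restriction> verts G) arev w V) (complex_of_real \<theta>) \<noteq> 0"
    unfolding induce_subgraph_verts_self using ph by blast
  then show "matching_value (\<lambda>v. \<theta> - V v) (verts G) \<noteq> 0"
    unfolding poly_matching_poly[OF subset_refl] by simp
  show "cycles_vanish (\<lambda>v. \<theta> - V v) (verts G)"
    unfolding cycles_vanish_def
  proof (intro ballI impI)
    fix C assume C: "C \<in> oriented_cycles (verts G)" "C \<noteq> {}"
    let ?H = "\<lparr>verts = tail G ` C, arcs = C \<union> arev ` C, tail = tail G, head = head G\<rparr>"
    have "poly (matching_poly (G \<restriction> (verts G - verts ?H)) arev w V) (complex_of_real \<theta>) = 0"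
      using ph two_regular_if_oriented_cycle[OF C(1)] C(2) by (elim conjE ballE[of _ _ ?H]) simp_all
    then have "poly (matching_poly (G \<restriction> (verts G - tail G ` C)) arev w V) (complex_of_real \<theta>) = 0" by simp
    then show "matching_value (\<lambda>v. \<theta> - V v) (verts G - tail G ` C) = 0"
      unfolding poly_matching_poly[OF Diff_subset] by simp
  qed
  obtain p where "graph_cycle G arev p" using ph unfolding is_forest_def by blast
  then show "\<exists>C\<in>oriented_cycles (verts G). C \<noteq> {}" using oriented_cycle_if_graph_cycle by blast
qed

end

section \<open>The lifted operator on square-summable functions of the cover\<close>

lemma ell2_inner_sum_right:
  assumes "finite I" "f \<in> ell2 X" "\<And>i. i \<in> I \<Longrightarrow> h i \<in> ell2 X"
  shows "ell2_inner X f (\<lambda>p. \<Sum>i\<in>I. h i p) = (\<Sum>i\<in>I. ell2_inner X f (h i))"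
  using assms(1,3)
proof (induction I rule: finite_induct)
  case (insert i I)
  then have "ell2_inner X f (\<lambda>p. h i p + (\<Sum>i\<in>I. h i p)) = ell2_inner X f (h i) + ell2_inner X f (\<lambda>p. \<Sum>i\<in>I. h i p)"
    by (intro ell2_inner_add_right[OF assms(2)] ell2_sum(1)) simp_all
  with insert show ?case by simp
qed simp

lemma ell2_slice:
  assumes f: "f \<in> ell2 (A \<times> B)" and v: "v \<in> A"
  shows "(\<lambda>x. f (v, x)) \<in> ell2 B" "ell2_norm B (\<lambda>x. f (v, x)) \<le> ell2_norm (A \<times> B) f"
proof -
  have le: "L2_set (\<lambda>x. cmod (f (v, x))) F \<le> ell2_norm (A \<times> B) f" if F: "finite F" "F \<subseteq> B" for F
  proof -
    have "L2_set (\<lambda>x. cmod (f (v, x))) F = L2_set (\<lambda>p. cmod (f p)) (Pair v ` F)"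
      by (simp add: L2_set_def sum.reindex inj_on_def)
    also have "\<dots> \<le> ell2_norm (A \<times> B) f"
      by (rule L2_set_le_ell2_norm[OF f]) (use F v in auto)
    finally show ?thesis .
  qed
  have zero: "f (v, x) = 0" if "x \<notin> B" for x using ell2_vanishes[OF f, of "(v, x)"] that by simp
  show "(\<lambda>x. f (v, x)) \<in> ell2 B" by (rule ell2I(1)[OF zero le])
  show "ell2_norm B (\<lambda>x. f (v, x)) \<le> ell2_norm (A \<times> B) f" by (rule ell2I(2)[OF zero le])
qed

lemma ell2_fibre:
  assumes h: "h \<in> ell2 B" and v: "v \<in> A"
  shows "(\<lambda>p. if fst p = v then h (snd p) else 0) \<in> ell2 (A \<times> B)"
    "ell2_norm (A \<times> B) (\<lambda>p. if fst p = v then h (snd p) else 0) \<le> ell2_norm B h"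
proof -
  let ?f = "\<lambda>p. if fst p = v then h (snd p) else 0"
  have le: "L2_set (\<lambda>p. cmod (?f p)) F \<le> ell2_norm B h" if F: "finite F" "F \<subseteq> A \<times> B" for F
  proof -
    let ?F = "{p \<in> F. fst p = v}"
    have "(\<Sum>p\<in>F. (cmod (?f p))\<^sup>2) = (\<Sum>p\<in>?F. (cmod (?f p))\<^sup>2)"
      by (rule sum.mono_neutral_right) (use F in auto)
    also have "\<dots> = (\<Sum>x\<in>snd ` ?F. (cmod (h x))\<^sup>2)"
      by (subst sum.reindex) (auto simp: inj_on_def)
    finally have "L2_set (\<lambda>p. cmod (?f p)) F = L2_set (\<lambda>x. cmod (h x)) (snd ` ?F)"
      by (simp add: L2_set_def)
    also have "\<dots> \<le> ell2_norm B h" by (rule L2_set_le_ell2_norm[OF h]) (use F in auto)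
    finally show ?thesis .
  qed
  have zero: "?f p = 0" if "p \<notin> A \<times> B" for p
    using ell2_vanishes[OF h, of "snd p"] that v by (cases p) auto
  show "?f \<in> ell2 (A \<times> B)" by (rule ell2I(1)[OF zero le])
  show "ell2_norm (A \<times> B) ?f \<le> ell2_norm B h" by (rule ell2I(2)[OF zero le])
qed

lemma ell2_inner_product:
  assumes "finite A" "f \<in> ell2 (A \<times> B)" "h \<in> ell2 (A \<times> B)"
  shows "ell2_inner (A \<times> B) f h = (\<Sum>v\<in>A. ell2_inner B (\<lambda>x. f (v, x)) (\<lambda>x. h (v, x)))"
proof -
  have "ell2_inner (A \<times> B) f h = (\<Sum>\<^sub>\<infinity>v\<in>A. \<Sum>\<^sub>\<infinity>x\<in>B. f (v, x) \<bullet> h (v, x))"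
    unfolding ell2_inner_def
    by (rule infsum_Sigma_banach[OF ell2_inner_summable[OF assms(2,3)], symmetric])
  also have "\<dots> = (\<Sum>v\<in>A. \<Sum>\<^sub>\<infinity>x\<in>B. f (v, x) \<bullet> h (v, x))" using assms(1) by (rule infsum_finite)
  finally show ?thesis by (simp only: ell2_inner_def)
qed

context schroedinger_cover begin

abbreviation X :: "('v \<times> 'g) set" where "X \<equiv> verts G \<times> carrier \<Gamma>"

definition slices :: "('v \<times> 'g \<Rightarrow> complex) \<Rightarrow> 'v \<Rightarrow> 'g \<Rightarrow> complex" where
  "slices f = (\<lambda>v x. f (v, x))"

definition glue :: "('v \<Rightarrow> 'g \<Rightarrow> complex) \<Rightarrow> 'v \<times> 'g \<Rightarrow> complex" where
  "glue F = (\<lambda>p. if fst p \<in> verts G then F (fst p) (snd p) else 0)"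

lemma slices_in: "f \<in> ell2 X \<Longrightarrow> slices f \<in> fields (verts G)"
  by (simp add: slices_def fields_def ell2_slice(1))

lemma norm_slices: "f \<in> ell2 X \<Longrightarrow> v \<in> verts G \<Longrightarrow> norm\<^sub>H (slices f v) \<le> ell2_norm X f"
  by (simp add: slices_def ell2_slice(2))

lemma slices_glue: "v \<in> verts G \<Longrightarrow> slices (glue F) v = F v"
  by (simp add: slices_def glue_def)

lemma glue_slices: "f \<in> ell2 X \<Longrightarrow> glue (slices f) = f"
  by (auto simp: fun_eq_iff slices_def glue_def ell2_vanishes)

lemma glue_in:
  assumes "F \<in> fields (verts G)"
  shows "glue F \<in> ell2 X" "ell2_norm X (glue F) \<le> (\<Sum>v\<in>verts G. norm\<^sub>H (F v))"
proof -
  have eq: "glue F = (\<lambda>p. \<Sum>v\<in>verts G. if fst p = v then F v (snd p) else 0)"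
    by (auto simp: fun_eq_iff glue_def)
  note fib = ell2_fibre[OF fieldsD[OF assms]]
  show "glue F \<in> ell2 X" unfolding eq by (rule ell2_sum(1)[OF finite_verts]) (rule fib(1))
  have "ell2_norm X (glue F) \<le> (\<Sum>v\<in>verts G. ell2_norm X (\<lambda>p. if fst p = v then F v (snd p) else 0))"
    unfolding eq by (rule ell2_sum(2)[OF finite_verts]) (rule fib(1))
  also have "\<dots> \<le> (\<Sum>v\<in>verts G. norm\<^sub>H (F v))" by (intro sum_mono fib(2))
  finally show "ell2_norm X (glue F) \<le> (\<Sum>v\<in>verts G. norm\<^sub>H (F v))" .
qed

lemma inner_slices:
  assumes "f \<in> ell2 X" "h \<in> ell2 X"
  shows "ell2_inner X f h = (\<Sum>v\<in>verts G. inner\<^sub>H (slices f v) (slices h v))"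
  unfolding slices_def by (rule ell2_inner_product[OF finite_verts assms])

lemma arcs_into_verts: "arcs_into v (verts G) = out_arcs G v"
  by (auto simp: arcs_into_def)

text \<open>Fixes the sign convention: the lifted operator minus \<theta> is the negative of
  \<open>cover_op\<close>, slice by slice.\<close>

lemma lifted_op_eq_glue:
  assumes f: "f \<in> ell2 X"
  shows "(\<lambda>p. lifted_op G w V \<Gamma> g f p - complex_of_real \<theta> * f p) =
    glue (\<lambda>v x. - cover_op (\<lambda>v. \<theta> - V v) (verts G) (slices f) v x)"
proof
  fix p :: "'v \<times> 'g"
  obtain v x where p: "p = (v, x)" by (cases p)
  consider "v \<notin> verts G" | "v \<in> verts G" "x \<notin> carrier \<Gamma>" | "v \<in> verts G" "x \<in> carrier \<Gamma>" by blast
  then show "lifted_op G w V \<Gamma> g f p - complex_of_real \<theta> * f p =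
    glue (\<lambda>v x. - cover_op (\<lambda>v. \<theta> - V v) (verts G) (slices f) v x) p"
  proof cases
    case 1
    then have "f p = 0" using ell2_vanishes[OF f] by (simp add: p)
    with 1 show ?thesis by (simp add: p lifted_op_def schroedinger_op_def derived_graph_def glue_def)
  next
    case 2
    then have "f p = 0" using ell2_vanishes[OF f] by (simp add: p)
    with 2 show ?thesis
      by (simp add: p lifted_op_def schroedinger_op_def derived_graph_def glue_def cover_op_def translate_def slices_def)
  next
    case 3
    have "(\<Sum>e\<in>arcs_into v (verts G). w e * translate e (slices f (head G e)) x) =
        (\<Sum>e\<in>out_arcs G v. w e * f (head G e, x \<otimes>\<^bsub>\<Gamma>\<^esub> g e))"
      unfolding arcs_into_verts using 3 by (simp add: translate_def slices_def)
    then show ?thesis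
      unfolding p lifted_op_apply[OF 3] using 3 by (simp add: glue_def cover_op_def slices_def algebra_simps)
  qed
qed

lemma lifted_op_eq_glue_0:
  assumes f: "f \<in> ell2 X"
  shows "lifted_op G w V \<Gamma> g f = glue (\<lambda>v x. - cover_op (\<lambda>v. - V v) (verts G) (slices f) v x)"
  using lifted_op_eq_glue[OF f, of V 0] by simp

lemma neg_cover_op_in:
  assumes "F \<in> fields (verts G)"
  shows "(\<lambda>v x. - cover_op d (verts G) F v x) \<in> fields (verts G)"
  using ell2_scale[OF cover_op_in[OF assms], of _ "-1" d] by (simp add: fields_def)

lemma norm_cover_op_le:
  assumes f: "f \<in> ell2 X" and v: "v \<in> verts G"
  shows "norm\<^sub>H (cover_op d (verts G) (slices f) v) \<le>
    (\<bar>d v\<bar> + (\<Sum>e\<in>arcs_into v (verts G). cmod (w e))) * ell2_norm X f"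
proof -
  note F = slices_in[OF f]
  note S = sum_translate_in[OF F subset_refl, of v]
  have "norm\<^sub>H (cover_op d (verts G) (slices f) v) \<le> norm\<^sub>H (\<lambda>x. complex_of_real (d v) * slices f v x) +
      norm\<^sub>H (\<lambda>x. \<Sum>e\<in>arcs_into v (verts G). w e * translate e (slices f (head G e)) x)"
    unfolding cover_op_def by (rule ell2_diff(2)[OF ell2_scale[OF fieldsD[OF F v]] S(1)])
  also have "\<dots> \<le> \<bar>d v\<bar> * ell2_norm X f + (\<Sum>e\<in>arcs_into v (verts G). cmod (w e) * ell2_norm X f)"
  proof (rule add_mono)
    show "norm\<^sub>H (\<lambda>x. complex_of_real (d v) * slices f v x) \<le> \<bar>d v\<bar> * ell2_norm X f"
      unfolding ell2_norm_scale norm_of_real by (intro mult_left_mono norm_slices[OF f v]) simp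
    have "(\<Sum>e\<in>arcs_into v (verts G). cmod (w e) * norm\<^sub>H (slices f (head G e))) \<le> (\<Sum>e\<in>arcs_into v (verts G). cmod (w e) * ell2_norm X f)"
      by (intro sum_mono mult_left_mono norm_slices[OF f]) (simp_all add: arcs_into_def)
    with S(2) show "norm\<^sub>H (\<lambda>x. \<Sum>e\<in>arcs_into v (verts G). w e * translate e (slices f (head G e)) x) \<le>
        (\<Sum>e\<in>arcs_into v (verts G). cmod (w e) * ell2_norm X f)" by (rule order_trans)
  qed
  also have "\<dots> = (\<bar>d v\<bar> + (\<Sum>e\<in>arcs_into v (verts G). cmod (w e))) * ell2_norm X f"
    by (simp only: distrib_right sum_distrib_right)
  finally show ?thesis .
qed

lemma sum_inner_cover_op:
  assumes K: "K \<in> fields (verts G)" and F: "F \<in> fields (verts G)"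
  shows "(\<Sum>v\<in>verts G. inner\<^sub>H (K v) (cover_op d (verts G) F v)) =
    (\<Sum>v\<in>verts G. d v * inner\<^sub>H (K v) (F v)) -
    (\<Sum>e\<in>arcs G. inner\<^sub>H (K (tail G e)) (\<lambda>x. w e * translate e (F (head G e)) x))"
proof -
  have in_H: "(\<lambda>x. w e * translate e (F (head G e)) x) \<in> H" if "e \<in> arcs_into v (verts G)" for e v
    using that by (intro ell2_scale translate_in fieldsD[OF F]) (simp_all add: arcs_into_def)
  have "inner\<^sub>H (K v) (cover_op d (verts G) F v) = d v * inner\<^sub>H (K v) (F v) -
      (\<Sum>e\<in>arcs_into v (verts G). inner\<^sub>H (K v) (\<lambda>x. w e * translate e (F (head G e)) x))" if v: "v \<in> verts G" for v
  proof -
    have "inner\<^sub>H (K v) (cover_op d (verts G) F v) = inner\<^sub>H (K v) (\<lambda>x. complex_of_real (d v) * F v x) -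
        inner\<^sub>H (K v) (\<lambda>x. \<Sum>e\<in>arcs_into v (verts G). w e * translate e (F (head G e)) x)"
      unfolding cover_op_def
      by (rule ell2_inner_diff_right[OF fieldsD[OF K v] ell2_scale[OF fieldsD[OF F v]] sum_translate_in(1)[OF F subset_refl]])
    also have "inner\<^sub>H (K v) (\<lambda>x. \<Sum>e\<in>arcs_into v (verts G). w e * translate e (F (head G e)) x) =
        (\<Sum>e\<in>arcs_into v (verts G). inner\<^sub>H (K v) (\<lambda>x. w e * translate e (F (head G e)) x))"
      by (rule ell2_inner_sum_right[OF finite_arcs_into fieldsD[OF K v] in_H])
    finally show ?thesis unfolding ell2_inner_scale_right .
  qed
  then have "(\<Sum>v\<in>verts G. inner\<^sub>H (K v) (cover_op d (verts G) F v)) = (\<Sum>v\<in>verts G. d v * inner\<^sub>H (K v) (F v)) -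
      (\<Sum>v\<in>verts G. \<Sum>e\<in>arcs_into v (verts G). inner\<^sub>H (K v) (\<lambda>x. w e * translate e (F (head G e)) x))"
    by (simp add: sum_subtractf)
  also have "(\<Sum>v\<in>verts G. \<Sum>e\<in>arcs_into v (verts G). inner\<^sub>H (K v) (\<lambda>x. w e * translate e (F (head G e)) x)) =
      (\<Sum>v\<in>verts G. \<Sum>e | e \<in> arcs G \<and> tail G e = v. inner\<^sub>H (K (tail G e)) (\<lambda>x. w e * translate e (F (head G e)) x))"
    by (intro sum.cong refl) (auto simp: arcs_into_def)
  also have "\<dots> = (\<Sum>e\<in>arcs G. inner\<^sub>H (K (tail G e)) (\<lambda>x. w e * translate e (F (head G e)) x))"
    by (rule sum.group) auto
  finally show ?thesis .
qed

text \<open>The term of an arc with \<open>K\<close> and \<open>F\<close> equals the term of the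
  reversed arc with \<open>F\<close> and \<open>K\<close>, by conjugate weights and adjoint
  translations.\<close>

lemma cover_op_symmetric:
  assumes K: "K \<in> fields (verts G)" and F: "F \<in> fields (verts G)"
  shows "(\<Sum>v\<in>verts G. inner\<^sub>H (K v) (cover_op d (verts G) F v)) = (\<Sum>v\<in>verts G. inner\<^sub>H (F v) (cover_op d (verts G) K v))"
proof -
  let ?t = "\<lambda>K F e. inner\<^sub>H (K (tail G e)) (\<lambda>x. w e * translate e (F (head G e)) x)"
  have "?t K F e = ?t F K (arev e)" if e: "e \<in> arcs G" for e
  proof -
    have "?t K F e = inner\<^sub>H (\<lambda>x. w e * translate e (F (head G e)) x) (K (tail G e))"
      by (rule ell2_inner_commute)
    also have "\<dots> = inner\<^sub>H (translate e (F (head G e))) (\<lambda>x. w (arev e) * K (tail G e) x)"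
      unfolding ell2_inner_cnj weight_arev[OF e] ..
    also have "\<dots> = inner\<^sub>H (F (head G e)) (\<lambda>x. w (arev e) * translate (arev e) (K (tail G e)) x)"
      unfolding inner_translate[OF e] translate_scale ..
    finally show ?thesis using e by simp
  qed
  then have "(\<Sum>e\<in>arcs G. ?t K F e) = (\<Sum>e\<in>arcs G. ?t F K (arev e))" by (intro sum.cong) simp_all
  also have "\<dots> = (\<Sum>e\<in>arcs G. ?t F K e)"
    by (rule sum.reindex_bij_witness[of _ arev arev]) simp_all
  finally have "(\<Sum>e\<in>arcs G. ?t K F e) = (\<Sum>e\<in>arcs G. ?t F K e)" .
  then show ?thesis
    unfolding sum_inner_cover_op[OF K F] sum_inner_cover_op[OF F K] by (simp only: ell2_inner_commute[of _ "K _" "F _"])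
qed

lemma inner_lifted_op:
  assumes f: "f \<in> ell2 X" and h: "h \<in> ell2 X"
  shows "ell2_inner X h (\<lambda>p. lifted_op G w V \<Gamma> g f p - complex_of_real \<theta> * f p) =
    - (\<Sum>v\<in>verts G. inner\<^sub>H (slices h v) (cover_op (\<lambda>v. \<theta> - V v) (verts G) (slices f) v))"
proof -
  have neg: "inner\<^sub>H k (\<lambda>x. - l x) = - inner\<^sub>H k l" for k l
    using ell2_inner_scale_right[of "carrier \<Gamma>" k "-1" l] by simp
  note in_X = glue_in(1)[OF neg_cover_op_in[OF slices_in[OF f]]]
  show ?thesis
    unfolding lifted_op_eq_glue[OF f] inner_slices[OF h in_X]
    by (simp add: slices_glue neg sum_negf)
qed

lemma ell2_symmetric_lifted_op:
  "\<exists>B. ell2_symmetric_local X (lifted_op G w V \<Gamma> g) B"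
proof -
  let ?T = "lifted_op G w V \<Gamma> g"
  let ?B = "\<Sum>v\<in>verts G. \<bar>- V v\<bar> + (\<Sum>e\<in>arcs_into v (verts G). cmod (w e))"
  have "ell2_symmetric_local X ?T ?B"
  proof
    fix f assume f: "f \<in> ell2 X"
    note N = neg_cover_op_in[OF slices_in[OF f]]
    show "?T f \<in> ell2 X" unfolding lifted_op_eq_glue_0[OF f] by (rule glue_in(1)[OF N])
    have "ell2_norm X (?T f) \<le> (\<Sum>v\<in>verts G. norm\<^sub>H (\<lambda>x. - cover_op (\<lambda>v. - V v) (verts G) (slices f) v x))"
      unfolding lifted_op_eq_glue_0[OF f] by (rule glue_in(2)[OF N])
    also have "\<dots> = (\<Sum>v\<in>verts G. norm\<^sub>H (cover_op (\<lambda>v. - V v) (verts G) (slices f) v))"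
      by (simp add: ell2_norm_def)
    also have "\<dots> \<le> (\<Sum>v\<in>verts G. (\<bar>- V v\<bar> + (\<Sum>e\<in>arcs_into v (verts G). cmod (w e))) * ell2_norm X f)"
      by (intro sum_mono norm_cover_op_le[OF f])
    also have "\<dots> = ?B * ell2_norm X f" by (simp only: sum_distrib_right)
    finally show "ell2_norm X (?T f) \<le> ?B * ell2_norm X f" .
    show "?T (\<lambda>p. c * f p) = (\<lambda>p. c * ?T f p)" for c
      by (auto simp: lifted_op_def schroedinger_op_def fun_eq_iff sum_distrib_left distrib_left mult_ac)
    fix h assume h: "h \<in> ell2 X"
    show "?T (\<lambda>p. f p + h p) = (\<lambda>p. ?T f p + ?T h p)"
      by (auto simp: lifted_op_def schroedinger_op_def fun_eq_iff sum.distrib distrib_left)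
    show "ell2_inner X (?T f) h = ell2_inner X f (?T h)"
      using inner_lifted_op[OF f h, of V 0] inner_lifted_op[OF h f, of V 0]
        cover_op_symmetric[OF slices_in[OF h] slices_in[OF f], of "\<lambda>v. 0 - V v"]
      by (simp add: ell2_inner_commute[of X "?T f"])
  next
    fix F and f :: "'v \<times> 'g \<Rightarrow> complex" and p assume lim: "\<And>p. (\<lambda>n. F n p) \<longlonglongrightarrow> f p"
    show "(\<lambda>n. ?T (F n) p) \<longlonglongrightarrow> ?T f p"
    proof (cases "p \<in> verts (derived_graph G \<Gamma> g)")
      case True
      then show ?thesis
        unfolding lifted_op_def schroedinger_op_def
        by (simp only: if_True) (intro tendsto_add tendsto_sum tendsto_mult tendsto_const lim)
    qed (simp add: lifted_op_def schroedinger_op_def)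
  qed
  then show ?thesis ..
qed

lemma lifted_op_bounded_below:
  assumes "regular (\<lambda>v. \<theta> - V v) (verts G)"
  shows "\<exists>c>0. \<forall>f\<in>ell2 X. c * ell2_norm X f \<le> ell2_norm X (\<lambda>p. lifted_op G w V \<Gamma> g f p - complex_of_real \<theta> * f p)"
proof -
  let ?d = "\<lambda>v. \<theta> - V v"
  have "controlled ?d (verts G) (\<lambda>F. \<Sum>v\<in>verts G. norm\<^sub>H (F v))"
    by (rule controlled_sum[OF finite_verts]) (use assms in \<open>simp add: regular_def\<close>)
  then obtain C where C: "\<forall>F\<in>fields (verts G).
      (\<Sum>v\<in>verts G. norm\<^sub>H (F v)) \<le> C * (\<Sum>v\<in>verts G. norm\<^sub>H (cover_op ?d (verts G) F v))"
    unfolding controlled_def by blast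
  \<comment> \<open>The sum of the equation norms is at most the number of vertices times the norm
    of the image. The summand 1 keeps \<open>K\<close> positive.\<close>
  define K where "K = \<bar>C\<bar> * real (card (verts G)) + 1"
  have K: "K > 0" by (simp add: K_def add_nonneg_pos)
  have "1 / K * ell2_norm X f \<le> ell2_norm X (\<lambda>p. lifted_op G w V \<Gamma> g f p - complex_of_real \<theta> * f p)"
    if f: "f \<in> ell2 X" for f
  proof -
    let ?A = "\<lambda>p. lifted_op G w V \<Gamma> g f p - complex_of_real \<theta> * f p"
    note F = slices_in[OF f] and eq = lifted_op_eq_glue[OF f, of V \<theta>]
    have A: "?A \<in> ell2 X" unfolding eq by (rule glue_in(1)[OF neg_cover_op_in[OF F]])
    have le: "norm\<^sub>H (cover_op ?d (verts G) (slices f) v) \<le> ell2_norm X ?A" if v: "v \<in> verts G" for v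
    proof -
      have "norm\<^sub>H (cover_op ?d (verts G) (slices f) v) = norm\<^sub>H (slices ?A v)"
        unfolding eq slices_glue[OF v] by (simp add: ell2_norm_def)
      also have "\<dots> \<le> ell2_norm X ?A" by (rule norm_slices[OF A v])
      finally show ?thesis .
    qed
    have "ell2_norm X f = ell2_norm X (glue (slices f))" unfolding glue_slices[OF f] ..
    also have "\<dots> \<le> (\<Sum>v\<in>verts G. norm\<^sub>H (slices f v))" by (rule glue_in(2)[OF F])
    also have "\<dots> \<le> C * (\<Sum>v\<in>verts G. norm\<^sub>H (cover_op ?d (verts G) (slices f) v))" by (rule bspec[OF C F])
    also have "\<dots> \<le> \<bar>C\<bar> * (\<Sum>v\<in>verts G. norm\<^sub>H (cover_op ?d (verts G) (slices f) v))"
      by (intro mult_right_mono sum_nonneg) simp_all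
    also have "\<dots> \<le> \<bar>C\<bar> * (\<Sum>v\<in>verts G. ell2_norm X ?A)" by (intro mult_left_mono sum_mono le) simp_all
    also have "\<dots> = \<bar>C\<bar> * real (card (verts G)) * ell2_norm X ?A" by simp
    also have "\<dots> \<le> K * ell2_norm X ?A" unfolding K_def by (intro mult_right_mono) simp_all
    finally show ?thesis using K by (simp add: pos_divide_le_eq mult.commute)
  qed
  then show ?thesis using K by (intro exI[of _ "1 / K"]) simp
qed

lemma lifted_op_surjective:
  assumes "regular (\<lambda>v. \<theta> - V v) (verts G)" and h: "h \<in> ell2 X"
  shows "\<exists>f\<in>ell2 X. (\<lambda>p. lifted_op G w V \<Gamma> g f p - complex_of_real \<theta> * f p) = h"
proof -
  let ?d = "\<lambda>v. \<theta> - V v"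
  have "(\<lambda>p. - 1 * h p) \<in> ell2 X" using h by (rule ell2_scale)
  from slices_in[OF this] obtain F where F: "F \<in> fields (verts G)"
    "\<And>v. v \<in> verts G \<Longrightarrow> cover_op ?d (verts G) F v = slices (\<lambda>p. - 1 * h p) v"
    using assms(1) unfolding regular_def by blast
  have "cover_op ?d (verts G) (slices (glue F)) v x = - h (v, x)" if v: "v \<in> verts G" for v x
  proof -
    have "cover_op ?d (verts G) (slices (glue F)) v = cover_op ?d (verts G) F v"
      by (rule cover_op_cong) (use v in \<open>auto simp: slices_glue\<close>)
    then show ?thesis unfolding F(2)[OF v] by (simp add: slices_def)
  qed
  then have "glue (\<lambda>v x. - cover_op ?d (verts G) (slices (glue F)) v x) = glue (slices h)"
    by (auto simp: glue_def slices_def fun_eq_iff)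
  also have "\<dots> = h" by (rule glue_slices[OF h])
  finally show ?thesis
    using glue_in(1)[OF F(1)] lifted_op_eq_glue[OF glue_in(1)[OF F(1)], of V \<theta>] by (intro bexI[of _ "glue F"]) simp_all
qed

lemma inner_lifted_op_glue:
  assumes "F \<in> fields (verts G)"
  shows "ell2_inner X (glue F) (\<lambda>p. lifted_op G w V \<Gamma> g (glue F) p - complex_of_real \<theta> * glue F p) =
    - cover_form (\<lambda>v. \<theta> - V v) (verts G) F"
proof -
  note f = glue_in(1)[OF assms]
  have "cover_op (\<lambda>v. \<theta> - V v) (verts G) (slices (glue F)) v = cover_op (\<lambda>v. \<theta> - V v) (verts G) F v" if "v \<in> verts G" for v
    by (rule cover_op_cong) (use that in \<open>auto simp: slices_glue\<close>)
  then show ?thesis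
    unfolding inner_lifted_op[OF f f] cover_form_def by (simp add: slices_glue)
qed

theorem lifted_op_spectral_gap:
  assumes "cycles_vanish (\<lambda>v. \<theta> - V v) (verts G)" "matching_value (\<lambda>v. \<theta> - V v) (verts G) \<noteq> 0"
    and C: "C \<in> oriented_cycles (verts G)" "C \<noteq> {}"
  shows "complex_of_real \<theta> \<notin> cover_spectrum G w V \<Gamma> g"
    and "\<exists>\<theta>\<^sub>1 \<theta>\<^sub>2. complex_of_real \<theta>\<^sub>1 \<in> cover_spectrum G w V \<Gamma> g \<and> complex_of_real \<theta>\<^sub>2 \<in> cover_spectrum G w V \<Gamma> g \<and>
      \<theta>\<^sub>1 < \<theta> \<and> \<theta> < \<theta>\<^sub>2"
    and "\<not> topological_space_class.connected (cover_spectrum G w V \<Gamma> g)"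
proof -
  let ?T = "lifted_op G w V \<Gamma> g"
  have spec: "cover_spectrum G w V \<Gamma> g = ell2_spectrum X ?T"
    by (simp add: cover_spectrum_def derived_graph_def)
  obtain B where "ell2_symmetric_local X ?T B" using ell2_symmetric_lifted_op by blast
  then interpret ell2_symmetric_local X ?T B .
  have reg: "regular (\<lambda>v. \<theta> - V v) (verts G)" by (rule regular_if_cycles_vanish[OF finite_verts assms(1,2)])
  obtain c where c: "c > 0" "\<And>f. f \<in> ell2 X \<Longrightarrow> c * ell2_norm X f \<le> ell2_norm X (\<lambda>p. ?T f p - complex_of_real \<theta> * f p)"
    using lifted_op_bounded_below[OF reg] by blast
  have surj: "solvable_at (complex_of_real \<theta>)"
    unfolding solvable_at_def by (intro ballI lifted_op_surjective[OF reg])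
  have "indefinite (\<lambda>v. \<theta> - V v) (verts G)" by (rule indefinite_if_cycle[OF finite_verts assms])
  then obtain F F' where F: "F \<in> fields (verts G)" "cover_form (\<lambda>v. \<theta> - V v) (verts G) F > 0"
    and F': "F' \<in> fields (verts G)" "cover_form (\<lambda>v. \<theta> - V v) (verts G) F' < 0"
    unfolding indefinite_def by blast
  \<comment> \<open>The sign change of \<open>inner_lifted_op_glue\<close> turns a positive value of
    the form into a vector below \<theta>.\<close>
  have below: "ell2_inner X (glue F) (\<lambda>p. ?T (glue F) p - complex_of_real \<theta> * glue F p) < 0"
    unfolding inner_lifted_op_glue[OF F(1)] using F(2) by simp
  have above: "ell2_inner X (glue F') (\<lambda>p. ?T (glue F') p - complex_of_real \<theta> * glue F' p) > 0"
    unfolding inner_lifted_op_glue[OF F'(1)] using F'(2) by simp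
  note gap = spectral_gap[OF c surj glue_in(1)[OF F(1)] below glue_in(1)[OF F'(1)] above]
  show "complex_of_real \<theta> \<notin> cover_spectrum G w V \<Gamma> g" unfolding spec by (rule gap(1))
  show "\<exists>\<theta>\<^sub>1 \<theta>\<^sub>2. complex_of_real \<theta>\<^sub>1 \<in> cover_spectrum G w V \<Gamma> g \<and> complex_of_real \<theta>\<^sub>2 \<in> cover_spectrum G w V \<Gamma> g \<and>
      \<theta>\<^sub>1 < \<theta> \<and> \<theta> < \<theta>\<^sub>2" unfolding spec by (rule gap(2))
  show "\<not> topological_space_class.connected (cover_spectrum G w V \<Gamma> g)" unfolding spec by (rule gap(3))
qed

end

theorem theorem6p3:
  fixes G :: "('v, 'e) pre_digraph"
    and arev :: "'e \<Rightarrow> 'e"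
    and w :: "'e \<Rightarrow> complex"
    and V :: "'v \<Rightarrow> real"
    and \<theta> :: real
    and \<Gamma> :: "('g, 'm) monoid_scheme"
    and g :: "'e \<Rightarrow> 'g"
  assumes "fin_digraph G"
    and "schroedinger_weights G arev w"
    and "phobic \<theta> G arev w V"
    and "Group.group \<Gamma>"
    and "voltage_assignment G arev \<Gamma> g"
  shows "complex_of_real \<theta> \<notin> cover_spectrum G w V \<Gamma> g
    \<and> (\<exists>\<theta>\<^sub>1 \<theta>\<^sub>2. complex_of_real \<theta>\<^sub>1 \<in> cover_spectrum G w V \<Gamma> g
          \<and> complex_of_real \<theta>\<^sub>2 \<in> cover_spectrum G w V \<Gamma> g
          \<and> \<theta>\<^sub>1 < \<theta> \<and> \<theta> < \<theta>\<^sub>2)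
    \<and> \<not> topological_space_class.connected (cover_spectrum G w V \<Gamma> g)"
proof -
  interpret fin_digraph G by fact
  interpret schroedinger_weights G arev w by fact
  interpret \<Gamma>: group \<Gamma> by fact
  interpret schroedinger_cover G arev w \<Gamma> g by unfold_locales fact
  obtain C where "C \<in> oriented_cycles (verts G)" "C \<noteq> {}"
    using phobicD(3)[OF assms(3)] by blast
  note gap = lifted_op_spectral_gap[OF phobicD(2,1)[OF assms(3)] this]
  show ?thesis by (intro conjI gap)
qed

end
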